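(* Let $V$ be an $\mathrm{FI}$-module over a commutative ring $\Bbbk$ which is generated in degree $\leqslant k$ and related in degree $\leqslant d$, where $k,d\in\mathbb{Z}_+$. Let $$\mathrm{hd}_1^S(V):=\max\{\mathrm{hd}_1(S^iV)+i\mid i=0,1,\ldots,\mathrm{N}(V)\}.$$ Then $$\mathrm{reg}(V)\leqslant \mathrm{hd}_1^S(V)-1.$$
   Context: $\Bbbk$ is a commutative ring and $\mathbb{Z}_+$ is the set of non-negative integers. $\mathrm{FI}$ is the category whose objects are finite sets and whose morphisms are injective maps. An $\mathrm{FI}$-module is a functor $V$ from $\mathrm{FI}$ to the category of $\Bbbk$-modules; write $V_X$ for $V(X)$ and $f_*$ for the map induced by an injection $f$. FI-modules form an abelian category (exactness computed objectwise); "projective" means projective object in this category. For $n\in\mathbb{Z}_+$, $\mathbf{n}=\{1,\ldots,n\}$ ($\mathbf 0=\emptyset$). The supremum of an empty set is $-\infty$ and the infimum of an empty set is $\infty$. FI-homology: for an $\mathrm{FI}$-module $V$, let $(JV)_X\subset V_X$ be the span of the images of $f_*:V_Y\to V_X$ for all injections $f:Y\to X$ with $|Y|<|X|$; $F(V):=V/JV$ is a right exact functor on $\mathrm{FI}$-modules, and $H_a$ ($a\in\mathbb{Z}_+$) is its $a$-th left derived functor. $V$ is $F$-acyclic if $H_a(V)=0$ for every $a\geqslant1$. Shift: fix a one-element set $\{\star\}$; $SV$ is the $\mathrm{FI}$-module with $(SV)_X=V_{X\sqcup\{\star\}}$ and with an injection $f$ acting through $f\sqcup\mathrm{id}_{\{\star\}}$;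 $S^i$ is the $i$-fold iterate. Degrees: $\deg(V):=\sup\{n\in\mathbb{Z}_+\mid V_{\mathbf n}\neq0\}$; $\mathrm{hd}_a(V):=\deg H_a(V)$; $\mathrm{reg}(V)$ is the infimum of the set of all $c\in\mathbb{Z}$ such that $\mathrm{hd}_a(V)\leqslant c+a$ for every integer $a\geqslant1$. $V$ is generated in degree $\leqslant k$ if $\mathrm{hd}_0(V)\leqslant k$. $V$ is generated in degree $\leqslant k$ and related in degree $\leqslant d$ if there is a short exact sequence $0\to W\to P\to V\to0$ of $\mathrm{FI}$-modules where $P$ is projective and generated in degree $\leqslant k$ and $W$ is generated in degree $\leqslant d$. For such $V$, it is known that $S^iV$ is $F$-acyclic for every $i\geqslant\min\{k,d\}+d$; $\mathrm{N}(V)$ denotes the minimum $i\in\mathbb{Z}_+$ such that $S^iV$ is $F$-acyclic. *)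

theory Defs
  imports "HOL-Algebra.Module" "HOL-Algebra.AbelCoset"
    "HOL-Library.Extended_Real" "HOL-Library.FSet"
begin

section \<open>Modules\<close>

definition mod_homs ::
  "('k, 'r) ring_scheme \<Rightarrow> ('k, 'a, 'm) module_scheme \<Rightarrow> ('k, 'b, 'n) module_scheme \<Rightarrow> ('a \<Rightarrow> 'b) set"
  where "mod_homs R M N = {h \<in> carrier M \<rightarrow> carrier N.
    (\<forall>x\<in>carrier M. \<forall>y\<in>carrier M. h (x \<oplus>\<^bsub>M\<^esub> y) = h x \<oplus>\<^bsub>N\<^esub> h y) \<and>
    (\<forall>r\<in>carrier R. \<forall>x\<in>carrier M. h (r \<odot>\<^bsub>M\<^esub> x) = r \<odot>\<^bsub>N\<^esub> h x)}"

text \<open>The quotient of \<open>M\<close> by a submodule \<open>N\<close>; the ring multiplication and unit of the module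
  record play no role in \<^locale>\<open>Module.module\<close>.\<close>

definition mod_quot :: "('k, 'a) module \<Rightarrow> 'a set \<Rightarrow> ('k, 'a set) module"
  where "mod_quot M N = \<lparr>carrier = a_rcosets\<^bsub>M\<^esub> N, mult = undefined, one = undefined,
    zero = N, add = set_add M, smult = (\<lambda>r C. \<Union>x\<in>C. N +>\<^bsub>M\<^esub> (r \<odot>\<^bsub>M\<^esub> x))\<rparr>"

text \<open>The map into the quotient of \<open>M\<close> by \<open>N\<close> that is induced on cosets by a map \<open>h\<close> into \<open>M\<close>.\<close>

definition quot_map :: "('k, 'b) module \<Rightarrow> 'b set \<Rightarrow> ('a \<Rightarrow> 'b) \<Rightarrow> 'a set \<Rightarrow> 'b set"
  where "quot_map M N h C = (\<Union>x\<in>C. N +>\<^bsub>M\<^esub> h x)"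


section \<open>FI-modules\<close>

text \<open>FI is represented by its (equivalent) full subcategory of finite sets of natural numbers.
  A morphism is an injection that is \<^const>\<open>undefined\<close> off its domain, so that equality of
  morphisms is equality of functions.\<close>

definition FI_hom :: "nat set \<Rightarrow> nat set \<Rightarrow> (nat \<Rightarrow> nat) set"
  where "FI_hom X Y = {f \<in> X \<rightarrow>\<^sub>E Y. inj_on f X}"

record ('k, 'a) fi_mod =
  Ob :: "nat set \<Rightarrow> ('k, 'a) module"
  Ar :: "nat set \<Rightarrow> nat set \<Rightarrow> (nat \<Rightarrow> nat) \<Rightarrow> 'a \<Rightarrow> 'a"

text \<open>The values of \<^const>\<open>Ob\<close> and \<^const>\<open>Ar\<close> outside FI are irrelevant.\<close>

locale fi_module =
  fixes R :: "('k, 'r) ring_scheme" and V :: "('k, 'a) fi_mod"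
  assumes Ob_module: "finite X \<Longrightarrow> Module.module R (Ob V X)"
    and Ar_hom: "\<lbrakk>finite X; finite Y; f \<in> FI_hom X Y\<rbrakk> \<Longrightarrow> Ar V X Y f \<in> mod_homs R (Ob V X) (Ob V Y)"
    and Ar_id: "\<lbrakk>finite X; v \<in> carrier (Ob V X)\<rbrakk> \<Longrightarrow> Ar V X X (\<lambda>x\<in>X. x) v = v"
    and Ar_comp: "\<lbrakk>finite X; finite Y; finite Z; f \<in> FI_hom X Y; g \<in> FI_hom Y Z; v \<in> carrier (Ob V X)\<rbrakk>
      \<Longrightarrow> Ar V X Z (compose X g f) v = Ar V Y Z g (Ar V X Y f v)"

definition fi_hom ::
  "('k, 'r) ring_scheme \<Rightarrow> ('k, 'a) fi_mod \<Rightarrow> ('k, 'b) fi_mod \<Rightarrow> (nat set \<Rightarrow> 'a \<Rightarrow> 'b) \<Rightarrow> bool"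
  where "fi_hom R V W \<phi> \<longleftrightarrow>
    (\<forall>X. finite X \<longrightarrow> \<phi> X \<in> mod_homs R (Ob V X) (Ob W X)) \<and>
    (\<forall>X Y f. finite X \<longrightarrow> finite Y \<longrightarrow> f \<in> FI_hom X Y \<longrightarrow>
      (\<forall>v\<in>carrier (Ob V X). \<phi> Y (Ar V X Y f v) = Ar W X Y f (\<phi> X v)))"

definition fi_mono :: "('k, 'a) fi_mod \<Rightarrow> (nat set \<Rightarrow> 'a \<Rightarrow> 'b) \<Rightarrow> bool"
  where "fi_mono V \<phi> \<longleftrightarrow> (\<forall>X. finite X \<longrightarrow> inj_on (\<phi> X) (carrier (Ob V X)))"

definition fi_epi :: "('k, 'a) fi_mod \<Rightarrow> ('k, 'b) fi_mod \<Rightarrow> (nat set \<Rightarrow> 'a \<Rightarrow> 'b) \<Rightarrow> bool"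
  where "fi_epi V W \<phi> \<longleftrightarrow> (\<forall>X. finite X \<longrightarrow> \<phi> X ` carrier (Ob V X) = carrier (Ob W X))"

definition fi_ker ::
  "('k, 'a) fi_mod \<Rightarrow> ('k, 'b) fi_mod \<Rightarrow> (nat set \<Rightarrow> 'a \<Rightarrow> 'b) \<Rightarrow> nat set \<Rightarrow> 'a set"
  where "fi_ker V W \<phi> X = a_kernel (Ob V X) (Ob W X) (\<phi> X)"

definition fi_im :: "('k, 'a) fi_mod \<Rightarrow> (nat set \<Rightarrow> 'a \<Rightarrow> 'b) \<Rightarrow> nat set \<Rightarrow> 'b set"
  where "fi_im V \<phi> X = \<phi> X ` carrier (Ob V X)"

definition fi_exact ::
  "('k, 'a) fi_mod \<Rightarrow> ('k, 'b) fi_mod \<Rightarrow> ('k, 'c) fi_mod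
    \<Rightarrow> (nat set \<Rightarrow> 'a \<Rightarrow> 'b) \<Rightarrow> (nat set \<Rightarrow> 'b \<Rightarrow> 'c) \<Rightarrow> bool"
  where "fi_exact U V W \<phi> \<psi> \<longleftrightarrow> (\<forall>X. finite X \<longrightarrow> fi_im U \<phi> X = fi_ker V W \<psi> X)"

definition fi_short_exact ::
  "('k, 'r) ring_scheme \<Rightarrow> ('k, 'a) fi_mod \<Rightarrow> ('k, 'b) fi_mod \<Rightarrow> ('k, 'c) fi_mod
    \<Rightarrow> (nat set \<Rightarrow> 'a \<Rightarrow> 'b) \<Rightarrow> (nat set \<Rightarrow> 'b \<Rightarrow> 'c) \<Rightarrow> bool"
  where "fi_short_exact R U V W \<phi> \<psi> \<longleftrightarrow>
    fi_module R U \<and> fi_module R V \<and> fi_module R W \<and> fi_hom R U V \<phi> \<and> fi_hom R V W \<psi> \<and>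
    fi_mono U \<phi> \<and> fi_exact U V W \<phi> \<psi> \<and> fi_epi V W \<psi>"

definition fi_sub :: "('k, 'a) fi_mod \<Rightarrow> (nat set \<Rightarrow> 'a set) \<Rightarrow> ('k, 'a) fi_mod"
  where "fi_sub V N = \<lparr>Ob = (\<lambda>X. (Ob V X)\<lparr>carrier := N X\<rparr>), Ar = Ar V\<rparr>"

definition fi_quot :: "('k, 'a) fi_mod \<Rightarrow> (nat set \<Rightarrow> 'a set) \<Rightarrow> ('k, 'a set) fi_mod"
  where "fi_quot V N = \<lparr>Ob = (\<lambda>X. mod_quot (Ob V X) (N X)),
    Ar = (\<lambda>X Y f. quot_map (Ob V Y) (N Y) (Ar V X Y f))\<rparr>"

text \<open>The disjoint union of \<open>X\<close> and a point is realised as \<open>insert 0 (Suc ` X)\<close>.\<close>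

definition pt_add :: "nat set \<Rightarrow> nat set"
  where "pt_add X = insert 0 (Suc ` X)"

definition pt_map :: "nat set \<Rightarrow> (nat \<Rightarrow> nat) \<Rightarrow> nat \<Rightarrow> nat"
  where "pt_map X f = (\<lambda>x\<in>pt_add X. case x of 0 \<Rightarrow> 0 | Suc y \<Rightarrow> Suc (f y))"

definition fi_shift :: "('k, 'a) fi_mod \<Rightarrow> ('k, 'a) fi_mod"
  where "fi_shift V = \<lparr>Ob = (\<lambda>X. Ob V (pt_add X)),
    Ar = (\<lambda>X Y f. Ar V (pt_add X) (pt_add Y) (pt_map X f))\<rparr>"

definition fi_deg :: "('k, 'a) fi_mod \<Rightarrow> ereal"
  where "fi_deg V = (SUP n\<in>{n::nat. carrier (Ob V {1..n}) \<noteq> {\<zero>\<^bsub>Ob V {1..n}\<^esub>}}. ereal (real n))"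


section \<open>Projective objects and resolutions\<close>

text \<open>A definition cannot quantify over all element types. The type \<open>univ\<close> over \<open>'a\<close> contains
  \<open>'a\<close> and is closed under finite formal linear combinations of triples consisting of an object
  of FI, a morphism of FI and an element. Hence every FI-module with elements in \<open>'a\<close> or in
  \<open>univ\<close> is a quotient of a free FI-module with elements in \<open>univ\<close>; so testing projectivity
  against FI-modules with elements in \<open>univ\<close> is no restriction (an object that has the lifting
  property for its free cover is a direct summand of it), and projective resolutions exist in
  \<open>univ\<close> (lemma \<open>ex_projective_resolution\<close> below).\<close>

datatype ('k, 'a) univ =
  Atom 'a | Comb "((nat set \<times> (nat \<Rightarrow> nat) \<times> ('k, 'a) univ) \<times> 'k) fset"

definition fi_projective :: "('k, 'r) ring_scheme \<Rightarrow> ('k, 'p) fi_mod \<Rightarrow> bool"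
  where "fi_projective R P \<longleftrightarrow> fi_module R P \<and>
    (\<forall>(E :: ('k, ('k, 'p) univ) fi_mod) (B :: ('k, ('k, 'p) univ) fi_mod) \<pi> \<phi>.
      fi_module R E \<longrightarrow> fi_module R B \<longrightarrow> fi_hom R E B \<pi> \<longrightarrow> fi_epi E B \<pi> \<longrightarrow> fi_hom R P B \<phi> \<longrightarrow>
      (\<exists>\<psi>. fi_hom R P E \<psi> \<and> (\<forall>X. finite X \<longrightarrow> (\<forall>x\<in>carrier (Ob P X). \<pi> X (\<psi> X x) = \<phi> X x))))"

definition projective_resolution ::
  "('k, 'r) ring_scheme \<Rightarrow> ('k, 'a) fi_mod \<Rightarrow> (nat \<Rightarrow> ('k, 'b) fi_mod)
    \<Rightarrow> (nat \<Rightarrow> nat set \<Rightarrow> 'b \<Rightarrow> 'b) \<Rightarrow> (nat set \<Rightarrow> 'b \<Rightarrow> 'a) \<Rightarrow> bool"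
  where "projective_resolution R V P d \<epsilon> \<longleftrightarrow>
    (\<forall>a. fi_projective R (P a)) \<and>
    (\<forall>a. fi_hom R (P (Suc a)) (P a) (d a)) \<and> fi_hom R (P 0) V \<epsilon> \<and>
    (\<forall>a. fi_exact (P (Suc (Suc a))) (P (Suc a)) (P a) (d (Suc a)) (d a)) \<and>
    fi_exact (P 1) (P 0) V (d 0) \<epsilon> \<and> fi_epi (P 0) V \<epsilon>"

definition chosen_resolution ::
  "('k, 'r) ring_scheme \<Rightarrow> ('k, 'a) fi_mod \<Rightarrow>
    (nat \<Rightarrow> ('k, ('k, 'a) univ) fi_mod) \<times> (nat \<Rightarrow> nat set \<Rightarrow> ('k, 'a) univ \<Rightarrow> ('k, 'a) univ)"
  where "chosen_resolution R V = (SOME (P, d). \<exists>\<epsilon>. projective_resolution R V P d \<epsilon>)"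


section \<open>FI-homology\<close>

definition fi_J :: "('k, 'r) ring_scheme \<Rightarrow> ('k, 'a) fi_mod \<Rightarrow> nat set \<Rightarrow> 'a set"
  where "fi_J R V X = (\<lambda>N. submodule N R (Ob V X)) hull
    (\<Union>Y\<in>{Y. finite Y \<and> card Y < card X}. \<Union>f\<in>FI_hom Y X. Ar V Y X f ` carrier (Ob V Y))"

definition F_ob :: "('k, 'r) ring_scheme \<Rightarrow> ('k, 'a) fi_mod \<Rightarrow> ('k, 'a set) fi_mod"
  where "F_ob R V = fi_quot V (fi_J R V)"

definition F_map ::
  "('k, 'r) ring_scheme \<Rightarrow> ('k, 'b) fi_mod \<Rightarrow> (nat set \<Rightarrow> 'a \<Rightarrow> 'b) \<Rightarrow> nat set \<Rightarrow> 'a set \<Rightarrow> 'b set"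
  where "F_map R W \<phi> X = quot_map (Ob W X) (fi_J R W X) (\<phi> X)"

text \<open>The homology at \<open>P a\<close> of the complex obtained by applying \<open>F\<close> to
  \<open>\<dots> \<rightarrow> P 2 \<rightarrow> P 1 \<rightarrow> P 0 \<rightarrow> 0\<close>.\<close>

definition F_cycles ::
  "('k, 'r) ring_scheme \<Rightarrow> (nat \<Rightarrow> ('k, 'b) fi_mod) \<Rightarrow> (nat \<Rightarrow> nat set \<Rightarrow> 'b \<Rightarrow> 'b)
    \<Rightarrow> nat \<Rightarrow> nat set \<Rightarrow> 'b set set"
  where "F_cycles R P d a = (case a of
      0 \<Rightarrow> (\<lambda>X. carrier (Ob (F_ob R (P 0)) X))
    | Suc b \<Rightarrow> fi_ker (F_ob R (P (Suc b))) (F_ob R (P b)) (F_map R (P b) (d b)))"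

definition F_boundaries ::
  "('k, 'r) ring_scheme \<Rightarrow> (nat \<Rightarrow> ('k, 'b) fi_mod) \<Rightarrow> (nat \<Rightarrow> nat set \<Rightarrow> 'b \<Rightarrow> 'b)
    \<Rightarrow> nat \<Rightarrow> nat set \<Rightarrow> 'b set set"
  where "F_boundaries R P d a = fi_im (F_ob R (P (Suc a))) (F_map R (P a) (d a))"

definition fi_homology ::
  "('k, 'r) ring_scheme \<Rightarrow> nat \<Rightarrow> ('k, 'a) fi_mod \<Rightarrow> ('k, ('k, 'a) univ set set) fi_mod"
  where "fi_homology R a V = (case chosen_resolution R V of (P, d) \<Rightarrow>
    fi_quot (fi_sub (F_ob R (P a)) (F_cycles R P d a)) (F_boundaries R P d a))"

definition F_acyclic :: "('k, 'r) ring_scheme \<Rightarrow> ('k, 'a) fi_mod \<Rightarrow> bool"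
  where "F_acyclic R V \<longleftrightarrow> (\<forall>a\<ge>1. \<forall>X. finite X \<longrightarrow>
    carrier (Ob (fi_homology R a V) X) = {\<zero>\<^bsub>Ob (fi_homology R a V) X\<^esub>})"

definition fi_hd :: "('k, 'r) ring_scheme \<Rightarrow> nat \<Rightarrow> ('k, 'a) fi_mod \<Rightarrow> ereal"
  where "fi_hd R a V = fi_deg (fi_homology R a V)"

definition fi_reg :: "('k, 'r) ring_scheme \<Rightarrow> ('k, 'a) fi_mod \<Rightarrow> ereal"
  where "fi_reg R V = (INF c\<in>{c::int. \<forall>a\<ge>1. fi_hd R a V \<le> ereal (of_int c + real a)}. ereal (of_int c))"

definition generated_le :: "('k, 'r) ring_scheme \<Rightarrow> nat \<Rightarrow> ('k, 'a) fi_mod \<Rightarrow> bool"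
  where "generated_le R k V \<longleftrightarrow> fi_hd R 0 V \<le> ereal (real k)"

text \<open>\<open>0 \<rightarrow> W \<rightarrow> P \<rightarrow> V \<rightarrow> 0\<close> exhibits \<open>V\<close> as generated in degree \<open>\<le> k\<close> and related in
  degree \<open>\<le> d\<close>. The sequence is an argument, not existentially bound, so that a theorem
  assuming this covers \<open>P\<close> and \<open>W\<close> with arbitrary element types.\<close>

definition gen_rel_presentation ::
  "('k, 'r) ring_scheme \<Rightarrow> nat \<Rightarrow> nat \<Rightarrow> ('k, 'w) fi_mod \<Rightarrow> ('k, 'p) fi_mod \<Rightarrow> ('k, 'a) fi_mod
    \<Rightarrow> (nat set \<Rightarrow> 'w \<Rightarrow> 'p) \<Rightarrow> (nat set \<Rightarrow> 'p \<Rightarrow> 'a) \<Rightarrow> bool"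
  where "gen_rel_presentation R k d W P V \<iota> \<pi> \<longleftrightarrow> fi_short_exact R W P V \<iota> \<pi> \<and>
    fi_projective R P \<and> generated_le R k P \<and> generated_le R d W"

definition fi_N :: "('k, 'r) ring_scheme \<Rightarrow> ('k, 'a) fi_mod \<Rightarrow> nat"
  where "fi_N R V = (LEAST i. F_acyclic R ((fi_shift ^^ i) V))"

definition fi_hd1S :: "('k, 'r) ring_scheme \<Rightarrow> ('k, 'a) fi_mod \<Rightarrow> ereal"
  where "fi_hd1S R V = Max ((\<lambda>i. fi_hd R 1 ((fi_shift ^^ i) V) + ereal (real i)) ` {0..fi_N R V})"


section \<open>Existence of projective resolutions\<close>

text \<open>\<open>lin_ext\<close> is the linear extension of a family of elements of \<open>M\<close> to the free module.\<close>

definition free_mod :: "('k, 'r) ring_scheme \<Rightarrow> 'b set \<Rightarrow> ('k, 'b \<Rightarrow> 'k) module"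
  where "free_mod R B = \<lparr>carrier = {c. finite {b. c b \<noteq> \<zero>\<^bsub>R\<^esub>} \<and> {b. c b \<noteq> \<zero>\<^bsub>R\<^esub>} \<subseteq> B \<and> range c \<subseteq> carrier R},
    mult = undefined, one = undefined, zero = (\<lambda>_. \<zero>\<^bsub>R\<^esub>),
    add = (\<lambda>c d b. c b \<oplus>\<^bsub>R\<^esub> d b), smult = (\<lambda>r c b. r \<otimes>\<^bsub>R\<^esub> c b)\<rparr>"

definition basis_elt :: "('k, 'r) ring_scheme \<Rightarrow> 'b \<Rightarrow> 'b \<Rightarrow> 'k"
  where "basis_elt R b = (\<lambda>x. if x = b then \<one>\<^bsub>R\<^esub> else \<zero>\<^bsub>R\<^esub>)"

definition lin_ext :: "('k, 'r) ring_scheme \<Rightarrow> ('k, 'a) module \<Rightarrow> ('b \<Rightarrow> 'a) \<Rightarrow> ('b \<Rightarrow> 'k) \<Rightarrow> 'a"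
  where "lin_ext R M e c = finsum M (\<lambda>b. c b \<odot>\<^bsub>M\<^esub> e b) {b. c b \<noteq> \<zero>\<^bsub>R\<^esub>}"

lemma mod_homsD:
  assumes "h \<in> mod_homs R M N"
  shows "x \<in> carrier M \<Longrightarrow> h x \<in> carrier N"
    "x \<in> carrier M \<Longrightarrow> y \<in> carrier M \<Longrightarrow> h (x \<oplus>\<^bsub>M\<^esub> y) = h x \<oplus>\<^bsub>N\<^esub> h y"
    "r \<in> carrier R \<Longrightarrow> x \<in> carrier M \<Longrightarrow> h (r \<odot>\<^bsub>M\<^esub> x) = r \<odot>\<^bsub>N\<^esub> h x"
  using assms by (auto simp: mod_homs_def)

lemma mod_homs_comp:
  "h \<in> mod_homs R M N \<Longrightarrow> g \<in> mod_homs R N Q \<Longrightarrow> (\<lambda>x. g (h x)) \<in> mod_homs R M Q"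
  by (auto simp: mod_homs_def Pi_iff)

lemma mod_homs_zero:
  assumes "Module.module R M" "Module.module R N" "h \<in> mod_homs R M N"
  shows "h \<zero>\<^bsub>M\<^esub> = \<zero>\<^bsub>N\<^esub>"
proof -
  interpret M: Module.module R M by fact
  interpret N: Module.module R N by fact
  have "h (\<zero>\<^bsub>R\<^esub> \<odot>\<^bsub>M\<^esub> \<zero>\<^bsub>M\<^esub>) = \<zero>\<^bsub>R\<^esub> \<odot>\<^bsub>N\<^esub> h \<zero>\<^bsub>M\<^esub>"
    using mod_homsD(3)[OF assms(3)] by blast
  then show ?thesis using mod_homsD(1)[OF assms(3)] by simp
qed

lemma free_mod_finite_supp:
  assumes "cring R" "c \<in> carrier (free_mod R B)" "d \<in> carrier (free_mod R B)"
  shows "(\<lambda>b. c b \<oplus>\<^bsub>R\<^esub> d b) \<in> carrier (free_mod R B)"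
proof -
  interpret R: cring R by fact
  have s: "{b. c b \<oplus>\<^bsub>R\<^esub> d b \<noteq> \<zero>\<^bsub>R\<^esub>} \<subseteq> {b. c b \<noteq> \<zero>\<^bsub>R\<^esub>} \<union> {b. d b \<noteq> \<zero>\<^bsub>R\<^esub>}" by auto
  have "finite {b. c b \<oplus>\<^bsub>R\<^esub> d b \<noteq> \<zero>\<^bsub>R\<^esub>}"
    by (rule finite_subset[OF s]) (use assms in \<open>auto simp: free_mod_def\<close>)
  moreover have "c b \<in> carrier R" "d b \<in> carrier R" for b
    using assms(2,3) by (auto simp: free_mod_def)
  ultimately show ?thesis using s assms(2,3) by (auto simp: free_mod_def)
qed

lemma free_mod_smult_closed:
  assumes "cring R" "c \<in> carrier (free_mod R B)" "r \<in> carrier R"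
  shows "(\<lambda>b. r \<otimes>\<^bsub>R\<^esub> c b) \<in> carrier (free_mod R B)"
proof -
  interpret R: cring R by fact
  have s: "{b. r \<otimes>\<^bsub>R\<^esub> c b \<noteq> \<zero>\<^bsub>R\<^esub>} \<subseteq> {b. c b \<noteq> \<zero>\<^bsub>R\<^esub>}" using assms(3) by auto
  have "finite {b. r \<otimes>\<^bsub>R\<^esub> c b \<noteq> \<zero>\<^bsub>R\<^esub>}"
    by (rule finite_subset[OF s]) (use assms in \<open>auto simp: free_mod_def\<close>)
  with s show ?thesis using assms(2,3) by (auto simp: free_mod_def)
qed

lemma free_mod_coeff: "c \<in> carrier (free_mod R B) \<Longrightarrow> c b \<in> carrier R"
  by (auto simp: free_mod_def)

lemma module_free_mod:
  assumes "cring R" shows "Module.module R (free_mod R B)"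
proof -
  interpret R: cring R by fact
  note [simp] = free_mod_coeff
  have ops: "x \<oplus>\<^bsub>free_mod R B\<^esub> y = (\<lambda>b. x b \<oplus>\<^bsub>R\<^esub> y b)" "r \<odot>\<^bsub>free_mod R B\<^esub> x = (\<lambda>b. r \<otimes>\<^bsub>R\<^esub> x b)"
    "\<zero>\<^bsub>free_mod R B\<^esub> = (\<lambda>_. \<zero>\<^bsub>R\<^esub>)" for x y r
    by (auto simp: free_mod_def)
  show ?thesis
  proof (rule moduleI[OF assms])
    show "abelian_group (free_mod R B)"
    proof (rule abelian_groupI)
      fix x assume x: "x \<in> carrier (free_mod R B)"
      show "\<exists>y\<in>carrier (free_mod R B). y \<oplus>\<^bsub>free_mod R B\<^esub> x = \<zero>\<^bsub>free_mod R B\<^esub>"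
      proof
        show "(\<lambda>b. (\<ominus>\<^bsub>R\<^esub> \<one>\<^bsub>R\<^esub>) \<otimes>\<^bsub>R\<^esub> x b) \<in> carrier (free_mod R B)"
          using free_mod_smult_closed[OF assms x, of "\<ominus>\<^bsub>R\<^esub> \<one>\<^bsub>R\<^esub>"] by simp
        show "(\<lambda>b. (\<ominus>\<^bsub>R\<^esub> \<one>\<^bsub>R\<^esub>) \<otimes>\<^bsub>R\<^esub> x b) \<oplus>\<^bsub>free_mod R B\<^esub> x = \<zero>\<^bsub>free_mod R B\<^esub>"
          unfolding ops using x by (intro ext) (simp add: R.l_minus R.l_neg)
      qed
    next
      show "\<zero>\<^bsub>free_mod R B\<^esub> \<in> carrier (free_mod R B)" by (auto simp: free_mod_def)
    qed (simp_all add: ops free_mod_finite_supp[OF assms] R.a_ac)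
  qed (simp_all add: ops free_mod_smult_closed[OF assms] R.l_distr R.r_distr R.m_assoc)
qed

lemma basis_elt_in: "cring R \<Longrightarrow> b \<in> B \<Longrightarrow> basis_elt R b \<in> carrier (free_mod R B)"
proof -
  assume "cring R" and b: "b \<in> B"
  then interpret R: cring R by simp
  have "{x. basis_elt R b x \<noteq> \<zero>\<^bsub>R\<^esub>} \<subseteq> {b}" by (auto simp: basis_elt_def)
  with b show ?thesis
    by (auto simp: free_mod_def basis_elt_def)
qed

lemma lin_ext_superset:
  assumes "Module.module R M" "e \<in> B \<rightarrow> carrier M" "c \<in> carrier (free_mod R B)"
    "finite A" "{b. c b \<noteq> \<zero>\<^bsub>R\<^esub>} \<subseteq> A" "A \<subseteq> B"
  shows "lin_ext R M e c = finsum M (\<lambda>b. c b \<odot>\<^bsub>M\<^esub> e b) A"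
proof -
  interpret M: Module.module R M by fact
  show ?thesis unfolding lin_ext_def
    by (rule M.add.finprod_mono_neutral_cong_left)
      (use assms in \<open>auto simp: free_mod_coeff[OF assms(3)] Pi_iff intro!: M.smult_l_null\<close>)
qed

lemma lin_ext_hom:
  assumes "Module.module R M" "e \<in> B \<rightarrow> carrier M"
  shows "lin_ext R M e \<in> mod_homs R (free_mod R B) M"
proof -
  interpret M: Module.module R M by fact
  interpret F: Module.module R "free_mod R B" by (rule module_free_mod) (rule M.R.is_cring)
  have fin: "finite {b. c b \<noteq> \<zero>\<^bsub>R\<^esub>}" "{b. c b \<noteq> \<zero>\<^bsub>R\<^esub>} \<subseteq> B" if "c \<in> carrier (free_mod R B)" for c
    using that by (auto simp: free_mod_def)
  have cl: "(\<lambda>b. c b \<odot>\<^bsub>M\<^esub> e b) \<in> A \<rightarrow> carrier M" if "c \<in> carrier (free_mod R B)" "A \<subseteq> B" for c A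
    using that assms(2) free_mod_coeff[OF that(1)] by auto
  show ?thesis
    unfolding mod_homs_def
  proof (intro CollectI conjI ballI funcsetI)
    fix c assume c: "c \<in> carrier (free_mod R B)"
    show "lin_ext R M e c \<in> carrier M"
      unfolding lin_ext_def by (rule M.finsum_closed) (use cl[OF c] fin(2)[OF c] in auto)
    { fix d assume d: "d \<in> carrier (free_mod R B)"
      let ?A = "{b. c b \<noteq> \<zero>\<^bsub>R\<^esub>} \<union> {b. d b \<noteq> \<zero>\<^bsub>R\<^esub>}"
      have A: "finite ?A" "?A \<subseteq> B" using fin[OF c] fin[OF d] by auto
      have s: "c \<oplus>\<^bsub>free_mod R B\<^esub> d = (\<lambda>b. c b \<oplus>\<^bsub>R\<^esub> d b)" by (simp add: free_mod_def)
      have "lin_ext R M e (c \<oplus>\<^bsub>free_mod R B\<^esub> d) = finsum M (\<lambda>b. (c b \<oplus>\<^bsub>R\<^esub> d b) \<odot>\<^bsub>M\<^esub> e b) ?A"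
        unfolding s
        by (rule lin_ext_superset[OF assms free_mod_finite_supp[OF M.R.is_cring c d] A(1) _ A(2)]) auto
      also have "\<dots> = finsum M (\<lambda>b. c b \<odot>\<^bsub>M\<^esub> e b \<oplus>\<^bsub>M\<^esub> d b \<odot>\<^bsub>M\<^esub> e b) ?A"
        by (rule M.finsum_cong')
          (use cl[OF c A(2)] cl[OF d A(2)] A(2) assms(2) in
            \<open>auto simp: free_mod_coeff[OF c] free_mod_coeff[OF d] Pi_iff intro!: M.smult_l_distr\<close>)
      also have "\<dots> = finsum M (\<lambda>b. c b \<odot>\<^bsub>M\<^esub> e b) ?A \<oplus>\<^bsub>M\<^esub> finsum M (\<lambda>b. d b \<odot>\<^bsub>M\<^esub> e b) ?A"
        by (rule M.finsum_addf) (use cl[OF c A(2)] cl[OF d A(2)] in auto)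
      also have "\<dots> = lin_ext R M e c \<oplus>\<^bsub>M\<^esub> lin_ext R M e d"
        using lin_ext_superset[OF assms c A(1) _ A(2)] lin_ext_superset[OF assms d A(1) _ A(2)] by auto
      finally show "lin_ext R M e (c \<oplus>\<^bsub>free_mod R B\<^esub> d) = lin_ext R M e c \<oplus>\<^bsub>M\<^esub> lin_ext R M e d" .
    }
    fix r assume r: "r \<in> carrier R"
  next
    fix r c assume r: "r \<in> carrier R" and c: "c \<in> carrier (free_mod R B)"
    let ?A = "{b. c b \<noteq> \<zero>\<^bsub>R\<^esub>}"
    have s: "r \<odot>\<^bsub>free_mod R B\<^esub> c = (\<lambda>b. r \<otimes>\<^bsub>R\<^esub> c b)" by (simp add: free_mod_def)
    have "lin_ext R M e (r \<odot>\<^bsub>free_mod R B\<^esub> c) = finsum M (\<lambda>b. (r \<otimes>\<^bsub>R\<^esub> c b) \<odot>\<^bsub>M\<^esub> e b) ?A"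
      unfolding s
      by (rule lin_ext_superset[OF assms free_mod_smult_closed[OF M.R.is_cring c r] fin(1)[OF c] _ fin(2)[OF c]])
        (use r in auto)
    also have "\<dots> = finsum M (\<lambda>b. r \<odot>\<^bsub>M\<^esub> (c b \<odot>\<^bsub>M\<^esub> e b)) ?A"
      by (rule M.finsum_cong')
        (use cl[OF c fin(2)[OF c]] fin(2)[OF c] assms(2) r in
          \<open>auto simp: free_mod_coeff[OF c] Pi_iff intro!: M.smult_assoc1\<close>)
    also have "\<dots> = r \<odot>\<^bsub>M\<^esub> lin_ext R M e c"
      unfolding lin_ext_def
      by (rule M.finsum_smult_ldistr[symmetric]) (use fin[OF c] r cl[OF c fin(2)[OF c]] in auto)
    finally show "lin_ext R M e (r \<odot>\<^bsub>free_mod R B\<^esub> c) = r \<odot>\<^bsub>M\<^esub> lin_ext R M e c" .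
  qed
qed

lemma lin_ext_basis:
  assumes "Module.module R M" "e \<in> B \<rightarrow> carrier M" "b \<in> B"
  shows "lin_ext R M e (basis_elt R b) = e b"
proof -
  interpret M: Module.module R M by fact
  have "lin_ext R M e (basis_elt R b) = finsum M (\<lambda>x. basis_elt R b x \<odot>\<^bsub>M\<^esub> e x) {b}"
    by (rule lin_ext_superset[OF assms(1,2) basis_elt_in])
      (use assms(3) in \<open>auto simp: basis_elt_def M.R.is_cring\<close>)
  also have "\<dots> = e b" using assms(2,3) by (auto simp: basis_elt_def Pi_iff)
  finally show ?thesis .
qed

lemma free_mod_hom_expand:
  assumes "Module.module R M" "h \<in> mod_homs R (free_mod R B) M" "c \<in> carrier (free_mod R B)"
  shows "h c = lin_ext R M (\<lambda>b. h (basis_elt R b)) c"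
proof -
  interpret M: Module.module R M by fact
  interpret F: Module.module R "free_mod R B" by (rule module_free_mod) (rule M.R.is_cring)
  note be = basis_elt_in[OF M.R.is_cring]
  have e: "(\<lambda>b. h (basis_elt R b)) \<in> B \<rightarrow> carrier M"
    by (intro funcsetI mod_homsD(1)[OF assms(2)] be)
  have "\<forall>c\<in>carrier (free_mod R B). {b. c b \<noteq> \<zero>\<^bsub>R\<^esub>} \<subseteq> A \<longrightarrow>
      h c = lin_ext R M (\<lambda>b. h (basis_elt R b)) c" if "finite A" "A \<subseteq> B" for A
    using that
  proof (induction A rule: finite_induct)
    case empty
    { fix c assume "c \<in> carrier (free_mod R B)" "{b. c b \<noteq> \<zero>\<^bsub>R\<^esub>} \<subseteq> {}"
      then have "c = \<zero>\<^bsub>free_mod R B\<^esub>" by (auto simp: free_mod_def)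
      then have "h c = lin_ext R M (\<lambda>b. h (basis_elt R b)) c"
        using mod_homs_zero[OF F.module_axioms M.module_axioms assms(2)]
          mod_homs_zero[OF F.module_axioms M.module_axioms lin_ext_hom[OF assms(1) e]] by simp }
    then show ?case by blast
  next
    case (insert x A)
    { fix c assume c: "c \<in> carrier (free_mod R B)" "{b. c b \<noteq> \<zero>\<^bsub>R\<^esub>} \<subseteq> insert x A"
      let ?c = "c(x := \<zero>\<^bsub>R\<^esub>)" and ?L = "lin_ext R M (\<lambda>b. h (basis_elt R b))"
      have "finite {b. ?c b \<noteq> \<zero>\<^bsub>R\<^esub>}"
        by (rule finite_subset[of _ "{b. c b \<noteq> \<zero>\<^bsub>R\<^esub>}"]) (use c(1) in \<open>auto simp: free_mod_def\<close>)
      then have c': "?c \<in> carrier (free_mod R B)" using c(1) by (auto simp: free_mod_def)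
      have x: "x \<in> B" and cx: "c x \<in> carrier R" using insert c(1) by (auto simp: free_mod_coeff)
      have eq: "c = ?c \<oplus>\<^bsub>free_mod R B\<^esub> c x \<odot>\<^bsub>free_mod R B\<^esub> basis_elt R x"
        using free_mod_coeff[OF c(1)] by (auto simp: free_mod_def basis_elt_def)
      have g: "g c = g ?c \<oplus>\<^bsub>M\<^esub> c x \<odot>\<^bsub>M\<^esub> g (basis_elt R x)"
        if g: "g \<in> mod_homs R (free_mod R B) M" for g
        by (subst eq, subst mod_homsD(2)[OF g c'])
          (use be[OF x] cx mod_homsD(3)[OF g cx be[OF x]] in auto)
      have "{b. ?c b \<noteq> \<zero>\<^bsub>R\<^esub>} \<subseteq> A" using c(2) by auto
      with insert c' have "h ?c = ?L ?c" by blast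
      then have "h c = ?L c"
        using g[OF assms(2)] g[OF lin_ext_hom[OF assms(1) e]] lin_ext_basis[OF assms(1) e x] by simp }
    then show ?case by blast
  qed
  from this[of "{b. c b \<noteq> \<zero>\<^bsub>R\<^esub>}"] assms(3) show ?thesis by (auto simp: free_mod_def)
qed

lemma free_mod_hom_eq:
  fixes M :: "('k, 'a) module"
  assumes "Module.module R M" "h \<in> mod_homs R (free_mod R B) M" "g \<in> mod_homs R (free_mod R B) M"
    "\<And>b. b \<in> B \<Longrightarrow> h (basis_elt R b) = g (basis_elt R b)" "c \<in> carrier (free_mod R B)"
  shows "h c = g c"
proof -
  interpret M: Module.module R M by fact
  have "{b. c b \<noteq> \<zero>\<^bsub>R\<^esub>} \<subseteq> B" using assms(5) by (auto simp: free_mod_def)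
  then show ?thesis
    unfolding free_mod_hom_expand[OF assms(1,2,5)] free_mod_hom_expand[OF assms(1,3,5)] lin_ext_def
    using mod_homsD(1)[OF assms(3)] basis_elt_in[OF M.R.is_cring, of _ B] free_mod_coeff[OF assms(5)]
    by (intro M.finsum_cong') (auto simp: assms(4) subset_iff Pi_iff)
qed

text \<open>The free FI-module on all elements of \<open>V\<close>.\<close>

definition fi_gens :: "('k, 'a) fi_mod \<Rightarrow> nat set \<Rightarrow> (nat set \<times> (nat \<Rightarrow> nat) \<times> 'a) set"
  where "fi_gens V X = {(Y, f, v). finite Y \<and> f \<in> FI_hom Y X \<and> v \<in> carrier (Ob V Y)}"

definition fi_free ::
  "('k, 'r) ring_scheme \<Rightarrow> ('k, 'a) fi_mod \<Rightarrow> ('k, nat set \<times> (nat \<Rightarrow> nat) \<times> 'a \<Rightarrow> 'k) fi_mod"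
  where "fi_free R V = \<lparr>Ob = (\<lambda>X. free_mod R (fi_gens V X)),
    Ar = (\<lambda>X Z g. lin_ext R (free_mod R (fi_gens V Z)) (\<lambda>(Y, f, v). basis_elt R (Y, compose Y g f, v)))\<rparr>"

definition fi_free_ext ::
  "('k, 'r) ring_scheme \<Rightarrow> ('k, 'b) fi_mod \<Rightarrow> (nat set \<Rightarrow> 'a \<Rightarrow> 'b) \<Rightarrow> nat set
    \<Rightarrow> (nat set \<times> (nat \<Rightarrow> nat) \<times> 'a \<Rightarrow> 'k) \<Rightarrow> 'b"
  where "fi_free_ext R E e X = lin_ext R (Ob E X) (\<lambda>(Y, f, v). Ar E Y X f (e Y v))"

lemma FI_hom_comp: "f \<in> FI_hom Y X \<Longrightarrow> g \<in> FI_hom X Z \<Longrightarrow> compose Y g f \<in> FI_hom Y Z"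
  by (auto simp: FI_hom_def compose_def inj_on_def PiE_def Pi_def extensional_def)

lemma FI_hom_id: "(\<lambda>x\<in>X. x) \<in> FI_hom X X"
  by (auto simp: FI_hom_def inj_on_def)

lemma fi_free_Ar_aux:
  assumes "cring R" "g \<in> FI_hom X Z"
  shows "(\<lambda>(Y, f, v). basis_elt R (Y, compose Y g f, v)) \<in> fi_gens V X \<rightarrow> carrier (free_mod R (fi_gens V Z))"
  using assms by (auto intro!: basis_elt_in simp: fi_gens_def FI_hom_comp)

lemma fi_free_Ar_hom:
  assumes "cring R" "g \<in> FI_hom X Z"
  shows "Ar (fi_free R V) X Z g \<in> mod_homs R (Ob (fi_free R V) X) (Ob (fi_free R V) Z)"
  unfolding fi_free_def by (simp add: lin_ext_hom[OF module_free_mod fi_free_Ar_aux] assms)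

lemma fi_free_Ar_basis:
  assumes "cring R" "g \<in> FI_hom X Z" "(Y, f, v) \<in> fi_gens V X"
  shows "Ar (fi_free R V) X Z g (basis_elt R (Y, f, v)) = basis_elt R (Y, compose Y g f, v)"
  unfolding fi_free_def using lin_ext_basis[OF module_free_mod fi_free_Ar_aux, OF assms(1,1,2,3)]
  by simp

lemma fi_module_fi_free:
  assumes "cring R" shows "fi_module R (fi_free R V)"
proof (rule fi_module.intro)
  have Ob: "Ob (fi_free R V) X = free_mod R (fi_gens V X)" for X by (simp add: fi_free_def)
  note hom = fi_free_Ar_hom[OF assms, of _ _ _ V, unfolded Ob]
  show "Module.module R (Ob (fi_free R V) X)" for X
    by (simp add: Ob module_free_mod assms)
  show "Ar (fi_free R V) X Y f \<in> mod_homs R (Ob (fi_free R V) X) (Ob (fi_free R V) Y)"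
    if "f \<in> FI_hom X Y" for X Y f
    using fi_free_Ar_hom[OF assms that] .
  show "Ar (fi_free R V) X X (\<lambda>x\<in>X. x) c = c" if "c \<in> carrier (Ob (fi_free R V) X)" for X c
  proof (rule free_mod_hom_eq[OF module_free_mod[OF assms] hom[OF FI_hom_id]])
    show "(\<lambda>c. c) \<in> mod_homs R (free_mod R (fi_gens V X)) (free_mod R (fi_gens V X))"
      by (auto simp: mod_homs_def)
    show "c \<in> carrier (free_mod R (fi_gens V X))" using that by (simp add: Ob)
    fix b assume b: "b \<in> fi_gens V X"
    obtain Y f v where bb: "b = (Y, f, v)" by (cases b)
    with b have "compose Y (\<lambda>x\<in>X. x) f = f"
      by (auto simp: fi_gens_def FI_hom_def PiE_def intro!: Id_compose)
    then show "Ar (fi_free R V) X X (\<lambda>x\<in>X. x) (basis_elt R b) = basis_elt R b"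
      using fi_free_Ar_basis[OF assms FI_hom_id b[unfolded bb]] bb by simp
  qed
  show "Ar (fi_free R V) X Z (compose X g f) c = Ar (fi_free R V) Y Z g (Ar (fi_free R V) X Y f c)"
    if f: "f \<in> FI_hom X Y" and g: "g \<in> FI_hom Y Z" and c: "c \<in> carrier (Ob (fi_free R V) X)" for X Y Z f g c
  proof (rule free_mod_hom_eq[OF module_free_mod[OF assms] hom[OF FI_hom_comp[OF f g]]
          mod_homs_comp[OF hom[OF f] hom[OF g]]])
    show "c \<in> carrier (free_mod R (fi_gens V X))" using c by (simp add: Ob)
    fix b assume b: "b \<in> fi_gens V X"
    obtain U h v where bb: "b = (U, h, v)" by (cases b)
    with b have h: "h \<in> FI_hom U X" by (auto simp: fi_gens_def)
    have b': "(U, compose U f h, v) \<in> fi_gens V Y"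
      using b bb FI_hom_comp[OF h f] by (auto simp: fi_gens_def)
    have "compose U (compose X g f) h = compose U g (compose U f h)"
      using h by (intro compose_assoc[symmetric]) (auto simp: FI_hom_def)
    then show "Ar (fi_free R V) X Z (compose X g f) (basis_elt R b)
        = Ar (fi_free R V) Y Z g (Ar (fi_free R V) X Y f (basis_elt R b))"
      using fi_free_Ar_basis[OF assms FI_hom_comp[OF f g] b[unfolded bb]]
        fi_free_Ar_basis[OF assms f b[unfolded bb]] fi_free_Ar_basis[OF assms g b'] bb by simp
  qed
qed

lemma fi_free_ext:
  assumes E: "fi_module R E" and R: "cring R"
    and e: "\<And>Y v. finite Y \<Longrightarrow> v \<in> carrier (Ob V Y) \<Longrightarrow> e Y v \<in> carrier (Ob E Y)"
  shows "fi_hom R (fi_free R V) E (fi_free_ext R E e)"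
    and "finite X \<Longrightarrow> (Y, f, v) \<in> fi_gens V X \<Longrightarrow>
      fi_free_ext R E e X (basis_elt R (Y, f, v)) = Ar E Y X f (e Y v)"
proof -
  interpret E: fi_module R E by fact
  have Ob: "Ob (fi_free R V) X = free_mod R (fi_gens V X)" for X by (simp add: fi_free_def)
  have a: "(\<lambda>(Y, f, v). Ar E Y X f (e Y v)) \<in> fi_gens V X \<rightarrow> carrier (Ob E X)" if "finite X" for X
    using that e by (auto simp: fi_gens_def intro!: mod_homsD(1)[OF E.Ar_hom])
  have hom: "fi_free_ext R E e X \<in> mod_homs R (free_mod R (fi_gens V X)) (Ob E X)" if "finite X" for X
    unfolding fi_free_ext_def by (rule lin_ext_hom[OF E.Ob_module[OF that] a[OF that]])
  show bas: "fi_free_ext R E e X (basis_elt R (Y, f, v)) = Ar E Y X f (e Y v)"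
    if "finite X" "(Y, f, v) \<in> fi_gens V X" for X Y f v
    unfolding fi_free_ext_def using lin_ext_basis[OF E.Ob_module a] that by fastforce
  show "fi_hom R (fi_free R V) E (fi_free_ext R E e)"
    unfolding fi_hom_def Ob
  proof (intro conjI allI impI ballI)
    fix X Y f c assume X: "finite X" and Y: "finite Y" and f: "f \<in> FI_hom X Y"
      and c: "c \<in> carrier (free_mod R (fi_gens V X))"
    note fhom = fi_free_Ar_hom[OF R f, of V, unfolded Ob] and fbas = fi_free_Ar_basis[OF R f, of _ _ _ V]
    show "fi_free_ext R E e Y (Ar (fi_free R V) X Y f c) = Ar E X Y f (fi_free_ext R E e X c)"
    proof (rule free_mod_hom_eq[OF E.Ob_module[OF Y] mod_homs_comp[OF fhom hom[OF Y]]
            mod_homs_comp[OF hom[OF X] E.Ar_hom[OF X Y f]] _ c])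
      fix b assume b: "b \<in> fi_gens V X"
      obtain U h v where bb: "b = (U, h, v)" by (cases b)
      with b have h: "h \<in> FI_hom U X" and U: "finite U" and v: "v \<in> carrier (Ob V U)"
        by (auto simp: fi_gens_def)
      have b': "(U, compose U f h, v) \<in> fi_gens V Y"
        using FI_hom_comp[OF h f] U v by (auto simp: fi_gens_def)
      show "fi_free_ext R E e Y (Ar (fi_free R V) X Y f (basis_elt R b))
          = Ar E X Y f (fi_free_ext R E e X (basis_elt R b))"
        using fbas[OF b[unfolded bb]] bas[OF Y b'] bas[OF X b[unfolded bb]]
          E.Ar_comp[OF U X Y h f e[OF U v]] unfolding bb by simp
    qed
  qed (use hom in auto)
qed

lemma fi_free_lift:
  assumes R: "cring R" and E: "fi_module R E" and B: "fi_module R B"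
    and \<pi>: "fi_hom R E B \<pi>" "fi_epi E B \<pi>" and \<phi>: "fi_hom R (fi_free R V) B \<phi>"
  shows "\<exists>\<psi>. fi_hom R (fi_free R V) E \<psi> \<and>
    (\<forall>X. finite X \<longrightarrow> (\<forall>x\<in>carrier (Ob (fi_free R V) X). \<pi> X (\<psi> X x) = \<phi> X x))"
proof -
  interpret B: fi_module R B by fact
  interpret E: fi_module R E by fact
  interpret P: fi_module R "fi_free R V" by (rule fi_module_fi_free[OF R])
  have Ob: "Ob (fi_free R V) X = free_mod R (fi_gens V X)" for X by (simp add: fi_free_def)
  let ?id = "\<lambda>Y v. basis_elt R (Y, (\<lambda>x\<in>Y. x), v)"
  have gen: "?id Y v \<in> carrier (free_mod R (fi_gens V Y))" if "finite Y" "v \<in> carrier (Ob V Y)" for Y v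
    using that by (intro basis_elt_in R) (auto simp: fi_gens_def FI_hom_id)
  define e where "e = (\<lambda>Y v. SOME u. u \<in> carrier (Ob E Y) \<and> \<pi> Y u = \<phi> Y (?id Y v))"
  have e: "e Y v \<in> carrier (Ob E Y) \<and> \<pi> Y (e Y v) = \<phi> Y (?id Y v)"
    if "finite Y" "v \<in> carrier (Ob V Y)" for Y v
  proof -
    have "\<phi> Y (?id Y v) \<in> carrier (Ob B Y)"
      by (rule mod_homsD(1)[where R = R, OF _ gen[OF that]]) (use \<phi> that in \<open>simp add: fi_hom_def Ob\<close>)
    then have "\<exists>u. u \<in> carrier (Ob E Y) \<and> \<pi> Y u = \<phi> Y (?id Y v)"
      using \<pi>(2) that(1) unfolding fi_epi_def by (smt (verit) imageE)
    then show ?thesis unfolding e_def by (rule someI_ex)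
  qed
  note ext = fi_free_ext[OF E R, of V e]
  have hom: "fi_hom R (fi_free R V) E (fi_free_ext R E e)" using ext(1) e by blast
  moreover have "\<pi> X (fi_free_ext R E e X c) = \<phi> X c"
    if X: "finite X" and c: "c \<in> carrier (Ob (fi_free R V) X)" for X c
  proof (rule free_mod_hom_eq[where h = "\<lambda>c. \<pi> X (fi_free_ext R E e X c)" and g = "\<phi> X",
        OF B.Ob_module[OF X]])
    show "(\<lambda>c. \<pi> X (fi_free_ext R E e X c)) \<in> mod_homs R (free_mod R (fi_gens V X)) (Ob B X)"
      by (rule mod_homs_comp[where N = "Ob E X"]) (use hom \<pi>(1) X in \<open>auto simp: fi_hom_def Ob\<close>)
    show "\<phi> X \<in> mod_homs R (free_mod R (fi_gens V X)) (Ob B X)"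
      using \<phi> X by (auto simp: fi_hom_def Ob)
    show "c \<in> carrier (free_mod R (fi_gens V X))" using c by (simp add: Ob)
    fix b assume b: "b \<in> fi_gens V X"
    obtain Y f v where bb: "b = (Y, f, v)" by (cases b)
    with b have f: "f \<in> FI_hom Y X" and Y: "finite Y" and v: "v \<in> carrier (Ob V Y)"
      by (auto simp: fi_gens_def)
    have "\<pi> X (fi_free_ext R E e X (basis_elt R b)) = \<pi> X (Ar E Y X f (e Y v))"
      using ext(2)[OF _ X] b bb e by auto
    also have "\<dots> = Ar B Y X f (\<phi> Y (?id Y v))"
      using \<pi>(1) X Y f e[OF Y v] by (auto simp: fi_hom_def)
    also have "\<dots> = \<phi> X (Ar (fi_free R V) Y X f (?id Y v))"
      using \<phi> X Y f gen[OF Y v] by (auto simp: fi_hom_def Ob)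
    also have "Ar (fi_free R V) Y X f (?id Y v) = basis_elt R b"
    proof -
      have "compose Y f (\<lambda>x\<in>Y. x) = f"
        using f by (intro compose_Id) (auto simp: FI_hom_def PiE_def)
      then show ?thesis
        using fi_free_Ar_basis[OF R f, of Y "\<lambda>x\<in>Y. x" v V] Y v bb by (auto simp: fi_gens_def FI_hom_id)
    qed
    finally show "\<pi> X (fi_free_ext R E e X (basis_elt R b)) = \<phi> X (basis_elt R b)" .
  qed
  ultimately show ?thesis by blast
qed

text \<open>Renaming the elements of an FI-module along an injection.\<close>

definition fi_transport :: "'a set \<Rightarrow> ('a \<Rightarrow> 'b) \<Rightarrow> ('k, 'a) fi_mod \<Rightarrow> ('k, 'b) fi_mod"
  where "fi_transport S e V = \<lparr>
    Ob = (\<lambda>X. \<lparr>carrier = e ` carrier (Ob V X), mult = undefined, one = undefined,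
      zero = e \<zero>\<^bsub>Ob V X\<^esub>,
      add = (\<lambda>x y. e (inv_into S e x \<oplus>\<^bsub>Ob V X\<^esub> inv_into S e y)),
      smult = (\<lambda>r x. e (r \<odot>\<^bsub>Ob V X\<^esub> inv_into S e x))\<rparr>),
    Ar = (\<lambda>X Y f x. e (Ar V X Y f (inv_into S e x)))\<rparr>"

lemma fi_transport:
  assumes V: "fi_module R V" and inj: "inj_on e S" and S: "\<And>X. finite X \<Longrightarrow> carrier (Ob V X) \<subseteq> S"
  shows "fi_module R (fi_transport S e V)"
    "fi_hom R V (fi_transport S e V) (\<lambda>X. e)"
    "fi_hom R (fi_transport S e V) V (\<lambda>X. inv_into S e)"
    "\<And>X x. finite X \<Longrightarrow> x \<in> carrier (Ob V X) \<Longrightarrow> inv_into S e (e x) = x"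
    "\<And>X. carrier (Ob (fi_transport S e V) X) = e ` carrier (Ob V X)"
proof -
  interpret V: fi_module R V by fact
  let ?T = "fi_transport S e V"
  show inv: "inv_into S e (e x) = x" if "finite X" "x \<in> carrier (Ob V X)" for X x
    using that S inj by (intro inv_into_f_f) auto
  show car: "carrier (Ob ?T X) = e ` carrier (Ob V X)" for X by (simp add: fi_transport_def)
  have ops: "x \<oplus>\<^bsub>Ob ?T X\<^esub> y = e (inv_into S e x \<oplus>\<^bsub>Ob V X\<^esub> inv_into S e y)"
    "r \<odot>\<^bsub>Ob ?T X\<^esub> x = e (r \<odot>\<^bsub>Ob V X\<^esub> inv_into S e x)"
    "\<zero>\<^bsub>Ob ?T X\<^esub> = e \<zero>\<^bsub>Ob V X\<^esub>"
    "Ar ?T X Y f x = e (Ar V X Y f (inv_into S e x))" for X Y f x y r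
    by (auto simp: fi_transport_def)
  have mod: "Module.module R (Ob ?T X)" if X: "finite X" for X
  proof -
    interpret M: Module.module R "Ob V X" by (rule V.Ob_module[OF X])
    note [simp] = inv[OF X]
    show ?thesis
    proof (rule moduleI[OF M.R.is_cring])
      show "abelian_group (Ob ?T X)"
      proof (rule abelian_groupI)
        fix x assume "x \<in> carrier (Ob ?T X)"
        then obtain u where u: "u \<in> carrier (Ob V X)" "x = e u" by (auto simp: car)
        show "\<exists>y\<in>carrier (Ob ?T X). y \<oplus>\<^bsub>Ob ?T X\<^esub> x = \<zero>\<^bsub>Ob ?T X\<^esub>"
          by (rule bexI[of _ "e (\<ominus>\<^bsub>Ob V X\<^esub> u)"]) (use u in \<open>auto simp: ops car M.l_neg\<close>)
      qed (auto simp: ops car M.a_ac)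
    qed (auto simp: ops car M.smult_l_distr M.smult_r_distr M.smult_assoc1)
  qed
  have ArC: "Ar V X Y f v \<in> carrier (Ob V Y)"
    if "finite X" "finite Y" "f \<in> FI_hom X Y" "v \<in> carrier (Ob V X)" for X Y f v
    using mod_homsD(1)[OF V.Ar_hom[OF that(1-3)] that(4)] .
  have clo: "x \<oplus>\<^bsub>Ob V X\<^esub> y \<in> carrier (Ob V X)" "r \<in> carrier R \<Longrightarrow> r \<odot>\<^bsub>Ob V X\<^esub> x \<in> carrier (Ob V X)"
    if "finite X" "x \<in> carrier (Ob V X)" "y \<in> carrier (Ob V X)" for X x y r
  proof -
    interpret M: Module.module R "Ob V X" by (rule V.Ob_module[OF that(1)])
    show "x \<oplus>\<^bsub>Ob V X\<^esub> y \<in> carrier (Ob V X)" "r \<in> carrier R \<Longrightarrow> r \<odot>\<^bsub>Ob V X\<^esub> x \<in> carrier (Ob V X)"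
      using that by auto
  qed
  show "fi_module R ?T"
  proof (rule fi_module.intro)
    show "Module.module R (Ob ?T X)" if "finite X" for X by (rule mod[OF that])
    show "Ar ?T X Y f \<in> mod_homs R (Ob ?T X) (Ob ?T Y)"
      if a: "finite X" "finite Y" "f \<in> FI_hom X Y" for X Y f
      using mod_homsD[OF V.Ar_hom[OF a]]
      by (auto simp: mod_homs_def car ops inv[OF a(1)] inv[OF a(2)] clo[OF a(1)])
    show "Ar ?T X X (\<lambda>x\<in>X. x) v = v" if "finite X" "v \<in> carrier (Ob ?T X)" for X v
      using that by (auto simp: car ops inv[OF that(1)] V.Ar_id)
    show "Ar ?T X Z (compose X g f) v = Ar ?T Y Z g (Ar ?T X Y f v)"
      if a: "finite X" "finite Y" "finite Z" "f \<in> FI_hom X Y" "g \<in> FI_hom Y Z" "v \<in> carrier (Ob ?T X)"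
      for X Y Z f g v
      using a(6) V.Ar_comp[OF a(1-5)] by (auto simp: car ops inv[OF a(1)] inv[OF a(2)] ArC[OF a(1,2,4)])
  qed
  show "fi_hom R V ?T (\<lambda>X. e)"
    unfolding fi_hom_def mod_homs_def by (auto simp: car ops inv)
  show "fi_hom R ?T V (\<lambda>X. inv_into S e)"
    unfolding fi_hom_def mod_homs_def by (auto simp: car ops inv clo ArC)
qed

lemma fi_hom_comp:
  assumes "fi_hom R U V \<phi>" "fi_hom R V W \<psi>" shows "fi_hom R U W (\<lambda>X x. \<psi> X (\<phi> X x))"
  using assms mod_homs_comp mod_homsD(1) unfolding fi_hom_def by metis

definition univ_enc :: "('k, 'r) ring_scheme \<Rightarrow> ('b \<Rightarrow> ('k, 'a) univ)
    \<Rightarrow> (nat set \<times> (nat \<Rightarrow> nat) \<times> 'b \<Rightarrow> 'k) \<Rightarrow> ('k, 'a) univ"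
  where "univ_enc R \<iota> c = Comb (Abs_fset ((\<lambda>(Y, f, v). ((Y, f, \<iota> v), c (Y, f, v))) ` {b. c b \<noteq> \<zero>\<^bsub>R\<^esub>}))"

lemma inj_on_univ_enc:
  fixes R :: "('k, 'r) ring_scheme" and \<iota> :: "'b \<Rightarrow> ('k, 'a) univ"
  assumes "inj \<iota>" shows "inj_on (univ_enc R \<iota>) {c. finite {b. c b \<noteq> \<zero>\<^bsub>R\<^esub>}}"
proof (rule inj_onI)
  fix c d assume c: "c \<in> {c. finite {b. c b \<noteq> \<zero>\<^bsub>R\<^esub>}}" and d: "d \<in> {c. finite {b. c b \<noteq> \<zero>\<^bsub>R\<^esub>}}"
    and eq: "univ_enc R \<iota> c = univ_enc R \<iota> d"
  let ?G = "\<lambda>c. (\<lambda>(Y, f, v). ((Y, f, \<iota> v), c (Y, f, v))) ` {b. c b \<noteq> \<zero>\<^bsub>R\<^esub>}"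
  have "?G c = ?G d"
    using eq c d by (simp add: univ_enc_def Abs_fset_inject)
  moreover have G: "((Y, f, \<iota> v), r) \<in> ?G c \<longleftrightarrow> c (Y, f, v) = r \<and> r \<noteq> \<zero>\<^bsub>R\<^esub>"
    for c :: "nat set \<times> (nat \<Rightarrow> nat) \<times> 'b \<Rightarrow> 'k" and Y f v r
    by (force simp: inj_eq[OF assms])
  ultimately have *: "(c (Y, f, v) = r \<and> r \<noteq> \<zero>\<^bsub>R\<^esub>) = (d (Y, f, v) = r \<and> r \<noteq> \<zero>\<^bsub>R\<^esub>)" for Y f v r
    using G[of Y f v r c] G[of Y f v r d] by argo
  have "c b = d b" for b
  proof -
    obtain Y f v where "b = (Y, f, v)" by (cases b)
    then show ?thesis using *[of Y f v "c b"] *[of Y f v "d b"] by metis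
  qed
  then show "c = d" by blast
qed

lemma ex_projective_cover:
  fixes V :: "('k, 'b) fi_mod" and \<iota> :: "'b \<Rightarrow> ('k, 'a) univ"
  assumes R: "cring R" and V: "fi_module R V" and \<iota>: "inj \<iota>"
  shows "\<exists>(P :: ('k, ('k, 'a) univ) fi_mod) \<epsilon>. fi_projective R P \<and> fi_hom R P V \<epsilon> \<and> fi_epi P V \<epsilon>"
proof -
  interpret V: fi_module R V by fact
  let ?S = "{c. finite {b. c b \<noteq> \<zero>\<^bsub>R\<^esub>}}" and ?F = "fi_free R V"
  let ?P = "fi_transport ?S (univ_enc R \<iota>) ?F" and ?inv = "inv_into ?S (univ_enc R \<iota>)"
  have "carrier (Ob ?F X) \<subseteq> ?S" for X by (auto simp: fi_free_def free_mod_def)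
  note T = fi_transport[OF fi_module_fi_free[OF R] inj_on_univ_enc[OF \<iota>] this]
  let ?ev = "fi_free_ext R V (\<lambda>Y v. v)"
  note ev = fi_free_ext[OF V R, of V "\<lambda>Y v. v", simplified]
  have "fi_projective R ?P"
    unfolding fi_projective_def
  proof (intro conjI allI impI)
    fix E B :: "('k, ('k, ('k, 'a) univ) univ) fi_mod" and \<pi> \<phi>
    assume a: "fi_module R E" "fi_module R B" "fi_hom R E B \<pi>" "fi_epi E B \<pi>" "fi_hom R ?P B \<phi>"
    obtain \<psi> where \<psi>: "fi_hom R ?F E \<psi>"
      "\<And>X x. finite X \<Longrightarrow> x \<in> carrier (Ob ?F X) \<Longrightarrow> \<pi> X (\<psi> X x) = \<phi> X (univ_enc R \<iota> x)"
      using fi_free_lift[OF R a(1-4) fi_hom_comp[OF T(2) a(5)]] by blast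
    show "\<exists>\<psi>. fi_hom R ?P E \<psi> \<and> (\<forall>X. finite X \<longrightarrow> (\<forall>x\<in>carrier (Ob ?P X). \<pi> X (\<psi> X x) = \<phi> X x))"
      using fi_hom_comp[OF T(3) \<psi>(1)] \<psi>(2) T(4)
      by (intro exI[of _ "\<lambda>X x. \<psi> X (?inv x)"]) (auto simp: T(5))
  qed (rule T(1))
  moreover have "fi_hom R ?P V (\<lambda>X x. ?ev X (?inv x))"
    by (rule fi_hom_comp[OF T(3) ev(1)])
  moreover have "fi_epi ?P V (\<lambda>X x. ?ev X (?inv x))"
    unfolding fi_epi_def
  proof (intro allI impI equalityI)
    fix X :: "nat set" assume X: "finite X"
    show "(\<lambda>x. ?ev X (?inv x)) ` carrier (Ob ?P X) \<subseteq> carrier (Ob V X)"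
      using calculation(2) X by (auto simp: fi_hom_def mod_homs_def)
    show "carrier (Ob V X) \<subseteq> (\<lambda>x. ?ev X (?inv x)) ` carrier (Ob ?P X)"
    proof
      fix v assume v: "v \<in> carrier (Ob V X)"
      have b: "(X, (\<lambda>x\<in>X. x), v) \<in> fi_gens V X" using X v by (auto simp: fi_gens_def FI_hom_id)
      let ?c = "basis_elt R (X, (\<lambda>x\<in>X. x), v)"
      have c: "?c \<in> carrier (Ob ?F X)" using basis_elt_in[OF R b] by (simp add: fi_free_def)
      have "?ev X ?c = v" using ev(2)[OF X b] V.Ar_id[OF X v] by simp
      then show "v \<in> (\<lambda>x. ?ev X (?inv x)) ` carrier (Ob ?P X)"
        using c T(4)[OF X c] by (intro image_eqI[of _ _ "univ_enc R \<iota> ?c"]) (auto simp: T(5))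
    qed
  qed
  ultimately show ?thesis by blast
qed

lemma fi_module_ker:
  assumes V: "fi_module R V" and W: "fi_module R W" and \<phi>: "fi_hom R V W \<phi>"
  shows "fi_module R (fi_sub V (fi_ker V W \<phi>))"
proof -
  interpret V: fi_module R V by fact
  interpret W: fi_module R W by fact
  let ?K = "fi_sub V (fi_ker V W \<phi>)"
  have Ob: "Ob ?K X = (Ob V X)\<lparr>carrier := fi_ker V W \<phi> X\<rparr>" and Ar: "Ar ?K = Ar V" for X
    by (auto simp: fi_sub_def)
  have K: "fi_ker V W \<phi> X = {x \<in> carrier (Ob V X). \<phi> X x = \<zero>\<^bsub>Ob W X\<^esub>}" for X
    by (auto simp: fi_ker_def a_kernel_def kernel_def)
  have h: "\<phi> X \<in> mod_homs R (Ob V X) (Ob W X)" if "finite X" for X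
    using \<phi> that by (auto simp: fi_hom_def)
  have sub: "submodule (fi_ker V W \<phi> X) R (Ob V X)" if X: "finite X" for X
  proof -
    interpret M: Module.module R "Ob V X" by (rule V.Ob_module[OF X])
    interpret N: Module.module R "Ob W X" by (rule W.Ob_module[OF X])
    note h = mod_homsD[OF h[OF X]] mod_homs_zero[OF M.module_axioms N.module_axioms h[OF X]]
    show ?thesis
    proof (rule M.submoduleI)
      fix a assume a: "a \<in> fi_ker V W \<phi> X"
      then have "\<ominus>\<^bsub>Ob V X\<^esub> a = (\<ominus>\<^bsub>R\<^esub> \<one>\<^bsub>R\<^esub>) \<odot>\<^bsub>Ob V X\<^esub> a"
        by (auto simp: K M.smult_l_minus)
      then show "\<ominus>\<^bsub>Ob V X\<^esub> a \<in> fi_ker V W \<phi> X"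
        using a h(3)[of "\<ominus>\<^bsub>R\<^esub> \<one>\<^bsub>R\<^esub>" a] by (simp add: K)
    qed (simp_all add: K h)
  qed
  show ?thesis
  proof (rule fi_module.intro)
    show "Module.module R (Ob ?K X)" if "finite X" for X
      unfolding Ob by (rule submodule.submodule_is_module[OF sub[OF that] V.Ob_module[OF that]])
    show "Ar ?K X Y f \<in> mod_homs R (Ob ?K X) (Ob ?K Y)"
      if a: "finite X" "finite Y" "f \<in> FI_hom X Y" for X Y f
    proof -
      have "Ar W X Y f \<zero>\<^bsub>Ob W X\<^esub> = \<zero>\<^bsub>Ob W Y\<^esub>"
        by (rule mod_homs_zero[OF W.Ob_module[OF a(1)] W.Ob_module[OF a(2)] W.Ar_hom[OF a]])
      moreover have "\<phi> Y (Ar V X Y f v) = Ar W X Y f (\<phi> X v)" if "v \<in> carrier (Ob V X)" for v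
        using \<phi> a that by (auto simp: fi_hom_def)
      ultimately show ?thesis
        using mod_homsD[OF V.Ar_hom[OF a]] by (auto simp: mod_homs_def Ob Ar K)
    qed
    show "Ar ?K X X (\<lambda>x\<in>X. x) v = v" if "finite X" "v \<in> carrier (Ob ?K X)" for X v
      unfolding Ar by (rule V.Ar_id[OF that(1)]) (use that(2) in \<open>simp add: Ob K\<close>)
    show "Ar ?K X Z (compose X g f) v = Ar ?K Y Z g (Ar ?K X Y f v)"
      if a: "finite X" "finite Y" "finite Z" "f \<in> FI_hom X Y" "g \<in> FI_hom Y Z" "v \<in> carrier (Ob ?K X)"
      for X Y Z f g v
      unfolding Ar by (rule V.Ar_comp[OF a(1-5)]) (use a(6) in \<open>simp add: Ob K\<close>)
  qed
qed

lemma ex_projective_resolution: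
  fixes V :: "('k, 'a) fi_mod"
  assumes R: "cring R" and V: "fi_module R V"
  shows "\<exists>(P :: nat \<Rightarrow> ('k, ('k, 'a) univ) fi_mod) d \<epsilon>. projective_resolution R V P d \<epsilon>"
proof -
  have "inj (Atom :: 'a \<Rightarrow> ('k, 'a) univ)" by (simp add: inj_def)
  from ex_projective_cover[OF R V this]
  obtain P0 :: "('k, ('k, 'a) univ) fi_mod" and \<epsilon>
    where P0: "fi_projective R P0" "fi_hom R P0 V \<epsilon>" "fi_epi P0 V \<epsilon>" by blast
  have mod: "fi_module R P" if "fi_projective R P" for P :: "('k, ('k, 'a) univ) fi_mod"
    using that by (simp add: fi_projective_def)
  define good :: "('k, ('k, 'a) univ) fi_mod \<times> (nat set \<Rightarrow> ('k, 'a) univ set) \<Rightarrow> bool"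
    where "good = (\<lambda>(P, K). fi_projective R P \<and> fi_module R (fi_sub P K) \<and>
    (\<forall>X. finite X \<longrightarrow> K X \<subseteq> carrier (Ob P X)))"
  define next_cover ::
      "('k, ('k, 'a) univ) fi_mod \<times> (nat set \<Rightarrow> ('k, 'a) univ set)
        \<Rightarrow> ('k, ('k, 'a) univ) fi_mod \<times> (nat set \<Rightarrow> ('k, 'a) univ set) \<Rightarrow> bool"
    where "next_cover = (\<lambda>(P, K) (Q, L).
    \<exists>d. fi_hom R Q P d \<and> (\<forall>X. finite X \<longrightarrow> fi_im Q d X = K X \<and> L X = fi_ker Q P d X))"
  have ker_sub: "fi_ker A B d X \<subseteq> carrier (Ob A X)" for A :: "('k, 'x) fi_mod" and B :: "('k, 'y) fi_mod" and d X
    by (auto simp: fi_ker_def a_kernel_def kernel_def)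
  let ?K0 = "fi_ker P0 V \<epsilon>"
  have start: "good (P0, ?K0)"
    unfolding good_def case_prod_conv
    by (intro conjI allI impI P0(1) fi_module_ker[OF mod[OF P0(1)] V P0(2)] ker_sub)
  have step: "\<exists>y. good y \<and> next_cover x y"
    if "good x" for x :: "('k, ('k, 'a) univ) fi_mod \<times> (nat set \<Rightarrow> ('k, 'a) univ set)"
  proof -
    obtain P K where x: "x = (P, K)" by (cases x)
    have P: "fi_projective R P" and K: "fi_module R (fi_sub P K)"
      and KP: "\<And>X. finite X \<Longrightarrow> K X \<subseteq> carrier (Ob P X)"
      using that by (auto simp: good_def x)
    obtain Q :: "('k, ('k, 'a) univ) fi_mod" and d
      where Q: "fi_projective R Q" "fi_hom R Q (fi_sub P K) d" "fi_epi Q (fi_sub P K) d"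
      using ex_projective_cover[OF R K, of id] by auto
    have d: "fi_hom R Q P d"
      unfolding fi_hom_def
    proof (intro conjI allI impI)
      fix X :: "nat set" assume X: "finite X"
      have "d X \<in> mod_homs R (Ob Q X) ((Ob P X)\<lparr>carrier := K X\<rparr>)"
        using Q(2) X by (simp add: fi_hom_def fi_sub_def)
      then show "d X \<in> mod_homs R (Ob Q X) (Ob P X)"
        using subsetD[OF KP[OF X]] by (simp add: mod_homs_def Pi_iff)
    qed (use Q(2) in \<open>simp add: fi_hom_def fi_sub_def\<close>)
    have "good (Q, fi_ker Q P d)"
      unfolding good_def case_prod_conv
      by (intro conjI allI impI Q(1) fi_module_ker[OF mod[OF Q(1)] mod[OF P] d] ker_sub)
    moreover have "next_cover (P, K) (Q, fi_ker Q P d)"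
      unfolding next_cover_def using d Q(3) by (auto simp: fi_epi_def fi_im_def fi_sub_def)
    ultimately show ?thesis unfolding x by blast
  qed
  obtain s where s: "s 0 = (P0, ?K0)" "\<And>n. good (s n)" "\<And>n. next_cover (s n) (s (Suc n))"
    using dependent_nat_choice[where P = "\<lambda>n x. good x \<and> (n = 0 \<longrightarrow> x = (P0, ?K0))"
        and Q = "\<lambda>n. next_cover"] start step by (metis Zero_not_Suc)
  define P K where "P = (\<lambda>n. fst (s n))" and "K = (\<lambda>n. snd (s n))"
  have "\<forall>n. \<exists>d. fi_hom R (P (Suc n)) (P n) d \<and>
      (\<forall>X. finite X \<longrightarrow> fi_im (P (Suc n)) d X = K n X \<and> K (Suc n) X = fi_ker (P (Suc n)) (P n) d X)"
    using s(3) by (auto simp: next_cover_def P_def K_def case_prod_beta)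
  then obtain d where d: "\<And>n. fi_hom R (P (Suc n)) (P n) (d n)"
    "\<And>n X. finite X \<Longrightarrow> fi_im (P (Suc n)) (d n) X = K n X"
    "\<And>n X. finite X \<Longrightarrow> K (Suc n) X = fi_ker (P (Suc n)) (P n) (d n) X"
    by metis
  have "fi_projective R (P n)" for n using s(2)[of n] by (auto simp: good_def P_def case_prod_beta)
  moreover have "P 0 = P0" "K 0 = ?K0" using s(1) by (auto simp: P_def K_def)
  ultimately have "projective_resolution R V P d \<epsilon>"
    unfolding projective_resolution_def fi_exact_def using d P0 by simp
  then show ?thesis by blast
qed

end

theory Submission
  imports Defs "HOL-Algebra.Free_Abelian_Groups" "HOL-Library.Function_Algebras"
begin

text \<open>
  Restricting an FI-module \<open>V\<close> to the lattice of subsets of \<open>X\<close>, one sees that \<open>H_a(V)_X\<close> is the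
  homology of a cube complex with terms \<open>\<Oplus> V_{X - T}\<close>, \<open>|T| = a\<close>. The cube on \<open>X \<squnion> {\<star>}\<close> is the
  mapping cone of the cubes of \<open>V\<close> and \<open>SV\<close> on \<open>X\<close>, so that
  \<open>H_a(V)_X \<rightarrow> H_a(SV)_X \<rightarrow> H_a(V)_{X \<squnion> {\<star>}} \<rightarrow> H_{a-1}(V)_X\<close> is exact. Descending induction from
  \<open>S^N V\<close>, \<open>N = N(V)\<close>, along this sequence gives the bound on the regularity.

  That some \<open>S^i V\<close> is acyclic follows by induction on the generation degree. Let \<open>KV\<close> and \<open>DV\<close> be
  the kernel and cokernel of \<open>V \<rightarrow> SV\<close>. Then \<open>DV\<close> has smaller generation degree and bounded
  \<open>H_1\<close>, so it is eventually acyclic and \<open>H_2(DV)\<close> is bounded. The cone of \<open>V \<rightarrow> SV\<close> now bounds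
  \<open>H_0(KV)\<close>, which is \<open>KV\<close> because all injections act by zero on \<open>KV\<close>; hence \<open>S^i V \<rightarrow> S^{i+1} V\<close>
  is injective for large \<open>i\<close>, and then \<open>H_a(S^i V)_{X \<squnion> {\<star>}} = H_a(D S^i V)_X = 0\<close>.
\<close>

section \<open>Acyclicity of mapping cones\<close>

text \<open>Only the vanishing of homology matters, so no homology group is formed: two graded
  subgroups \<open>N\<close> \<le> \<open>C\<close> of one additive group stand for the complex
  \<open>C/N\<close>, and \<open>acyc\<close> is exactness in one degree. Passing to submodules,
  quotients or cokernels changes the subgroups but not the type, so an induction can move from
  \<open>V\<close> to \<open>DV\<close>. The price is that addition and differential must be total,
  and modules with carriers are replaced by formal sums. That the cube computes the derived functors
  is shown by dimension shifting along a projective resolution: the cube is exact in positive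
  degrees on free FI-modules, hence on projectives, and its boundaries in degree 0 are exactly
  \<open>JV\<close>. Eventual acyclicity has to be proved because \<open>fi_N\<close> is a
  \<open>LEAST\<close>; any bound, however large, gives it a meaning. The new point of
  \<open>SV\<close> is placed in two ways, first as in \<open>fi_shift\<close> and last for
  \<open>DV\<close>; then \<open>S D = D S\<close> is an equality and no isomorphisms have to be
  carried along.\<close>

locale graded_complex =
  fixes d :: "'c::ab_group_add \<Rightarrow> 'c" and C N :: "int \<Rightarrow> 'c set"
  assumes d_add: "d (x + y) = d x + d y"
    and C_zero: "0 \<in> C a" and C_diff: "x \<in> C a \<Longrightarrow> y \<in> C a \<Longrightarrow> x - y \<in> C a"
    and N_zero: "0 \<in> N a" and N_diff: "x \<in> N a \<Longrightarrow> y \<in> N a \<Longrightarrow> x - y \<in> N a"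
    and N_C: "x \<in> N a \<Longrightarrow> x \<in> C a"
    and d_C: "x \<in> C a \<Longrightarrow> d x \<in> C (a - 1)" and d_N: "x \<in> N a \<Longrightarrow> d x \<in> N (a - 1)"
    and d_d: "x \<in> C a \<Longrightarrow> d (d x) \<in> N (a - 1 - 1)"
begin

lemma d_zero: "d 0 = 0" using d_add[of 0 0] by simp
lemma d_minus: "d (- x) = - d x" using d_add[of x "- x"] d_zero by (simp add: eq_neg_iff_add_eq_0 add.commute)
lemma d_diff: "d (x - y) = d x - d y" using d_add[of x "- y"] d_minus by simp

lemma C_minus: "x \<in> C a \<Longrightarrow> - x \<in> C a" using C_diff[OF C_zero, of x a] by simp
lemma C_add: "x \<in> C a \<Longrightarrow> y \<in> C a \<Longrightarrow> x + y \<in> C a" using C_diff[OF _ C_minus, of x a y] by simp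
lemma N_minus: "x \<in> N a \<Longrightarrow> - x \<in> N a" using N_diff[OF N_zero, of x a] by simp
lemma N_add: "x \<in> N a \<Longrightarrow> y \<in> N a \<Longrightarrow> x + y \<in> N a" using N_diff[OF _ N_minus, of x a y] by simp
lemma d_C1: "x \<in> C (a + 1) \<Longrightarrow> d x \<in> C a" using d_C[of x "a + 1"] by simp
lemma d_N1: "x \<in> N (a + 1) \<Longrightarrow> d x \<in> N a" using d_N[of x "a + 1"] by simp
lemma d_d1: "x \<in> C (a + 1) \<Longrightarrow> d (d x) \<in> N (a - 1)" using d_d[of x "a + 1"] by simp
lemma d_d2: "x \<in> C (a + 1 + 1) \<Longrightarrow> d (d x) \<in> N a" using d_d[of x "a + 1 + 1"] by simp

end

definition acyc :: "('c::ab_group_add \<Rightarrow> 'c) \<Rightarrow> (int \<Rightarrow> 'c set) \<Rightarrow> (int \<Rightarrow> 'c set) \<Rightarrow> int \<Rightarrow> bool"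
  where "acyc d C N a \<longleftrightarrow> (\<forall>c\<in>C a. d c \<in> N (a - 1) \<longrightarrow> (\<exists>b\<in>C (a + 1). c - d b \<in> N a))"

lemma acycD: "acyc d C N a \<Longrightarrow> c \<in> C a \<Longrightarrow> d c \<in> N (a - 1) \<Longrightarrow> \<exists>b\<in>C (a + 1). c - d b \<in> N a"
  by (simp add: acyc_def)

locale complex_map = S: graded_complex d C N + T: graded_complex d' C' N'
  for d :: "'c::ab_group_add \<Rightarrow> 'c" and C N and d' :: "'e::ab_group_add \<Rightarrow> 'e" and C' N' +
  fixes \<phi> :: "'c \<Rightarrow> 'e"
  assumes \<phi>_add: "\<phi> (x + y) = \<phi> x + \<phi> y"
    and \<phi>_C: "x \<in> C a \<Longrightarrow> \<phi> x \<in> C' a" and \<phi>_N: "x \<in> N a \<Longrightarrow> \<phi> x \<in> N' a"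
    and \<phi>_d: "x \<in> C a \<Longrightarrow> d' (\<phi> x) - \<phi> (d x) \<in> N' (a - 1)"
begin

lemma \<phi>_zero: "\<phi> 0 = 0" using \<phi>_add[of 0 0] by simp
lemma \<phi>_minus: "\<phi> (- x) = - \<phi> x" using \<phi>_add[of x "- x"] \<phi>_zero by (simp add: eq_neg_iff_add_eq_0 add.commute)
lemma \<phi>_diff: "\<phi> (x - y) = \<phi> x - \<phi> y" using \<phi>_add[of x "- y"] \<phi>_minus by simp

lemma \<phi>_d1: "x \<in> C (a + 1) \<Longrightarrow> d' (\<phi> x) - \<phi> (d x) \<in> N' a" using \<phi>_d[of x "a + 1"] by simp

text \<open>Acyclicity in degree \<open>a\<close> of the mapping cone of \<open>\<phi>\<close>, with differential
  \<open>(c0, c1) \<mapsto> (d' c0 + \<phi> c1, - d c1)\<close>.\<close>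

definition cone_acyc :: "int \<Rightarrow> bool"
  where "cone_acyc a \<longleftrightarrow> (\<forall>c0\<in>C' a. \<forall>c1\<in>C (a - 1).
    d' c0 + \<phi> c1 \<in> N' (a - 1) \<longrightarrow> d c1 \<in> N (a - 1 - 1) \<longrightarrow>
    (\<exists>b0\<in>C' (a + 1). \<exists>b1\<in>C a. c0 - (d' b0 + \<phi> b1) \<in> N' a \<and> c1 + d b1 \<in> N (a - 1)))"

lemma cone_acycD: "cone_acyc a \<Longrightarrow> c0 \<in> C' a \<Longrightarrow> c1 \<in> C (a - 1) \<Longrightarrow> d' c0 + \<phi> c1 \<in> N' (a - 1) \<Longrightarrow>
  d c1 \<in> N (a - 1 - 1) \<Longrightarrow> \<exists>b0\<in>C' (a + 1). \<exists>b1\<in>C a. c0 - (d' b0 + \<phi> b1) \<in> N' a \<and> c1 + d b1 \<in> N (a - 1)"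
  by (auto simp: cone_acyc_def)

abbreviation coker_N :: "int \<Rightarrow> 'e set"
  where "coker_N a \<equiv> {x + \<phi> y |x y. x \<in> N' a \<and> y \<in> C a}"

text \<open>Exactness of \<open>H_a(C') \<rightarrow> H_a(cone) \<rightarrow> H_{a-1}(C)\<close>:
  the component \<open>c1\<close> is removed first, and its primitive corrects \<open>c0\<close> to
  a cycle.\<close>

lemma cone_acycI1:
  assumes "acyc d' C' N' a" "acyc d C N (a - 1)"
  shows "cone_acyc a"
  unfolding cone_acyc_def
proof (intro ballI impI)
  fix c0 c1 assume c: "c0 \<in> C' a" "c1 \<in> C (a - 1)" "d' c0 + \<phi> c1 \<in> N' (a - 1)" "d c1 \<in> N (a - 1 - 1)"
  obtain b1 where b1: "b1 \<in> C a" "c1 - d b1 \<in> N (a - 1)" using acycD[OF assms(2) c(2,4)] by auto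
  have "d' (c0 + \<phi> b1) = (d' c0 + \<phi> c1) + (d' (\<phi> b1) - \<phi> (d b1)) - \<phi> (c1 - d b1)"
    by (simp add: T.d_add \<phi>_diff)
  also have "\<dots> \<in> N' (a - 1)" by (intro T.N_diff T.N_add c \<phi>_d \<phi>_N b1)
  finally have "\<exists>b\<in>C' (a + 1). c0 + \<phi> b1 - d' b \<in> N' a"
    by (intro acycD[OF assms(1)] T.C_add c \<phi>_C b1)
  then obtain b0 where b0: "b0 \<in> C' (a + 1)" "c0 + \<phi> b1 - d' b0 \<in> N' a" by auto
  show "\<exists>b0\<in>C' (a + 1). \<exists>b1\<in>C a. c0 - (d' b0 + \<phi> b1) \<in> N' a \<and> c1 + d b1 \<in> N (a - 1)"
    by (intro bexI[OF _ b0(1)] bexI[of _ "- b1"] S.C_minus b1(1))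
      (use b0 b1 in \<open>simp add: \<phi>_minus S.d_minus algebra_simps\<close>)
qed

text \<open>Exactness of \<open>H_a(C) \<rightarrow> H_a(C') \<rightarrow> H_a(cone)\<close>,
  applied to the cone cycle with second component 0.\<close>

lemma acyc_target:
  assumes "cone_acyc a" "acyc d C N a"
  shows "acyc d' C' N' a"
  unfolding acyc_def
proof (intro ballI impI)
  fix c assume c: "c \<in> C' a" "d' c \<in> N' (a - 1)"
  obtain b0 b1 where b: "b0 \<in> C' (a + 1)" "b1 \<in> C a" "c - (d' b0 + \<phi> b1) \<in> N' a" "d b1 \<in> N (a - 1)"
    using cone_acycD[OF assms(1) c(1) S.C_zero] c(2) by (auto simp: \<phi>_zero S.d_zero S.N_zero)
  obtain e where e: "e \<in> C (a + 1)" "b1 - d e \<in> N a" using acycD[OF assms(2) b(2,4)] by auto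
  have "c - d' (b0 + \<phi> e) = c - (d' b0 + \<phi> b1) + \<phi> (b1 - d e) - (d' (\<phi> e) - \<phi> (d e))"
    by (simp add: T.d_add \<phi>_diff)
  also have "\<dots> \<in> N' a" by (rule T.N_diff[OF T.N_add[OF b(3) \<phi>_N[OF e(2)]] \<phi>_d1[OF e(1)]])
  finally show "\<exists>b\<in>C' (a + 1). c - d' b \<in> N' a"
    by (intro bexI[of _ "b0 + \<phi> e"] T.C_add b \<phi>_C e)
qed

text \<open>The cone maps onto the cokernel of \<open>\<phi>\<close>. The obstruction to lifting a
  cycle of degree \<open>a\<close> lies in \<open>H_{a-2}(ker \<phi>)\<close>, and it disappears
  when \<open>C/N\<close> is zero in degree \<open>a - 2\<close>.\<close>

lemma acyc_coker_low:
  assumes "cone_acyc a" "C (a - 1 - 1) \<subseteq> N (a - 1 - 1)"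
  shows "acyc d' C' coker_N a"
  unfolding acyc_def
proof (intro ballI impI)
  fix c assume c: "c \<in> C' a" "d' c \<in> coker_N (a - 1)"
  then obtain x e where e: "d' c = x + \<phi> e" "x \<in> N' (a - 1)" "e \<in> C (a - 1)" by auto
  have "d' c + \<phi> (- e) \<in> N' (a - 1)" "- e \<in> C (a - 1)" "d (- e) \<in> N (a - 1 - 1)"
    using e assms(2) S.d_C[OF S.C_minus[OF e(3)]] by (auto simp: \<phi>_minus S.C_minus)
  from cone_acycD[OF assms(1) c(1) this(2,1,3)]
  obtain b0 b1 where b: "b0 \<in> C' (a + 1)" "b1 \<in> C a" "c - (d' b0 + \<phi> b1) \<in> N' a" by blast
  have "c - d' b0 = (c - (d' b0 + \<phi> b1)) + \<phi> b1" by simp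
  with b show "\<exists>b\<in>C' (a + 1). c - d' b \<in> coker_N a" by blast
qed

text \<open>Exactness of \<open>H_{a-1}(ker \<phi>) \<rightarrow> H_a(cone) \<rightarrow> H_a(coker
  \<phi>)\<close>, with the first term zero by injectivity in degree \<open>a - 1\<close>.\<close>

lemma cone_acycI_inj:
  assumes "acyc d' C' coker_N a" "\<And>x. x \<in> C (a - 1) \<Longrightarrow> \<phi> x \<in> N' (a - 1) \<Longrightarrow> x \<in> N (a - 1)"
  shows "cone_acyc a"
  unfolding cone_acyc_def
proof (intro ballI impI)
  fix c0 c1 assume c: "c0 \<in> C' a" "c1 \<in> C (a - 1)" "d' c0 + \<phi> c1 \<in> N' (a - 1)"
  have "d' c0 = (d' c0 + \<phi> c1) + \<phi> (- c1)" by (simp add: \<phi>_minus)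
  then have "d' c0 \<in> coker_N (a - 1)" using c S.C_minus by blast
  from acycD[OF assms(1) c(1) this]
  obtain b x e where b: "b \<in> C' (a + 1)" "c0 - d' b = x + \<phi> e" "x \<in> N' a" "e \<in> C a" by auto
  have x: "x = c0 - d' b - \<phi> e" using b(2) by simp
  have "\<phi> (c1 + d e) = d' c0 + \<phi> c1 - d' (d' b) - (d' (\<phi> e) - \<phi> (d e)) - d' x"
    unfolding x by (simp add: \<phi>_add T.d_diff)
  also have "\<dots> \<in> N' (a - 1)" by (rule T.N_diff[OF T.N_diff[OF T.N_diff[OF c(3) T.d_d1[OF b(1)]] \<phi>_d[OF b(4)]] T.d_N[OF b(3)]])
  finally have "c1 + d e \<in> N (a - 1)" by (intro assms(2) S.C_add c S.d_C b)
  moreover have "c0 - (d' b + \<phi> e) \<in> N' a" using b(3) x by (simp add: algebra_simps)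
  ultimately show "\<exists>b0\<in>C' (a + 1). \<exists>b1\<in>C a. c0 - (d' b0 + \<phi> b1) \<in> N' a \<and> c1 + d b1 \<in> N (a - 1)"
    using b by blast
qed

text \<open>Exactness of \<open>H_{a+1}(coker \<phi>) \<rightarrow> H_{a-1}(ker \<phi>)
  \<rightarrow> H_a(cone)\<close>. The cone cycle \<open>(0, e)\<close> bounds some
  \<open>(b0, b1)\<close>; then \<open>b0\<close> is a cycle of the cokernel, and its primitive
  there corrects \<open>- b1\<close> to an element of the kernel.\<close>

lemma ker_boundary:
  assumes "acyc d' C' coker_N (a + 1)" "cone_acyc a" "e \<in> C (a - 1)" "\<phi> e \<in> N' (a - 1)"
    "d e \<in> N (a - 1 - 1)"
  shows "\<exists>z\<in>C a. \<phi> z \<in> N' a \<and> e - d z \<in> N (a - 1)"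
proof -
  obtain b0 b1 where b: "b0 \<in> C' (a + 1)" "b1 \<in> C a" "0 - (d' b0 + \<phi> b1) \<in> N' a" "e + d b1 \<in> N (a - 1)"
    using cone_acycD[OF assms(2) T.C_zero assms(3) _ assms(5)] assms(4) unfolding T.d_zero add_0 by blast
  have b3: "d' b0 + \<phi> b1 \<in> N' a" using T.N_minus[OF b(3)] by (simp add: add.commute)
  have "d' b0 = (d' b0 + \<phi> b1) + \<phi> (- b1)" by (simp add: \<phi>_minus)
  then have "d' b0 \<in> coker_N (a + 1 - 1)" using b3 S.C_minus[OF b(2)] by fastforce
  from acycD[OF assms(1) b(1) this]
  obtain x t y where y: "x \<in> C' (a + 1 + 1)" "b0 - d' x = t + \<phi> y" "t \<in> N' (a + 1)" "y \<in> C (a + 1)" by auto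
  have t: "t = b0 - d' x - \<phi> y" using y(2) by simp
  have "\<phi> (- b1 - d y) = (0 - (d' b0 + \<phi> b1)) + (d' (\<phi> y) - \<phi> (d y)) + d' (d' x) + d' t"
    unfolding t by (simp add: \<phi>_diff \<phi>_minus T.d_diff)
  also have "\<dots> \<in> N' a"
    by (rule T.N_add[OF T.N_add[OF T.N_add[OF b(3) \<phi>_d1[OF y(4)]] T.d_d2[OF y(1)]] T.d_N1[OF y(3)]])
  finally have z: "\<phi> (- b1 - d y) \<in> N' a" .
  have "e - d (- b1 - d y) = (e + d b1) + d (d y)" by (simp add: S.d_diff S.d_minus)
  also have "\<dots> \<in> N (a - 1)" by (rule S.N_add[OF b(4) S.d_d1[OF y(4)]])
  finally have "e - d (- b1 - d y) \<in> N (a - 1)" .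
  moreover have "- b1 - d y \<in> C a" by (rule S.C_diff[OF S.C_minus[OF b(2)] S.d_C1[OF y(4)]])
  ultimately show ?thesis using z by blast
qed

text \<open>If \<open>C'\<close> is the direct sum of a subcomplex \<open>Q\<close> and an
  isomorphic image of \<open>C\<close>, the cone is an extension of the cone of an isomorphism by
  \<open>Q\<close>, so its homology is that of \<open>Q\<close>.\<close>

lemma cone_acycI_split:
  assumes "acyc d' Q N' a"
    and QC: "\<And>a x. x \<in> Q a \<Longrightarrow> x \<in> C' a"
    and dQ: "\<And>x. x \<in> Q a \<Longrightarrow> d' x \<in> Q (a - 1)"
    and sum: "\<And>x. x \<in> C' a \<Longrightarrow> \<exists>q\<in>Q a. \<exists>p\<in>C a. x - (q + \<phi> p) \<in> N' a"
    and direct: "\<And>q p. q \<in> Q (a - 1) \<Longrightarrow> p \<in> C (a - 1) \<Longrightarrow> q + \<phi> p \<in> N' (a - 1) \<Longrightarrow>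
      q \<in> N' (a - 1) \<and> p \<in> N (a - 1)"
  shows "cone_acyc a"
  unfolding cone_acyc_def
proof (intro ballI impI)
  fix c0 c1 assume c: "c0 \<in> C' a" "c1 \<in> C (a - 1)" "d' c0 + \<phi> c1 \<in> N' (a - 1)"
  obtain q p where q: "q \<in> Q a" "p \<in> C a" "c0 - (q + \<phi> p) \<in> N' a" using sum[OF c(1)] by blast
  have "d' q + \<phi> (d p + c1) = (d' c0 + \<phi> c1) - d' (c0 - (q + \<phi> p)) - (d' (\<phi> p) - \<phi> (d p))"
    by (simp add: \<phi>_add T.d_add T.d_diff)
  also have "\<dots> \<in> N' (a - 1)" by (rule T.N_diff[OF T.N_diff[OF c(3) T.d_N[OF q(3)]] \<phi>_d[OF q(2)]])
  finally have *: "d' q \<in> N' (a - 1) \<and> d p + c1 \<in> N (a - 1)"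
    by (intro direct dQ q S.C_add S.d_C c)
  then obtain b where b: "b \<in> Q (a + 1)" "q - d' b \<in> N' a" using acycD[OF assms(1) q(1)] by blast
  have "c0 - (d' b + \<phi> p) = (c0 - (q + \<phi> p)) + (q - d' b)" by simp
  also have "\<dots> \<in> N' a" by (intro T.N_add q b)
  finally show "\<exists>b0\<in>C' (a + 1). \<exists>b1\<in>C a. c0 - (d' b0 + \<phi> b1) \<in> N' a \<and> c1 + d b1 \<in> N (a - 1)"
    using * QC[OF b(1)] q(2) by (metis add.commute)
qed

text \<open>\<open>\<psi>\<close> enters only in degree \<open>a\<close> and only through cycles, so
  that a mere choice of preimages, as in \<open>acyc_iso\<close>, can serve: it makes
  \<open>\<phi>\<close> onto in \<open>H_a\<close>.\<close>

lemma acyc_retract: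
  assumes "acyc d C N a"
    and \<psi>: "\<And>x. x \<in> C' a \<Longrightarrow> \<psi> x \<in> C a" "\<And>x. x \<in> C' a \<Longrightarrow> d' x \<in> N' (a - 1) \<Longrightarrow> d (\<psi> x) \<in> N (a - 1)"
      "\<And>x. x \<in> C' a \<Longrightarrow> x - \<phi> (\<psi> x) \<in> N' a"
  shows "acyc d' C' N' a"
  unfolding acyc_def
proof (intro ballI impI)
  fix c assume c: "c \<in> C' a" "d' c \<in> N' (a - 1)"
  obtain b where b: "b \<in> C (a + 1)" "\<psi> c - d b \<in> N a"
    using acycD[OF assms(1) \<psi>(1)[OF c(1)] \<psi>(2)[OF c]] by blast
  have "c - d' (\<phi> b) = (c - \<phi> (\<psi> c)) + \<phi> (\<psi> c - d b) - (d' (\<phi> b) - \<phi> (d b))" by (simp add: \<phi>_diff)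
  also have "\<dots> \<in> N' a" by (rule T.N_diff[OF T.N_add[OF \<psi>(3)[OF c(1)] \<phi>_N[OF b(2)]] \<phi>_d1[OF b(1)]])
  finally show "\<exists>b\<in>C' (a + 1). c - d' b \<in> N' a" using \<phi>_C[OF b(1)] by blast
qed

lemma acyc_iso:
  assumes surj: "\<And>a y. y \<in> C' a \<Longrightarrow> \<exists>x\<in>C a. y - \<phi> x \<in> N' a"
    and ker: "\<And>a x. x \<in> C a \<Longrightarrow> \<phi> x \<in> N' a \<Longrightarrow> x \<in> N a"
  shows "acyc d C N a \<longleftrightarrow> acyc d' C' N' a"
proof
  assume *: "acyc d C N a"
  have "\<forall>x. \<exists>y. x \<in> C' a \<longrightarrow> y \<in> C a \<and> x - \<phi> y \<in> N' a" using surj by blast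
  then obtain \<psi> where \<psi>: "\<And>x. x \<in> C' a \<Longrightarrow> \<psi> x \<in> C a \<and> x - \<phi> (\<psi> x) \<in> N' a" by metis
  show "acyc d' C' N' a"
  proof (rule acyc_retract[OF *, of \<psi>])
    fix x assume x: "x \<in> C' a" "d' x \<in> N' (a - 1)"
    have "\<phi> (d (\<psi> x)) = d' x - d' (x - \<phi> (\<psi> x)) - (d' (\<phi> (\<psi> x)) - \<phi> (d (\<psi> x)))" by (simp add: T.d_diff)
    also have "\<dots> \<in> N' (a - 1)" using \<psi>[OF x(1)] by (intro T.N_diff[OF T.N_diff[OF x(2) T.d_N] \<phi>_d]) auto
    finally show "d (\<psi> x) \<in> N (a - 1)" using \<psi>[OF x(1)] by (intro ker S.d_C) auto
  qed (use \<psi> in auto)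
next
  assume *: "acyc d' C' N' a"
  show "acyc d C N a"
    unfolding acyc_def
  proof (intro ballI impI)
    fix c assume c: "c \<in> C a" "d c \<in> N (a - 1)"
    have "d' (\<phi> c) = (d' (\<phi> c) - \<phi> (d c)) + \<phi> (d c)" by simp
    also have "\<dots> \<in> N' (a - 1)" by (rule T.N_add[OF \<phi>_d[OF c(1)] \<phi>_N[OF c(2)]])
    finally obtain b' where b': "b' \<in> C' (a + 1)" "\<phi> c - d' b' \<in> N' a" using acycD[OF * \<phi>_C[OF c(1)]] by blast
    obtain b where b: "b \<in> C (a + 1)" "b' - \<phi> b \<in> N' (a + 1)" using surj[OF b'(1)] by blast
    have "\<phi> (c - d b) = (\<phi> c - d' b') + d' (b' - \<phi> b) + (d' (\<phi> b) - \<phi> (d b))" by (simp add: T.d_diff \<phi>_diff)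
    also have "\<dots> \<in> N' a" by (rule T.N_add[OF T.N_add[OF b'(2) T.d_N1[OF b(2)]] \<phi>_d1[OF b(1)]])
    finally have "c - d b \<in> N a" by (intro ker S.C_diff c S.d_C1 b)
    then show "\<exists>b\<in>C (a + 1). c - d b \<in> N a" using b(1) by blast
  qed
qed

end

text \<open>Dimension shifting along \<open>0 \<rightarrow> W/N \<rightarrow> C/N \<rightarrow> C/W \<rightarrow> 0\<close>.\<close>

locale subcomplex = graded_complex +
  fixes W :: "int \<Rightarrow> 'c::ab_group_add set"
  assumes W_diff: "x \<in> W a \<Longrightarrow> y \<in> W a \<Longrightarrow> x - y \<in> W a"
    and W_C: "x \<in> W a \<Longrightarrow> x \<in> C a" and N_W: "x \<in> N a \<Longrightarrow> x \<in> W a"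
    and d_W: "x \<in> W a \<Longrightarrow> d x \<in> W (a - 1)"
begin

lemma W_add: "x \<in> W a \<Longrightarrow> y \<in> W a \<Longrightarrow> x + y \<in> W a"
  using W_diff[OF _ W_diff[OF N_W[OF N_zero]], of x a y] by simp

text \<open>When \<open>H_{a+1}(C/N) = 0\<close>, the connecting map identifies
  \<open>H_{a+1}(C/W)\<close> with the kernel of \<open>H_a(W/N) \<rightarrow> H_a(C/N)\<close>.
  Nothing is asked of \<open>H_a(C/N)\<close>, which is what the bottom degree \<open>a = 0\<close>
  requires.\<close>

lemma acyc_shift_0:
  assumes "acyc d C N (a + 1)"
  shows "acyc d C W (a + 1) \<longleftrightarrow>
    (\<forall>w\<in>W a. (\<exists>c\<in>C (a + 1). w - d c \<in> N a) \<longrightarrow> (\<exists>v\<in>W (a + 1). w - d v \<in> N a))"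
proof
  assume *: "acyc d C W (a + 1)"
  show "\<forall>w\<in>W a. (\<exists>c\<in>C (a + 1). w - d c \<in> N a) \<longrightarrow> (\<exists>v\<in>W (a + 1). w - d v \<in> N a)"
  proof (intro ballI impI)
    fix w assume w: "w \<in> W a" "\<exists>c\<in>C (a + 1). w - d c \<in> N a"
    then obtain c where c: "c \<in> C (a + 1)" "w - d c \<in> N a" by blast
    have "d c = w - (w - d c)" by simp
    then have "d c \<in> W a" using W_diff[OF w(1) N_W[OF c(2)]] by simp
    then obtain b where b: "b \<in> C (a + 1 + 1)" "c - d b \<in> W (a + 1)"
      using acycD[OF * c(1)] by auto
    have "w - d (c - d b) = (w - d c) + d (d b)" by (simp add: d_diff)
    also have "\<dots> \<in> N a" by (rule N_add[OF c(2) d_d2[OF b(1)]])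
    finally show "\<exists>v\<in>W (a + 1). w - d v \<in> N a" using b(2) by blast
  qed
next
  assume *: "\<forall>w\<in>W a. (\<exists>c\<in>C (a + 1). w - d c \<in> N a) \<longrightarrow> (\<exists>v\<in>W (a + 1). w - d v \<in> N a)"
  show "acyc d C W (a + 1)"
    unfolding acyc_def
  proof (intro ballI impI)
    fix c assume c: "c \<in> C (a + 1)" "d c \<in> W (a + 1 - 1)"
    obtain w where w: "w \<in> W (a + 1)" "d c - d w \<in> N a"
      using *[rule_format, of "d c"] c N_zero[of a] by (metis add_diff_cancel_right' diff_self)
    obtain b where b: "b \<in> C (a + 1 + 1)" "c - w - d b \<in> N (a + 1)"
      using acycD[OF assms(1) C_diff[OF c(1) W_C[OF w(1)]]] w by (auto simp: d_diff)
    have "c - d b = (c - w - d b) + w" by simp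
    also have "\<dots> \<in> W (a + 1)" by (intro W_add N_W b w)
    finally show "\<exists>b\<in>C (a + 1 + 1). c - d b \<in> W (a + 1)" using b(1) by blast
  qed
qed

text \<open>If \<open>H_a(C/N)\<close> vanishes too, the kernel in \<open>acyc_shift_0\<close> is
  all of \<open>H_a(W/N)\<close>.\<close>

lemma acyc_shift:
  assumes "acyc d C N (a + 1)" "acyc d C N a"
  shows "acyc d C W (a + 1) \<longleftrightarrow> acyc d W N a"
  unfolding acyc_shift_0[OF assms(1)]
proof
  assume *: "\<forall>w\<in>W a. (\<exists>c\<in>C (a + 1). w - d c \<in> N a) \<longrightarrow> (\<exists>v\<in>W (a + 1). w - d v \<in> N a)"
  show "acyc d W N a"
    unfolding acyc_def using * acycD[OF assms(2) W_C] by blast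
next
  assume *: "acyc d W N a"
  show "\<forall>w\<in>W a. (\<exists>c\<in>C (a + 1). w - d c \<in> N a) \<longrightarrow> (\<exists>v\<in>W (a + 1). w - d v \<in> N a)"
  proof (intro ballI impI)
    fix w assume w: "w \<in> W a" "\<exists>c\<in>C (a + 1). w - d c \<in> N a"
    then obtain c where c: "c \<in> C (a + 1)" "w - d c \<in> N a" by blast
    have "d w = d (w - d c) + d (d c)" by (simp add: d_diff)
    also have "\<dots> \<in> N (a - 1)" by (rule N_add[OF d_N[OF c(2)] d_d1[OF c(1)]])
    finally show "\<exists>v\<in>W (a + 1). w - d v \<in> N a" by (rule acycD[OF * w(1)])
  qed
qed

end

section \<open>The cube complex of an FI-system\<close>

type_synonym 'g action = "nat \<Rightarrow> nat \<Rightarrow> (nat \<Rightarrow> nat) \<Rightarrow> 'g \<Rightarrow> 'g"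

definition inj_maps :: "nat \<Rightarrow> nat \<Rightarrow> (nat \<Rightarrow> nat) set"
  where "inj_maps m n = {f. inj_on f {..<m} \<and> f ` {..<m} \<subseteq> {..<n}}"

definition up :: "(nat \<Rightarrow> nat) \<Rightarrow> nat \<Rightarrow> nat"
  where "up f = case_nat 0 (\<lambda>x. Suc (f x))"

definition ext_last :: "nat \<Rightarrow> nat \<Rightarrow> (nat \<Rightarrow> nat) \<Rightarrow> nat \<Rightarrow> nat"
  where "ext_last m n f = (\<lambda>x. if x < m then f x else n)"

definition shift_front :: "'g action \<Rightarrow> 'g action"
  where "shift_front F = (\<lambda>m n f. F (Suc m) (Suc n) (up f))"

text \<open>With the new point last, \<open>V \<rightarrow> SV\<close> is induced by the inclusions
  \<open>{..<m} \<subseteq> {..<Suc m}\<close>, and the shift commutes strictly with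
  \<open>shift_front\<close>. Two points both added in front would commute only up to a
  transposition.\<close>

definition shift_back :: "'g action \<Rightarrow> 'g action"
  where "shift_back F = (\<lambda>m n f. F (Suc m) (Suc n) (ext_last m n f))"

definition shift_set :: "(nat \<Rightarrow> 'g set) \<Rightarrow> nat \<Rightarrow> 'g set"
  where "shift_set A m = A (Suc m)"

text \<open>The denominator of the derivative \<open>DV\<close>, the cokernel of
  \<open>V \<rightarrow> SV\<close>; its numerator is \<open>shift_set A\<close>.\<close>

definition deriv_set :: "'g::ab_group_add action \<Rightarrow> (nat \<Rightarrow> 'g set) \<Rightarrow> (nat \<Rightarrow> 'g set) \<Rightarrow> nat \<Rightarrow> 'g set"
  where "deriv_set F A B m = {x + F m (Suc m) (\<lambda>i. i) y |x y. x \<in> B (Suc m) \<and> y \<in> A m}"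

abbreviation "falses l \<equiv> count_list l False"
abbreviation "trues l \<equiv> count_list l True"

text \<open>A list \<open>l\<close> of length \<open>n\<close> encodes the subset \<open>T\<close> of \<open>{..<n}\<close> of the positions of \<open>True\<close>. The
  value of a chain at \<open>l\<close> lies in \<open>V_{{..<n} - T}\<close>, identified with \<open>V_{..<m}\<close> by the increasing
  bijection, where \<open>m\<close> is the number of entries \<open>False\<close>; the degree is the number of entries
  \<open>True\<close>. The recursion describes the cube as an iterated mapping cone.\<close>

fun bd :: "'g::ab_group_add action \<Rightarrow> (bool list \<Rightarrow> 'g) \<Rightarrow> bool list \<Rightarrow> 'g" where
  "bd F c [] = 0"
| "bd F c (False # l) = bd (shift_front F) (\<lambda>l. c (False # l)) l
    + F (falses l) (Suc (falses l)) Suc (c (True # l))"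
| "bd F c (True # l) = - bd F (\<lambda>l. c (True # l)) l"

text \<open>In negative degrees the condition is void, so every function is a chain there, both for
  \<open>A\<close> and for \<open>B\<close>.\<close>

definition cubes :: "(nat \<Rightarrow> 'g set) \<Rightarrow> nat \<Rightarrow> int \<Rightarrow> (bool list \<Rightarrow> 'g) set"
  where "cubes A n a = {c. \<forall>l. length l = n \<longrightarrow> int (trues l) = a \<longrightarrow> c l \<in> A (falses l)}"

definition vanish :: "'g::ab_group_add action \<Rightarrow> (nat \<Rightarrow> 'g set) \<Rightarrow> (nat \<Rightarrow> 'g set) \<Rightarrow> int \<Rightarrow> nat \<Rightarrow> bool"
  where "vanish F A B a n \<longleftrightarrow> acyc (bd F) (cubes A n) (cubes B n) a"

lemma cubesI: "(\<And>l. length l = n \<Longrightarrow> int (trues l) = a \<Longrightarrow> c l \<in> A (falses l)) \<Longrightarrow> c \<in> cubes A n a"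
  by (simp add: cubes_def)

lemma cubesD: "c \<in> cubes A n a \<Longrightarrow> length l = n \<Longrightarrow> int (trues l) = a \<Longrightarrow> c l \<in> A (falses l)"
  by (simp add: cubes_def)

lemma inj_mapsD: "f \<in> inj_maps m n \<Longrightarrow> x < m \<Longrightarrow> f x < n"
  "f \<in> inj_maps m n \<Longrightarrow> inj_on f {..<m}"
  by (auto simp: inj_maps_def)

lemma inj_mapsI: "(\<And>x. x < m \<Longrightarrow> f x < n) \<Longrightarrow> (\<And>x y. x < m \<Longrightarrow> y < m \<Longrightarrow> f x = f y \<Longrightarrow> x = y) \<Longrightarrow> f \<in> inj_maps m n"
  by (auto simp: inj_maps_def inj_on_def)

lemma inj_maps_inj: "f \<in> inj_maps m n \<Longrightarrow> x < m \<Longrightarrow> y < m \<Longrightarrow> f x = f y \<longleftrightarrow> x = y"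
  by (auto simp: inj_maps_def inj_on_def)

lemma inj_maps_id: "m \<le> n \<Longrightarrow> (\<lambda>i. i) \<in> inj_maps m n" and inj_maps_Suc: "Suc \<in> inj_maps m (Suc m)"
  by (auto intro: inj_mapsI)


lemma up_simps[simp]: "up f 0 = 0" "up f (Suc x) = Suc (f x)" by (simp_all add: up_def)

lemma up_id: "up (\<lambda>i. i) = (\<lambda>i. i)" by (auto simp: up_def fun_eq_iff split: nat.split)

lemma up_comp: "up (\<lambda>x. g (f x)) = (\<lambda>x. up g (up f x))" by (auto simp: up_def fun_eq_iff split: nat.split)

lemma inj_maps_up: "f \<in> inj_maps m n \<Longrightarrow> up f \<in> inj_maps (Suc m) (Suc n)"
  by (rule inj_mapsI) (auto simp: up_def inj_maps_inj inj_mapsD split: nat.splits)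

lemma inj_maps_ext_last: "f \<in> inj_maps m n \<Longrightarrow> ext_last m n f \<in> inj_maps (Suc m) (Suc n)"
  by (rule inj_mapsI) (auto simp: ext_last_def inj_maps_inj dest: inj_mapsD(1) split: if_splits)

lemma shift_front_back: "shift_front (shift_back F) = shift_back (shift_front F)"
proof -
  have "ext_last (Suc m) (Suc n) (up f) = up (ext_last m n f)" for m n f
    by (auto simp: ext_last_def up_def fun_eq_iff split: nat.split)
  then show ?thesis by (simp add: shift_front_def shift_back_def)
qed

lemma shift_deriv_set: "shift_set (deriv_set F A B) = deriv_set (shift_front F) (shift_set A) (shift_set B)"
  by (simp add: shift_set_def deriv_set_def shift_front_def up_id fun_eq_iff)

text \<open>Additivity holds on the whole type, so that \<open>bd F\<close> is additive on arbitrary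
  functions; the functor laws hold on \<open>A\<close>. Morphisms are total functions, whence
  \<open>F_cong\<close>.\<close>

locale fi_action =
  fixes F :: "'g::ab_group_add action" and A :: "nat \<Rightarrow> 'g set"
  assumes F_add: "F m n f (x + y) = F m n f x + F m n f y"
    and A_zero: "0 \<in> A m" and A_diff: "x \<in> A m \<Longrightarrow> y \<in> A m \<Longrightarrow> x - y \<in> A m"
    and F_A: "f \<in> inj_maps m n \<Longrightarrow> x \<in> A m \<Longrightarrow> F m n f x \<in> A n"
    and F_comp: "f \<in> inj_maps m n \<Longrightarrow> g \<in> inj_maps n p \<Longrightarrow> x \<in> A m \<Longrightarrow>
      F m p (\<lambda>i. g (f i)) x = F n p g (F m n f x)"
    and F_cong: "(\<And>i. i < m \<Longrightarrow> f i = g i) \<Longrightarrow> F m n f = F m n g"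
begin

lemma F_zero: "F m n f 0 = 0" using F_add[of m n f 0 0] by simp
lemma F_minus: "F m n f (- x) = - F m n f x"
  using F_add[of m n f x "- x"] F_zero by (simp add: eq_neg_iff_add_eq_0 add.commute)
lemma F_diff: "F m n f (x - y) = F m n f x - F m n f y" using F_add[of m n f x "- y"] F_minus by simp

lemma A_minus: "x \<in> A m \<Longrightarrow> - x \<in> A m" using A_diff[OF A_zero, of x m] by simp
lemma A_add: "x \<in> A m \<Longrightarrow> y \<in> A m \<Longrightarrow> x + y \<in> A m" using A_diff[OF _ A_minus, of x m y] by simp

lemma fi_action_front: "fi_action (shift_front F) (shift_set A)"
  unfolding shift_front_def shift_set_def
proof unfold_locales
  fix m n :: nat and f g :: "nat \<Rightarrow> nat" assume "\<And>i. i < m \<Longrightarrow> f i = g i"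
  then show "F (Suc m) (Suc n) (up f) = F (Suc m) (Suc n) (up g)"
    by (intro F_cong) (auto simp: up_def split: nat.split)
next
  fix m n p :: nat and f g :: "nat \<Rightarrow> nat" and x assume "f \<in> inj_maps m n" "g \<in> inj_maps n p" "x \<in> A (Suc m)"
  then show "F (Suc m) (Suc p) (up (\<lambda>i. g (f i))) x = F (Suc n) (Suc p) (up g) (F (Suc m) (Suc n) (up f) x)"
    unfolding up_comp by (intro F_comp inj_maps_up)
qed (simp_all add: F_add A_zero A_diff F_A inj_maps_up)

lemma fi_action_back: "fi_action (shift_back F) (shift_set A)"
  unfolding shift_back_def shift_set_def
proof unfold_locales
  fix f m n g p x assume a: "f \<in> inj_maps m n" "g \<in> inj_maps n p" "x \<in> A (Suc m)"
  have "F (Suc m) (Suc p) (ext_last m p (\<lambda>i. g (f i))) = F (Suc m) (Suc p) (\<lambda>i. ext_last n p g (ext_last m n f i))"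
    by (rule F_cong) (use a inj_mapsD(1)[OF a(1)] in \<open>auto simp: ext_last_def\<close>)
  then show "F (Suc m) (Suc p) (ext_last m p (\<lambda>i. g (f i))) x = F (Suc n) (Suc p) (ext_last n p g) (F (Suc m) (Suc n) (ext_last m n f) x)"
    using F_comp[OF inj_maps_ext_last[OF a(1)] inj_maps_ext_last[OF a(2)] a(3)] by simp
next
  fix m n :: nat and f g :: "nat \<Rightarrow> nat" assume "\<And>i. i < m \<Longrightarrow> f i = g i"
  then show "F (Suc m) (Suc n) (ext_last m n f) = F (Suc m) (Suc n) (ext_last m n g)"
    by (intro F_cong) (auto simp: ext_last_def)
qed (simp_all add: F_add A_zero A_diff F_A inj_maps_ext_last)

end

section \<open>Additivity, naturality and vanishing square of the cube differential\<close>

lemma bd_add: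
  assumes "\<And>m n f x y. F m n f (x + y) = F m n f x + F m n f y"
  shows "bd F (\<lambda>l. c l + c' l) l = bd F c l + bd F c' l"
  using assms
proof (induction l arbitrary: F c c')
  case (Cons b l)
  have s: "shift_front F m n f (x + y) = shift_front F m n f x + shift_front F m n f y" for m n f x y
    by (simp add: shift_front_def Cons.prems)
  show ?case
    using Cons.IH[of F, OF Cons.prems] Cons.IH[of "shift_front F", OF s]
    by (cases b) (simp_all add: Cons.prems algebra_simps)
qed simp

lemma bd_uminus:
  assumes "\<And>m n f x y. F m n f (x + y) = F m n f x + F m n f y"
  shows "bd F (\<lambda>l. - c l) l = - bd F c l"
proof -
  have z: "bd F (\<lambda>l. 0) l = 0" using bd_add[where F = F, OF assms, where c = "\<lambda>l. 0" and c' = "\<lambda>l. 0" and l = l] by simp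
  show ?thesis using bd_add[where F = F, OF assms, where c = "\<lambda>l. - c l" and c' = c and l = l] z by (simp add: eq_neg_iff_add_eq_0)
qed

lemma bd_cong:
  assumes "\<And>l'. length l' = length l \<Longrightarrow> trues l' = Suc (trues l) \<Longrightarrow> c l' = c' l'"
  shows "bd F c l = bd F c' l"
  using assms
proof (induction l arbitrary: F c c')
  case (Cons b l)
  show ?case
  proof (cases b)
    case True
    have "bd F (\<lambda>l. c (True # l)) l = bd F (\<lambda>l. c' (True # l)) l"
      by (rule Cons.IH) (use Cons.prems True in auto)
    then show ?thesis using True by simp
  next
    case False
    have "bd (shift_front F) (\<lambda>l. c (False # l)) l = bd (shift_front F) (\<lambda>l. c' (False # l)) l"
      by (rule Cons.IH) (use Cons.prems False in auto)
    moreover have "c (True # l) = c' (True # l)" by (rule Cons.prems) (use False in auto)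
    ultimately show ?thesis using False by simp
  qed
qed simp

text \<open>The family \<open>\<phi>\<close> and both actions are arbitrary because the induction
  passes to front shifts and to \<open>\<lambda>m. \<phi> (Suc m)\<close>. Working modulo
  \<open>H\<close> covers two uses: a denominator gives maps of quotients, and
  \<open>H = {0}\<close> gives strict commutation.\<close>

lemma bd_natural:
  fixes F :: "'g::ab_group_add action" and F' :: "'h::ab_group_add action"
  assumes "fi_action F A" "fi_action F' H"
    and "\<And>m x y. \<phi> m (x + y) = \<phi> m x + \<phi> m y"
    and "\<And>m n f x. f \<in> inj_maps m n \<Longrightarrow> x \<in> A m \<Longrightarrow> F' m n f (\<phi> m x) - \<phi> n (F m n f x) \<in> H n"
    and "\<And>l'. length l' = length l \<Longrightarrow> trues l' = Suc (trues l) \<Longrightarrow> c l' \<in> A (falses l')"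
  shows "bd F' (\<lambda>l. \<phi> (falses l) (c l)) l - \<phi> (falses l) (bd F c l) \<in> H (falses l)"
  using assms
proof (induction l arbitrary: F F' A H \<phi> c)
  case Nil
  interpret H: fi_action F' H by fact
  have "\<phi> 0 0 = 0" using Nil(3)[of 0 0 0] by simp
  then show ?case by (simp add: H.A_zero)
next
  case (Cons b l)
  interpret A: fi_action F A by fact
  interpret H: fi_action F' H by fact
  show ?case
  proof (cases b)
    case True
    have "\<phi> m (- x) = - \<phi> m x" for m x
      using Cons.prems(3)[of m x "- x"] Cons.prems(3)[of m 0 0] by (simp add: eq_neg_iff_add_eq_0 add.commute)
    moreover have "bd F' (\<lambda>l. \<phi> (falses l) (c (True # l))) l - \<phi> (falses l) (bd F (\<lambda>l. c (True # l)) l)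
      \<in> H (falses l)" (is "?x \<in> _")
    proof (rule Cons.IH[OF Cons.prems(1-4)])
      show "c (True # l') \<in> A (falses l')"
        if "length l' = length l" "trues l' = Suc (trues l)" for l'
        using Cons.prems(5)[of "True # l'"] that True by simp
    qed
    from H.A_minus[OF this] have "- bd F' (\<lambda>l. \<phi> (falses l) (c (True # l))) l + \<phi> (falses l) (bd F (\<lambda>l. c (True # l)) l) \<in> H (falses l)"
      by simp
    ultimately show ?thesis using True by simp
  next
    case False
    let ?k = "falses l"
    have 1: "bd (shift_front F') (\<lambda>l. \<phi> (Suc (falses l)) (c (False # l))) l
        - \<phi> (Suc ?k) (bd (shift_front F) (\<lambda>l. c (False # l)) l) \<in> shift_set H ?k"
    proof (rule Cons.IH[OF A.fi_action_front H.fi_action_front, of "\<lambda>m. \<phi> (Suc m)"])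
      fix m n f x assume "f \<in> inj_maps m n" "x \<in> shift_set A m"
      then show "shift_front F' m n f (\<phi> (Suc m) x) - \<phi> (Suc n) (shift_front F m n f x) \<in> shift_set H n"
        unfolding shift_set_def shift_front_def by (intro Cons.prems(4) inj_maps_up)
    next
      show "c (False # l') \<in> shift_set A (falses l')"
        if "length l' = length l" "trues l' = Suc (trues l)" for l'
        using Cons.prems(5)[of "False # l'"] that False by (simp add: shift_set_def)
    qed (rule Cons.prems(3))
    have "c (True # l) \<in> A ?k" using Cons.prems(5)[of "True # l"] False by simp
    then have 2: "F' ?k (Suc ?k) Suc (\<phi> ?k (c (True # l))) - \<phi> (Suc ?k) (F ?k (Suc ?k) Suc (c (True # l))) \<in> H (Suc ?k)"
      by (rule Cons.prems(4)[OF inj_maps_Suc])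
    show ?thesis using H.A_add[OF 1[unfolded shift_set_def] 2] False by (simp add: Cons.prems(3) algebra_simps)
  qed
qed

lemma (in fi_action) fi_action_zero: "fi_action F (\<lambda>_. {0})"
  by unfold_locales (simp_all add: F_add F_zero, rule F_cong, simp)

lemma bd_in:
  assumes "fi_action F A"
    and "\<And>l'. length l' = length l \<Longrightarrow> trues l' = Suc (trues l) \<Longrightarrow> c l' \<in> A (falses l')"
  shows "bd F c l \<in> A (falses l)"
  using assms
proof (induction l arbitrary: F A c)
  case Nil
  then interpret fi_action F A by simp
  show ?case by (simp add: A_zero)
next
  case (Cons b l)
  interpret A: fi_action F A by fact
  let ?k = "falses l"
  show ?case
  proof (cases b)
    case True
    have "bd F (\<lambda>l. c (True # l)) l \<in> A ?k"
    proof (rule Cons.IH[OF Cons.prems(1)])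
      show "c (True # l') \<in> A (falses l')"
        if "length l' = length l" "trues l' = Suc (trues l)" for l'
        using Cons.prems(2)[of "True # l'"] that True by simp
    qed
    then show ?thesis using True by (simp add: A.A_minus)
  next
    case False
    have "bd (shift_front F) (\<lambda>l. c (False # l)) l \<in> shift_set A ?k"
    proof (rule Cons.IH[OF A.fi_action_front])
      show "c (False # l') \<in> shift_set A (falses l')"
        if "length l' = length l" "trues l' = Suc (trues l)" for l'
        using Cons.prems(2)[of "False # l'"] that False by (simp add: shift_set_def)
    qed
    moreover have "c (True # l) \<in> A ?k" using Cons.prems(2)[of "True # l"] False by simp
    ultimately show ?thesis using False by (simp add: shift_set_def A.A_add A.F_A[OF inj_maps_Suc])
  qed
qed

context complex_map
begin

text \<open>Meant for the cube on one more point, with lists split at the first or at the last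
  entry. The coordinates \<open>p0\<close> and \<open>p1\<close> control membership and differential
  without determining a chain: its value at the empty list is lost.\<close>

lemma acyc_cone_iff:
  fixes d2 :: "'f::ab_group_add \<Rightarrow> 'f" and C2 N2 :: "int \<Rightarrow> 'f set"
    and p0 :: "'f \<Rightarrow> 'e" and p1 :: "'f \<Rightarrow> 'c"
  assumes diff: "\<And>x y. p0 (x - y) = p0 x - p0 y" "\<And>x y. p1 (x - y) = p1 x - p1 y"
    and C2: "\<And>a c. c \<in> C2 a \<longleftrightarrow> p0 c \<in> C' a \<and> p1 c \<in> C (a - 1)"
    and N2: "\<And>a c. c \<in> N2 a \<longleftrightarrow> p0 c \<in> N' a \<and> p1 c \<in> N (a - 1)"
    and d2: "\<And>c. p0 (d2 c) = d' (p0 c) + \<phi> (p1 c)" "\<And>c. p1 (d2 c) = - d (p1 c)"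
    and surj: "\<And>c0 c1. \<exists>c. p0 c = c0 \<and> p1 c = c1"
  shows "acyc d2 C2 N2 a \<longleftrightarrow> cone_acyc a"
proof -
  have *: "- d x \<in> N (a - 1 - 1) \<longleftrightarrow> d x \<in> N (a - 1 - 1)" for x using S.N_minus[of "- d x"] S.N_minus[of "d x"] by auto
  show ?thesis
  proof
    assume L: "acyc d2 C2 N2 a"
    show "cone_acyc a"
      unfolding cone_acyc_def
    proof (intro ballI impI)
      fix c0 c1 assume c: "c0 \<in> C' a" "c1 \<in> C (a - 1)" "d' c0 + \<phi> c1 \<in> N' (a - 1)" "d c1 \<in> N (a - 1 - 1)"
      obtain c' where p: "p0 c' = c0" "p1 c' = c1" using surj by blast
      have "c' \<in> C2 a" "d2 c' \<in> N2 (a - 1)" using c by (simp_all only: C2 N2 d2 p * simp_thms)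
      then obtain b where "b \<in> C2 (a + 1)" "c' - d2 b \<in> N2 a" using acycD[OF L, of c'] by blast
      then show "\<exists>b0\<in>C' (a + 1). \<exists>b1\<in>C a. c0 - (d' b0 + \<phi> b1) \<in> N' a \<and> c1 + d b1 \<in> N (a - 1)"
        using p by (intro bexI[of _ "p0 b"] bexI[of _ "p1 b"]) (auto simp: C2 N2 d2 diff)
    qed
  next
    assume R: "cone_acyc a"
    show "acyc d2 C2 N2 a"
      unfolding acyc_def
    proof (intro ballI impI)
      fix c assume c: "c \<in> C2 a" "d2 c \<in> N2 (a - 1)"
      then obtain b0 b1 where b: "b0 \<in> C' (a + 1)" "b1 \<in> C a" "p0 c - (d' b0 + \<phi> b1) \<in> N' a" "p1 c + d b1 \<in> N (a - 1)"
        using cone_acycD[OF R, of "p0 c" "p1 c"] unfolding C2 N2 d2 * by blast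
      obtain b where "p0 b = b0" "p1 b = b1" using surj by blast
      then show "\<exists>b\<in>C2 (a + 1). c - d2 b \<in> N2 a" using b by (intro bexI[of _ b]) (auto simp: C2 N2 d2 diff)
    qed
  qed
qed

end

lemma bd_plus:
  assumes "fi_action F A" shows "bd F (c + c') = bd F c + bd F c'"
proof -
  interpret fi_action F A by fact
  show ?thesis using bd_add[where F = F, OF F_add] by (auto simp: fun_eq_iff plus_fun_def)
qed

lemma bd_eq_natural:
  assumes A: "fi_action F A" and F': "fi_action F' A'"
    and "\<And>m x y. \<phi> m (x + y) = \<phi> m x + \<phi> m y"
    and nat: "\<And>m n f x. f \<in> inj_maps m n \<Longrightarrow> x \<in> A m \<Longrightarrow> F' m n f (\<phi> m x) = \<phi> n (F m n f x)"
    and "\<And>l'. length l' = length l \<Longrightarrow> trues l' = Suc (trues l) \<Longrightarrow> c l' \<in> A (falses l')"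
  shows "bd F' (\<lambda>l. \<phi> (falses l) (c l)) l = \<phi> (falses l) (bd F c l)"
  using bd_natural[OF A fi_action.fi_action_zero[OF F'], of \<phi> l c] assms(3-5) by simp

context fi_action
begin

lemma front_natural:
  assumes "f \<in> inj_maps m n" "x \<in> A m"
  shows "shift_front F m n f (F m (Suc m) Suc x) = F n (Suc n) Suc (F m n f x)"
  using F_comp[OF inj_maps_Suc inj_maps_up[OF assms(1)] assms(2)] F_comp[OF assms(1) inj_maps_Suc assms(2)]
  by (simp add: shift_front_def)

lemma back_natural:
  assumes "f \<in> inj_maps m n" "x \<in> A m"
  shows "shift_back F m n f (F m (Suc m) (\<lambda>i. i) x) = F n (Suc n) (\<lambda>i. i) (F m n f x)"
proof -
  have "F m (Suc n) (\<lambda>i. ext_last m n f i) = F m (Suc n) f" by (rule F_cong) (simp add: ext_last_def)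
  then show ?thesis
    using F_comp[OF inj_maps_id inj_maps_ext_last[OF assms(1)] assms(2)] F_comp[OF assms(1) inj_maps_id assms(2), of "Suc n"]
    by (simp add: shift_back_def)
qed

end

lemma bd_bd:
  assumes "fi_action F A"
    and "\<And>l'. length l' = length l \<Longrightarrow> trues l' = Suc (Suc (trues l)) \<Longrightarrow> c l' \<in> A (falses l')"
  shows "bd F (bd F c) l = 0"
  using assms
proof (induction l arbitrary: F A c)
  case (Cons b l)
  interpret A: fi_action F A by fact
  interpret SA: fi_action "shift_front F" "shift_set A" by (rule A.fi_action_front)
  show ?case
  proof (cases b)
    case True
    have "bd F (bd F (\<lambda>l. c (True # l))) l = 0"
    proof (rule Cons.IH[OF Cons.prems(1)])
      show "c (True # l') \<in> A (falses l')"
        if "length l' = length l" "trues l' = Suc (Suc (trues l))" for l'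
        using Cons.prems(2)[of "True # l'"] that True by simp
    qed
    then show ?thesis using True bd_uminus[where F = F, OF A.F_add] by simp
  next
    case False
    let ?\<iota> = "\<lambda>m. F m (Suc m) Suc"
    have 1: "bd (shift_front F) (bd (shift_front F) (\<lambda>l. c (False # l))) l = 0"
    proof (rule Cons.IH[OF A.fi_action_front])
      show "c (False # l') \<in> shift_set A (falses l')"
        if "length l' = length l" "trues l' = Suc (Suc (trues l))" for l'
        using Cons.prems(2)[of "False # l'"] that False by (simp add: shift_set_def)
    qed
    \<comment> \<open>The mixed terms of the square: the coface \<open>Suc\<close> is a natural map
      into the front shift, and the minus sign at \<open>True\<close> makes them cancel.\<close>
    have 2: "bd (shift_front F) (\<lambda>l. ?\<iota> (falses l) (c (True # l))) l
        = ?\<iota> (falses l) (bd F (\<lambda>l. c (True # l)) l)"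
    proof (rule bd_eq_natural[OF A.fi_action_axioms A.fi_action_front])
      show "c (True # l') \<in> A (falses l')"
        if "length l' = length l" "trues l' = Suc (trues l)" for l'
        using Cons.prems(2)[of "True # l'"] that False by simp
    qed (simp_all add: A.F_add A.front_natural)
    show ?thesis
      using False 1 2 bd_add[where F = "shift_front F", OF SA.F_add] by (simp add: A.F_minus)
  qed
qed simp

lemma count_bool_length: "trues l + falses l = length l"
  by (induction l) auto

text \<open>An FI-system stands for the FI-module \<open>m \<mapsto> A m / B m\<close> on the skeleton of FI. Passing to
  quotients only enlarges \<open>B\<close>, so inductions can run through quotients within one type.\<close>

locale fi_system = A: fi_action F A + B: fi_action F B for F A B +
  assumes B_A: "x \<in> B m \<Longrightarrow> x \<in> A m"
begin

lemma fi_system_front: "fi_system (shift_front F) (shift_set A) (shift_set B)"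
  by (intro fi_system.intro A.fi_action_front B.fi_action_front fi_system_axioms.intro) (simp add: shift_set_def B_A)

lemma fi_system_back: "fi_system (shift_back F) (shift_set A) (shift_set B)"
  by (intro fi_system.intro A.fi_action_back B.fi_action_back fi_system_axioms.intro) (simp add: shift_set_def B_A)

lemma fi_system_deriv: "fi_system (shift_back F) (shift_set A) (deriv_set F A B)"
proof -
  interpret SA: fi_action "shift_back F" "shift_set A" by (rule A.fi_action_back)
  interpret SB: fi_action "shift_back F" "shift_set B" by (rule B.fi_action_back)
  show ?thesis
  proof unfold_locales
    show "0 \<in> deriv_set F A B m" for m
      using A.A_zero[of m] B.A_zero[of "Suc m"] A.F_zero unfolding deriv_set_def by (metis (mono_tags, lifting) add_0 mem_Collect_eq)
    show "u - v \<in> deriv_set F A B m" if u: "u \<in> deriv_set F A B m" and v: "v \<in> deriv_set F A B m" for u v m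
    proof -
      obtain x y x' y' where *: "u = x + F m (Suc m) (\<lambda>i. i) y" "v = x' + F m (Suc m) (\<lambda>i. i) y'"
        "x \<in> B (Suc m)" "y \<in> A m" "x' \<in> B (Suc m)" "y' \<in> A m"
        using u v unfolding deriv_set_def by blast
      then have "u - v = (x - x') + F m (Suc m) (\<lambda>i. i) (y - y')" by (simp add: A.F_diff)
      then show ?thesis using B.A_diff[OF *(3,5)] A.A_diff[OF *(4,6)] unfolding deriv_set_def by blast
    qed
    show "shift_back F m n f u \<in> deriv_set F A B n" if f: "f \<in> inj_maps m n" and u: "u \<in> deriv_set F A B m" for f m n u
    proof -
      obtain x y where *: "u = x + F m (Suc m) (\<lambda>i. i) y" "x \<in> B (Suc m)" "y \<in> A m"
        using u by (auto simp: deriv_set_def)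
      then have "shift_back F m n f u = shift_back F m n f x + F n (Suc n) (\<lambda>i. i) (F m n f y)"
        using A.back_natural[OF f *(3)] by (simp add: SA.F_add)
      moreover have "shift_back F m n f x \<in> B (Suc n)" using SB.F_A[OF f, of x] * by (simp add: shift_set_def)
      ultimately show ?thesis using A.F_A[OF f *(3)] unfolding deriv_set_def by blast
    qed
    show "u \<in> shift_set A m" if "u \<in> deriv_set F A B m" for u m
      using that B_A A.A_add A.F_A[OF inj_maps_id] unfolding deriv_set_def shift_set_def
      by (smt (verit) le_SucI mem_Collect_eq order_refl)
    show "shift_back F m p (\<lambda>i. g (f i)) x = shift_back F n p g (shift_back F m n f x)"
      if "f \<in> inj_maps m n" "g \<in> inj_maps n p" "x \<in> deriv_set F A B m" for f m n g p x
    proof (rule SA.F_comp[OF that(1,2)])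
      show "x \<in> shift_set A m"
        using that B_A A.A_add A.F_A[OF inj_maps_id] unfolding deriv_set_def shift_set_def
        by (smt (verit) le_SucI mem_Collect_eq order_refl)
    qed
  qed (rule SA.F_add, rule SA.F_cong, blast)
qed

lemma graded_complex: "graded_complex (bd F) (cubes A n) (cubes B n)"
proof (rule graded_complex.intro)
  show "bd F (c + c') = bd F c + bd F c'" for c c' by (rule bd_plus[OF A.fi_action_axioms])
  show "bd F c \<in> cubes A n (a - 1)" if "c \<in> cubes A n a" for c a
  proof (rule cubesI)
    fix l :: "bool list" assume "length l = n" "int (trues l) = a - 1"
    then show "bd F c l \<in> A (falses l)"
      by (intro bd_in[OF A.fi_action_axioms] cubesD[OF that]) auto
  qed
  show "bd F c \<in> cubes B n (a - 1)" if "c \<in> cubes B n a" for c a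
  proof (rule cubesI)
    fix l :: "bool list" assume "length l = n" "int (trues l) = a - 1"
    then show "bd F c l \<in> B (falses l)"
      by (intro bd_in[OF B.fi_action_axioms] cubesD[OF that]) auto
  qed
  show "bd F (bd F c) \<in> cubes B n (a - 1 - 1)" if "c \<in> cubes A n a" for c a
  proof (rule cubesI)
    fix l :: "bool list" assume "length l = n" "int (trues l) = a - 1 - 1"
    then have "bd F (bd F c) l = 0"
      by (intro bd_bd[OF A.fi_action_axioms] cubesD[OF that]) auto
    then show "bd F (bd F c) l \<in> B (falses l)" by (simp add: B.A_zero)
  qed
qed (auto simp: cubes_def A.A_zero A.A_diff B.A_zero B.A_diff B_A)

end

definition lift :: "(nat \<Rightarrow> 'g \<Rightarrow> 'h) \<Rightarrow> (bool list \<Rightarrow> 'g) \<Rightarrow> bool list \<Rightarrow> 'h"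
  where "lift \<phi> c = (\<lambda>l. \<phi> (falses l) (c l))"

locale system_map = S: fi_system F A B + T: fi_system F' A' B'
  for F :: "'g::ab_group_add action" and A B and F' :: "'h::ab_group_add action" and A' B' +
  fixes \<phi> :: "nat \<Rightarrow> 'g \<Rightarrow> 'h"
  assumes \<phi>_add: "\<phi> m (x + y) = \<phi> m x + \<phi> m y"
    and \<phi>_A: "x \<in> A m \<Longrightarrow> \<phi> m x \<in> A' m" and \<phi>_B: "x \<in> B m \<Longrightarrow> \<phi> m x \<in> B' m"
    and \<phi>_nat: "f \<in> inj_maps m n \<Longrightarrow> x \<in> A m \<Longrightarrow> F' m n f (\<phi> m x) - \<phi> n (F m n f x) \<in> B' n"
begin

lemma complex_map: "complex_map (bd F) (cubes A n) (cubes B n) (bd F') (cubes A' n) (cubes B' n) (lift \<phi>)"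
proof (intro complex_map.intro S.graded_complex T.graded_complex complex_map_axioms.intro)
  show "lift \<phi> (x + y) = lift \<phi> x + lift \<phi> y" for x y by (auto simp: lift_def \<phi>_add)
  show "bd F' (lift \<phi> x) - lift \<phi> (bd F x) \<in> cubes B' n (a - 1)" if "x \<in> cubes A n a" for x a
  proof (rule cubesI)
    fix l :: "bool list" assume "length l = n" "int (trues l) = a - 1"
    then have "bd F' (\<lambda>l. \<phi> (falses l) (x l)) l - \<phi> (falses l) (bd F x l) \<in> B' (falses l)"
      by (intro bd_natural[OF S.A.fi_action_axioms T.B.fi_action_axioms] \<phi>_add \<phi>_nat cubesD[OF that]) auto
    then show "(bd F' (lift \<phi> x) - lift \<phi> (bd F x)) l \<in> B' (falses l)"
      by (simp add: lift_def)
  qed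
qed (auto simp: cubes_def lift_def \<phi>_A \<phi>_B)

end

section \<open>The cube on n + 1 points as a mapping cone of cubes on n points\<close>

context fi_system
begin

lemma front_map: "system_map F A B (shift_front F) (shift_set A) (shift_set B) (\<lambda>m. F m (Suc m) Suc)"
  by (intro system_map.intro fi_system_front fi_system_axioms system_map_axioms.intro)
    (auto simp: A.F_add shift_set_def A.front_natural B.A_zero intro: A.F_A B.F_A inj_maps_Suc)

lemma back_map: "system_map F A B (shift_back F) (shift_set A) (shift_set B) (\<lambda>m. F m (Suc m) (\<lambda>i. i))"
  by (intro system_map.intro fi_system_back fi_system_axioms system_map_axioms.intro)
    (auto simp: A.F_add shift_set_def A.back_natural B.A_zero intro: A.F_A[OF inj_maps_id] B.F_A[OF inj_maps_id])

end

context fi_system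
begin

interpretation G: graded_complex "bd F" "cubes A n" "cubes B n" for n by (rule graded_complex)

text \<open>The recursion of \<open>bd\<close> on the first entry is literally the differential of
  the cone, with components at \<open>False # l\<close> and \<open>True # l\<close>.\<close>

lemma vanish_Suc_front:
  "vanish F A B a (Suc n) \<longleftrightarrow> complex_map.cone_acyc (bd F) (cubes A n) (cubes B n)
    (bd (shift_front F)) (cubes (shift_set A) n) (cubes (shift_set B) n) (lift (\<lambda>m. F m (Suc m) Suc)) a"
proof -
  interpret complex_map "bd F" "cubes A n" "cubes B n" "bd (shift_front F)" "cubes (shift_set A) n"
    "cubes (shift_set B) n" "lift (\<lambda>m. F m (Suc m) Suc)"
    by (rule system_map.complex_map[OF front_map])
  have split: "c \<in> cubes X (Suc n) b \<longleftrightarrow>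
      (\<lambda>l. c (False # l)) \<in> cubes (shift_set X) n b \<and> (\<lambda>l. c (True # l)) \<in> cubes X n (b - 1)" for c X b
  proof (intro iffI conjI cubesI)
    assume c: "(\<lambda>l. c (False # l)) \<in> cubes (shift_set X) n b \<and> (\<lambda>l. c (True # l)) \<in> cubes X n (b - 1)"
    fix l assume l: "length l = Suc n" "int (trues l) = b"
    then obtain x l' where l': "l = x # l'" by (cases l) auto
    show "c l \<in> X (falses l)"
      using cubesD[OF conjunct1[OF c], of l'] cubesD[OF conjunct2[OF c], of l'] l l'
      by (cases x) (simp_all add: shift_set_def)
  next
    fix l assume c: "c \<in> cubes X (Suc n) b" and l: "length l = n" "int (trues l) = b"
    show "c (False # l) \<in> shift_set X (falses l)"
      using cubesD[OF c, of "False # l"] l by (simp add: shift_set_def)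
  next
    fix l assume c: "c \<in> cubes X (Suc n) b" and l: "length l = n" "int (trues l) = b - 1"
    show "c (True # l) \<in> X (falses l)"
      using cubesD[OF c, of "True # l"] l by simp
  qed
  show ?thesis
    unfolding vanish_def
  proof (rule acyc_cone_iff[where ?p0.0 = "\<lambda>c l. c (False # l)" and ?p1.0 = "\<lambda>c l. c (True # l)"])
    show "\<exists>c. (\<lambda>l. c (False # l)) = c0 \<and> (\<lambda>l. c (True # l)) = c1" for c0 c1 :: "bool list \<Rightarrow> 'a"
      by (rule exI[of _ "\<lambda>l. case l of [] \<Rightarrow> 0 | x # l \<Rightarrow> if x then c1 l else c0 l"]) simp
  qed (auto simp: split lift_def fun_eq_iff)
qed

definition sgn_count :: "bool list \<Rightarrow> 'a \<Rightarrow> 'a"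
  where "sgn_count l x = (if even (trues l) then x else - x)"

text \<open>The face in the last direction carries one sign for each preceding \<open>True\<close>.
  Absorbing this sign into the second component turns that face into the plain map of the cone and
  produces the minus sign of the cone differential.\<close>

lemma vanish_Suc_back:
  "vanish F A B a (Suc n) \<longleftrightarrow> complex_map.cone_acyc (bd F) (cubes A n) (cubes B n)
    (bd (shift_back F)) (cubes (shift_set A) n) (cubes (shift_set B) n) (lift (\<lambda>m. F m (Suc m) (\<lambda>i. i))) a"
proof -
  interpret complex_map "bd F" "cubes A n" "cubes B n" "bd (shift_back F)" "cubes (shift_set A) n"
    "cubes (shift_set B) n" "lift (\<lambda>m. F m (Suc m) (\<lambda>i. i))"
    by (rule system_map.complex_map[OF back_map])
  have sgn: "sgn_count l x \<in> X m \<longleftrightarrow> x \<in> X m" if "fi_action F X" for l x m and X :: "nat \<Rightarrow> 'a set"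
    using fi_action.A_minus[OF that, of x m] fi_action.A_minus[OF that, of "- x" m] by (auto simp: sgn_count_def)
  have split: "c \<in> cubes X (Suc n) b \<longleftrightarrow>
      (\<lambda>l. c (l @ [False])) \<in> cubes (shift_set X) n b \<and> (\<lambda>l. sgn_count l (c (l @ [True]))) \<in> cubes X n (b - 1)"
    if X: "fi_action F X" for c X b
  proof (intro iffI conjI cubesI)
    assume c: "(\<lambda>l. c (l @ [False])) \<in> cubes (shift_set X) n b \<and> (\<lambda>l. sgn_count l (c (l @ [True]))) \<in> cubes X n (b - 1)"
    fix l assume l: "length l = Suc n" "int (trues l) = b"
    then obtain x l' where l': "l = l' @ [x]" by (cases l rule: rev_cases) auto
    show "c l \<in> X (falses l)"
      using cubesD[OF conjunct1[OF c], of l'] cubesD[OF conjunct2[OF c], of l'] l l'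
      by (cases x) (simp_all add: shift_set_def sgn[OF X])
  next
    fix l assume c: "c \<in> cubes X (Suc n) b" and l: "length l = n" "int (trues l) = b"
    show "c (l @ [False]) \<in> shift_set X (falses l)"
      using cubesD[OF c, of "l @ [False]"] l by (simp add: shift_set_def)
  next
    fix l assume c: "c \<in> cubes X (Suc n) b" and l: "length l = n" "int (trues l) = b - 1"
    show "sgn_count l (c (l @ [True])) \<in> X (falses l)"
      using cubesD[OF c, of "l @ [True]"] l by (simp add: sgn[OF X])
  qed
  have sgnF: "F i j f (sgn_count l x) = sgn_count l (F i j f x)" for i j f l x
    by (simp add: sgn_count_def A.F_minus)
  have "bd F c (l @ [False]) = bd (shift_back F) (\<lambda>l. c (l @ [False])) l
      + sgn_count l (F (falses l) (Suc (falses l)) (\<lambda>i. i) (c (l @ [True])))"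
    if "fi_action F A" for F A c l
    using that
  proof (induction l arbitrary: F A c)
    case Nil
    then interpret fi_action F A .
    \<comment> \<open>At the end of the recursion the first and the last coface are both the map
      from the empty set.\<close>
    have "F 0 (Suc 0) Suc = F 0 (Suc 0) (\<lambda>i. i)" by (rule F_cong) simp
    then show ?case by (simp add: sgn_count_def)
  next
    case (Cons x l)
    then interpret fi_action F A by simp
    let ?k = "falses l"
    show ?case
    proof (cases x)
      case True
      then show ?thesis using Cons.IH[OF Cons.prems] by (simp add: sgn_count_def)
    next
      case False
      \<comment> \<open>Extending \<open>Suc\<close> by the last point sends \<open>?k\<close> to
        \<open>Suc ?k\<close>, hence is again \<open>Suc\<close>, on a set with one more
        point.\<close>
      have "shift_back F ?k (Suc ?k) Suc = F (Suc ?k) (Suc (Suc ?k)) Suc"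
        unfolding shift_back_def by (rule F_cong) (auto simp: ext_last_def)
      then show ?thesis
        using Cons.IH[OF fi_action_front] False
        by (simp add: sgn_count_def shift_front_back algebra_simps) (simp add: shift_front_def up_id)
    qed
  qed
  note d0 = this[OF A.fi_action_axioms]
  have d1: "bd F c (l @ [True]) = bd F (\<lambda>l. c (l @ [True])) l" if "fi_action F A" for F A c l
    using that
  proof (induction l arbitrary: F A c)
    case (Cons x l)
    then show ?case using fi_action.fi_action_front[OF Cons.prems] by (cases x) auto
  qed simp
  \<comment> \<open>At \<open>l\<close> the differential reads only lists with one more
    \<open>True\<close>, and their sign is opposite to that of \<open>l\<close>.\<close>
  have sgn_bd: "bd F (\<lambda>l. sgn_count l (c l)) l = - sgn_count l (bd F c l)" for c l
  proof -
    have "bd F (\<lambda>l. sgn_count l (c l)) l = bd F (\<lambda>l'. if even (trues l) then - c l' else c l') l"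
      by (rule bd_cong) (simp add: sgn_count_def)
    then show ?thesis using bd_uminus[where F = F, OF A.F_add] by (simp add: sgn_count_def)
  qed
  show ?thesis
    unfolding vanish_def
  proof (rule acyc_cone_iff[where ?p0.0 = "\<lambda>c l. c (l @ [False])" and ?p1.0 = "\<lambda>c l. sgn_count l (c (l @ [True]))"])
    show "\<exists>c. (\<lambda>l. c (l @ [False])) = c0 \<and> (\<lambda>l. sgn_count l (c (l @ [True]))) = c1" for c0 c1 :: "bool list \<Rightarrow> 'a"
      by (rule exI[of _ "\<lambda>l. if last l then sgn_count (butlast l) (c1 (butlast l)) else c0 (butlast l)"])
        (auto simp: fun_eq_iff sgn_count_def)
  next
    show "(\<lambda>l. bd F c (l @ [False])) = bd (shift_back F) (\<lambda>l. c (l @ [False]))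
      + lift (\<lambda>m. F m (Suc m) (\<lambda>i. i)) (\<lambda>l. sgn_count l (c (l @ [True])))" for c
      by (simp add: fun_eq_iff d0 lift_def sgnF)
    show "(\<lambda>l. sgn_count l (bd F c (l @ [True]))) = - bd F (\<lambda>l. sgn_count l (c (l @ [True])))" for c
      by (simp add: fun_eq_iff d1[OF A.fi_action_axioms] sgn_bd)
  qed (simp_all add: split[OF A.fi_action_axioms] split[OF B.fi_action_axioms], simp_all add: fun_eq_iff sgn_count_def)
qed

end

section \<open>Shifts, derivatives and eventual acyclicity\<close>

lemma cubes_negative: "a < 0 \<Longrightarrow> c \<in> cubes A n a"
  by (rule cubesI) auto

text \<open>In degree 0 only the list without \<open>True\<close> is constrained, so a constant
  function represents an element of \<open>V\<close> at \<open>n\<close>.\<close>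

lemma cubes_const: "x \<in> A n \<Longrightarrow> (\<lambda>_. x) \<in> cubes A n 0"
proof (rule cubesI)
  fix l :: "bool list" assume "x \<in> A n" "length l = n" "int (trues l) = 0"
  then show "x \<in> A (falses l)" using count_bool_length[of l] by simp
qed

text \<open>At a list without \<open>True\<close> the differential is a sum of coface values. All
  injections \<open>f\<close> are allowed in the hypothesis because the recursion replaces a coface
  by its image under \<open>up\<close>.\<close>

lemma bd_in_range:
  assumes "0 \<in> H" "\<And>x y. x \<in> H \<Longrightarrow> y \<in> H \<Longrightarrow> x + y \<in> H" "trues l = 0"
    and "\<And>l' f. length l' = length l \<Longrightarrow> trues l' = 1 \<Longrightarrow> f \<in> inj_maps (falses l') (Suc (falses l'))
      \<Longrightarrow> F (falses l') (Suc (falses l')) f (c l') \<in> H"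
  shows "bd F c l \<in> H"
  using assms(3,4)
proof (induction l arbitrary: F c)
  case Nil
  show ?case by (simp add: assms(1))
next
  case (Cons b l)
  then have b: "b = False" by (cases b) auto
  have "bd (shift_front F) (\<lambda>l. c (False # l)) l \<in> H"
  proof (rule Cons.IH)
    show "trues l = 0" using Cons.prems b by simp
    show "shift_front F (falses l') (Suc (falses l')) f (c (False # l')) \<in> H"
      if "length l' = length l" "trues l' = 1" "f \<in> inj_maps (falses l') (Suc (falses l'))" for l' f
      using Cons.prems(2)[of "False # l'" "up f"] that inj_maps_up[OF that(3)] by (simp add: shift_front_def)
  qed
  moreover have "F (falses l) (Suc (falses l)) Suc (c (True # l)) \<in> H"
    using Cons.prems(2)[of "True # l" Suc] Cons.prems(1) b by (simp add: inj_maps_Suc)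
  ultimately show ?case using b by (simp add: assms(2))
qed

context fi_system
begin

interpretation G: graded_complex "bd F" "cubes A n" "cubes B n" for n by (rule graded_complex)

interpretation front: complex_map "bd F" "cubes A n" "cubes B n" "bd (shift_front F)" "cubes (shift_set A) n"
    "cubes (shift_set B) n" "lift (\<lambda>m. F m (Suc m) Suc)" for n
    by (rule system_map.complex_map[OF front_map])

interpretation rear: complex_map "bd F" "cubes A n" "cubes B n" "bd (shift_back F)" "cubes (shift_set A) n"
    "cubes (shift_set B) n" "lift (\<lambda>m. F m (Suc m) (\<lambda>i. i))" for n
    by (rule system_map.complex_map[OF back_map])

lemma vanish_SucI:
  "vanish (shift_front F) (shift_set A) (shift_set B) a n \<Longrightarrow> vanish F A B (a - 1) n \<Longrightarrow> vanish F A B a (Suc n)"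
  unfolding vanish_Suc_front by (rule front.cone_acycI1) (simp_all add: vanish_def)

lemma vanish_shift:
  "vanish F A B a n \<Longrightarrow> vanish F A B a (Suc n) \<Longrightarrow> vanish (shift_front F) (shift_set A) (shift_set B) a n"
  unfolding vanish_Suc_front unfolding vanish_def by (rule front.acyc_target)

lemma cubes_deriv_set:
  "cubes (deriv_set F A B) n a =
    {x + lift (\<lambda>m. F m (Suc m) (\<lambda>i. i)) y |x y. x \<in> cubes (shift_set B) n a \<and> y \<in> cubes A n a}"
proof (intro equalityI subsetI)
  fix c assume c: "c \<in> cubes (deriv_set F A B) n a"
  have "\<exists>x y. length l = n \<and> int (trues l) = a \<longrightarrow>
      c l = x + F (falses l) (Suc (falses l)) (\<lambda>i. i) y \<and>
      x \<in> B (Suc (falses l)) \<and> y \<in> A (falses l)" for l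
    using cubesD[OF c, of l] unfolding deriv_set_def by blast
  then obtain x y where "\<And>l. length l = n \<and> int (trues l) = a \<longrightarrow>
      c l = x l + F (falses l) (Suc (falses l)) (\<lambda>i. i) (y l) \<and>
      x l \<in> B (Suc (falses l)) \<and> y l \<in> A (falses l)"
    by metis
  then have xy: "c l = x l + F (falses l) (Suc (falses l)) (\<lambda>i. i) (y l)"
      "x l \<in> B (Suc (falses l))" "y l \<in> A (falses l)"
    if "length l = n" "int (trues l) = a" for l
    using that by blast+
  let ?y = "\<lambda>l. if length l = n \<and> int (trues l) = a then y l else 0"
  let ?\<delta> = "lift (\<lambda>m. F m (Suc m) (\<lambda>i. i))"
  \<comment> \<open>The remainder \<open>c - ?\<delta> ?y\<close> takes the place of
    \<open>x\<close>, so that the equation holds at every list, also where membership in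
    \<open>cubes\<close> says nothing.\<close>
  have "c = (c - ?\<delta> ?y) + ?\<delta> ?y" by simp
  moreover have "c - ?\<delta> ?y \<in> cubes (shift_set B) n a"
    by (rule cubesI) (use xy in \<open>simp add: lift_def shift_set_def\<close>)
  moreover have "?y \<in> cubes A n a"
    by (rule cubesI) (use xy in simp)
  ultimately show "c \<in> {x + ?\<delta> y |x y. x \<in> cubes (shift_set B) n a \<and> y \<in> cubes A n a}" by blast
next
  fix c assume "c \<in> {x + lift (\<lambda>m. F m (Suc m) (\<lambda>i. i)) y |x y. x \<in> cubes (shift_set B) n a \<and> y \<in> cubes A n a}"
  then obtain x y where c: "c = x + lift (\<lambda>m. F m (Suc m) (\<lambda>i. i)) y"
    and x: "x \<in> cubes (shift_set B) n a" and y: "y \<in> cubes A n a" by blast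
  show "c \<in> cubes (deriv_set F A B) n a"
  proof (rule cubesI)
    fix l assume l: "length l = n" "int (trues l) = a"
    show "c l \<in> deriv_set F A B (falses l)"
      using cubesD[OF x l] cubesD[OF y l] unfolding c deriv_set_def lift_def shift_set_def plus_fun_def by blast
  qed
qed

lemma vanish_deriv_def:
  "vanish (shift_back F) (shift_set A) (deriv_set F A B) a n \<longleftrightarrow>
    acyc (bd (shift_back F)) (cubes (shift_set A) n) (rear.coker_N n) a"
  unfolding vanish_def ext[of "cubes (deriv_set F A B) n", OF cubes_deriv_set] ..

text \<open>The obstruction of \<open>acyc_coker_low\<close> sits in degree \<open>a - 2\<close>,
  which is negative here. Thus \<open>H_0\<close> and \<open>H_1\<close> of \<open>DV\<close> at
  \<open>n\<close> are quotients of those of \<open>V\<close> at \<open>n + 1\<close>.\<close>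

lemma vanish_deriv:
  assumes "vanish F A B a (Suc n)" "a \<le> 1"
  shows "vanish (shift_back F) (shift_set A) (deriv_set F A B) a n"
proof -
  have "cubes A n (a - 1 - 1) \<subseteq> cubes B n (a - 1 - 1)" using assms(2) by (auto intro: cubes_negative)
  then show ?thesis
    using rear.acyc_coker_low[of n a] assms(1) unfolding vanish_Suc_back vanish_deriv_def by blast
qed

text \<open>When \<open>V \<rightarrow> SV\<close> is injective, its cone has the homology of the
  cokernel \<open>DV\<close>.\<close>

lemma vanish_SucI_deriv:
  assumes "\<And>m x. x \<in> A m \<Longrightarrow> F m (Suc m) (\<lambda>i. i) x \<in> B (Suc m) \<Longrightarrow> x \<in> B m"
    and "vanish (shift_back F) (shift_set A) (deriv_set F A B) a n"
  shows "vanish F A B a (Suc n)"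
  unfolding vanish_Suc_back
proof (rule rear.cone_acycI_inj)
  show "acyc (bd (shift_back F)) (cubes (shift_set A) n) (rear.coker_N n) a"
    using assms(2) by (simp add: vanish_deriv_def)
  fix x assume x: "x \<in> cubes A n (a - 1)"
    "lift (\<lambda>m. F m (Suc m) (\<lambda>i. i)) x \<in> cubes (shift_set B) n (a - 1)"
  show "x \<in> cubes B n (a - 1)"
  proof (rule cubesI)
    fix l assume l: "length l = n" "int (trues l) = a - 1"
    show "x l \<in> B (falses l)"
      by (rule assms(1)[OF cubesD[OF x(1) l]]) (use cubesD[OF x(2) l] in \<open>simp add: lift_def shift_set_def\<close>)
  qed
qed

text \<open>A permutation of the target carries the last coface map to any other one, so all injections
  vanish on the kernel of \<open>V \<rightarrow> SV\<close>.\<close>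

lemma ker_all_cofaces:
  assumes x: "x \<in> A m" "F m (Suc m) (\<lambda>i. i) x \<in> B (Suc m)" and f: "f \<in> inj_maps m (Suc m)"
  shows "F m (Suc m) f x \<in> B (Suc m)"
proof -
  have "card (f ` {..<m}) = m" using f by (simp add: card_image inj_maps_def)
  then have "\<not> {..<Suc m} \<subseteq> f ` {..<m}"
    using card_mono[of "f ` {..<m}" "{..<Suc m}"] by auto
  then obtain j where j: "j < Suc m" "j \<notin> f ` {..<m}" by blast
  let ?\<sigma> = "\<lambda>i. if i < m then f i else j"
  have \<sigma>: "?\<sigma> \<in> inj_maps (Suc m) (Suc m)"
    by (rule inj_mapsI) (use j f in \<open>auto simp: inj_maps_inj dest: inj_mapsD(1) split: if_splits\<close>)
  have "F m (Suc m) f = F m (Suc m) (\<lambda>i. ?\<sigma> i)" by (rule A.F_cong) simp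
  then show ?thesis using A.F_comp[OF inj_maps_id \<sigma> x(1)] B.F_A[OF \<sigma> x(2)] by simp
qed

text \<open>By \<open>ker_boundary\<close> in degree 1, \<open>H_0(KV)\<close> vanishes at
  \<open>n\<close>: modulo \<open>B\<close>, \<open>x\<close> is the boundary of a chain
  \<open>z\<close> with values in the kernel. All cofaces annihilate the kernel, so this boundary is
  itself zero modulo \<open>B\<close>.\<close>

lemma ker_trivial:
  assumes "vanish (shift_back F) (shift_set A) (deriv_set F A B) 2 n" "vanish F A B 1 (Suc n)"
    and x: "x \<in> A n" "F n (Suc n) (\<lambda>i. i) x \<in> B (Suc n)"
  shows "x \<in> B n"
proof -
  let ?\<delta> = "lift (\<lambda>m. F m (Suc m) (\<lambda>i. i))" and ?l = "replicate n False"
  have l: "length ?l = n" "trues ?l = 0" "falses ?l = n" by (induction n) auto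
  have "\<exists>z\<in>cubes A n 1. ?\<delta> z \<in> cubes (shift_set B) n 1 \<and> (\<lambda>_. x) - bd F z \<in> cubes B n (1 - 1)"
  proof (rule rear.ker_boundary)
    show "rear.cone_acyc n 1" using assms(2) by (simp add: vanish_Suc_back)
    show "acyc (bd (shift_back F)) (cubes (shift_set A) n) (rear.coker_N n) (1 + 1)"
      using assms(1) by (simp add: vanish_deriv_def)
    show "(\<lambda>_. x) \<in> cubes A n (1 - 1)" using cubes_const[where A = A, OF x(1)] by simp
    show "bd F (\<lambda>_. x) \<in> cubes B n (1 - 1 - 1)" by (rule cubes_negative) simp
    show "?\<delta> (\<lambda>_. x) \<in> cubes (shift_set B) n (1 - 1)"
    proof (rule cubesI)
      fix l :: "bool list" assume "length l = n" "int (trues l) = 1 - 1"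
      then have "falses l = n" using count_bool_length[of l] by simp
      then show "?\<delta> (\<lambda>_. x) l \<in> shift_set B (falses l)" using x(2) by (simp add: lift_def shift_set_def)
    qed
  qed
  then obtain z where z: "z \<in> cubes A n 1" "?\<delta> z \<in> cubes (shift_set B) n 1" "(\<lambda>_. x) - bd F z \<in> cubes B n 0"
    by auto
  have "bd F z ?l \<in> B n"
  proof (rule bd_in_range[OF B.A_zero B.A_add l(2)])
    fix l' f assume l': "length l' = length ?l" "trues l' = 1"
      and f: "f \<in> inj_maps (falses l') (Suc (falses l'))"
    have "Suc (falses l') = n" using count_bool_length[of l'] l' by simp
    then show "F (falses l') (Suc (falses l')) f (z l') \<in> B n"
      using ker_all_cofaces[OF cubesD[OF z(1)] _ f] cubesD[OF z(2), of l'] l' by (simp add: lift_def shift_set_def)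
  qed
  moreover have "x - bd F z ?l \<in> B n" using cubesD[OF z(3) l(1)] l by simp
  ultimately show ?thesis using B.A_add by fastforce
qed

lemma vanish_0: "a > 0 \<Longrightarrow> vanish F A B a 0"
  unfolding vanish_def acyc_def using G.C_zero by (auto simp: cubes_def)

text \<open>Nakayama's lemma for FI: \<open>H_0 = 0\<close> writes every element as a sum of images
  from smaller sets, and these vanish by induction.\<close>

lemma zero_system:
  assumes "\<And>n. vanish F A B 0 n" shows "A n \<subseteq> B n"
proof (induction n rule: less_induct)
  case (less n)
  let ?l = "replicate n False"
  have l: "length ?l = n" "trues ?l = 0" "falses ?l = n" by (induction n) auto
  show ?case
  proof
    fix x assume "x \<in> A n"
    then obtain b where b: "b \<in> cubes A n 1" "(\<lambda>_. x) - bd F b \<in> cubes B n 0"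
      using acycD[OF assms[of n, unfolded vanish_def] cubes_const[of x A n] cubes_negative] by auto
    have "b \<in> cubes B n 1"
    proof (rule cubesI)
      fix l' :: "bool list" assume l': "length l' = n" "int (trues l') = 1"
      then show "b l' \<in> B (falses l')"
        using less[of "falses l'"] count_bool_length[of l'] cubesD[OF b(1) l'] by auto
    qed
    then have "bd F b ?l \<in> B n" using cubesD[OF G.d_N[of b n 1], of ?l] l by simp
    moreover have "x - bd F b ?l \<in> B n" using cubesD[OF b(2) l(1)] l by simp
    ultimately show "x \<in> B n" using B.A_add by fastforce
  qed
qed

end

lemma vanish_zero_system: 
  assumes "fi_system F A B" "\<And>n. A n \<subseteq> B n" shows "vanish F A B a n"
proof -
  interpret fi_system F A B by fact
  interpret G: graded_complex "bd F" "cubes A n" "cubes B n" by (rule graded_complex)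
  show ?thesis
    unfolding vanish_def acyc_def using assms(2) G.C_zero[of "a + 1"]
    by (intro ballI impI bexI[of _ 0]) (auto simp: cubes_def G.d_zero)
qed

section \<open>Iterated shifts: the regularity bound and eventual acyclicity\<close>

abbreviation "shiftF i \<equiv> (shift_front ^^ i)"
abbreviation "shiftS i \<equiv> (shift_set ^^ i)"

lemma fi_system_shift: "fi_system F A B \<Longrightarrow> fi_system (shiftF i F) (shiftS i A) (shiftS i B)"
  by (induction i) (auto intro: fi_system.fi_system_front)

text \<open>Induction on \<open>N\<close>. The shifted system satisfies the hypotheses with
  \<open>c - 1\<close>, because its shift indices are smaller by one. Inside, induction on
  \<open>a\<close> uses the exactness of \<open>H_{a+1}(SV)_m \<rightarrow> H_{a+1}(V)_{m+1}
  \<rightarrow> H_a(V)_m\<close>: the bounds for the outer terms, \<open>m > c - 1 + (a + 1)\<close>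
  and \<open>m > c + a\<close>, coincide with \<open>m + 1 > c + (a + 1)\<close>.\<close>

lemma regularity_bound:
  assumes "fi_system F A B"
    and "\<And>a n. a \<ge> 1 \<Longrightarrow> vanish (shiftF N F) (shiftS N A) (shiftS N B) a n"
    and "\<And>i n. i \<le> N \<Longrightarrow> int n + int i > c + 1 \<Longrightarrow> vanish (shiftF i F) (shiftS i A) (shiftS i B) 1 n"
    and "a \<ge> 1" "int n > c + a"
  shows "vanish F A B a n"
  using assms
proof (induction N arbitrary: F A B c a n)
  case 0
  then show ?case by simp
next
  case (Suc N)
  interpret fi_system F A B by fact
  have S: "vanish (shift_front F) (shift_set A) (shift_set B) a n" if "a \<ge> 1" "int n > c - 1 + a" for a n
  proof (rule Suc.IH[OF fi_system_front _ _ that])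
    show "vanish (shiftF N (shift_front F)) (shiftS N (shift_set A)) (shiftS N (shift_set B)) a n" if "a \<ge> 1" for a n
      using Suc.prems(2)[OF that, of n] by (simp add: funpow_swap1)
    show "vanish (shiftF i (shift_front F)) (shiftS i (shift_set A)) (shiftS i (shift_set B)) 1 n"
      if "i \<le> N" "int n + int i > c - 1 + 1" for i n
      using Suc.prems(3)[of "Suc i" n] that by (simp add: funpow_swap1)
  qed
  have "vanish F A B a n" if "int n > c + a" for n
    using \<open>a \<ge> 1\<close> that
  proof (induction a arbitrary: n rule: int_ge_induct)
    case base
    then show ?case using Suc.prems(3)[of 0 n] by simp
  next
    case (step a)
    show ?case
    proof (cases n)
      case 0
      then show ?thesis using step vanish_0[of "a + 1"] by simp
    next
      case (Suc m)
      then show ?thesis using vanish_SucI[of "a + 1" m] S[of "a + 1" m] step by simp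
    qed
  qed
  then show ?case using Suc.prems(5) by simp
qed

lemma shift_simps:
  "shiftF i (shift_back F) = shift_back (shiftF i F)"
  "shiftS i (shift_set A) = shift_set (shiftS i A)"
  "shiftS i (deriv_set F A B) = deriv_set (shiftF i F) (shiftS i A) (shiftS i B)"
  by (induction i) (simp_all add: shift_front_back shift_deriv_set)

lemma shiftS_apply: "shiftS i A m = A (m + i)"
  by (induction i arbitrary: m) (simp_all add: shift_set_def)

text \<open>\<open>up\<close> fixes inclusions. Hence injectivity of
  \<open>V \<rightarrow> SV\<close> on all sets with at least \<open>i\<close> points is injectivity
  of \<open>S^i V \<rightarrow> S^{i+1} V\<close> everywhere.\<close>

lemma shiftF_incl: "shiftF i F m (Suc m) (\<lambda>i. i) = F (m + i) (Suc m + i) (\<lambda>i. i)"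
  by (induction i arbitrary: m) (simp_all add: shift_front_def up_id)

text \<open>\<open>H_a(SV)_n\<close> is controlled by \<open>H_a(V)_n\<close> and
  \<open>H_a(V)_{n+1}\<close>, so the threshold \<open>M\<close> does not grow under shifts.\<close>

lemma vanish_shift_ge:
  assumes "fi_system F A B" "\<And>n. n \<ge> M \<Longrightarrow> vanish F A B a n" "n \<ge> M"
  shows "vanish (shiftF i F) (shiftS i A) (shiftS i B) a n"
  using assms(3)
proof (induction i arbitrary: n)
  case (Suc i)
  then show ?case
    using fi_system.vanish_shift[OF fi_system_shift[OF assms(1)], of i a n] by simp
qed (use assms in simp)

text \<open>\<open>k\<close> is a threshold from which \<open>H_0\<close> vanishes, one more than a
  generation degree; so \<open>k = 0\<close> means that \<open>V\<close> is zero, and the induction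
  can start there.\<close>

lemma eventually_acyclic:
  assumes "fi_system F A B" "\<And>n. n \<ge> k \<Longrightarrow> vanish F A B 0 n" "\<And>n. n \<ge> M \<Longrightarrow> vanish F A B 1 n"
  shows "\<exists>i. \<forall>a\<ge>1. \<forall>n. vanish (shiftF i F) (shiftS i A) (shiftS i B) a n"
  using assms
proof (induction k arbitrary: F A B)
  case 0
  interpret fi_system F A B by fact
  have "vanish F A B a n" for a n by (rule vanish_zero_system[OF fi_system_axioms zero_system]) (use 0 in simp)
  then show ?case by (intro exI[of _ 0]) simp
next
  case (Suc k)
  interpret fi_system F A B by fact
  let ?F = "shift_back F" and ?A = "shift_set A" and ?B = "deriv_set F A B"
  have "\<exists>i. \<forall>a\<ge>1. \<forall>n. vanish (shiftF i ?F) (shiftS i ?A) (shiftS i ?B) a n"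
    by (rule Suc.IH[OF fi_system_deriv]) (use Suc.prems(2,3) in \<open>auto intro: vanish_deriv\<close>)
  then obtain i where i: "\<And>a n. a \<ge> 1 \<Longrightarrow> vanish (shiftF i ?F) (shiftS i ?A) (shiftS i ?B) a n" by blast
  have D1: "vanish ?F ?A ?B 1 n" if "n \<ge> M" for n using that Suc.prems(3) by (auto intro: vanish_deriv)
  \<comment> \<open>The constant is \<open>c = M + i\<close>: for \<open>j \<le> i\<close>,
    \<open>m + j > c + 1\<close> forces \<open>m \<ge> M\<close>, where \<open>H_1\<close> of the
    shifts of \<open>DV\<close> vanishes. In degree 2 this leaves \<open>n > c + 2\<close>.\<close>
  have D2: "vanish ?F ?A ?B 2 n" if "n > M + i + 2" for n
  proof (rule regularity_bound[OF fi_system_deriv i, where c = "int (M + i)"])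
    show "vanish (shiftF j ?F) (shiftS j ?A) (shiftS j ?B) 1 m" if "j \<le> i" "int m + int j > int (M + i) + 1" for j m
      by (rule vanish_shift_ge[OF fi_system_deriv D1]) (use that in auto)
  qed (use that in auto)
  have K: "x \<in> B n" if "n > M + i + 2" "x \<in> A n" "F n (Suc n) (\<lambda>i. i) x \<in> B (Suc n)" for n x
    using that by (intro ker_trivial[OF D2 Suc.prems(3) that(2,3)]) auto
  \<comment> \<open>\<open>I\<close> is the first index beyond the range where the kernel may be
    nonzero, and \<open>I \<ge> i\<close> keeps \<open>S^I DV\<close> acyclic.\<close>
  define I where "I = M + i + 3"
  have I: "M + i + 3 = (M + 3) + i" by simp
  interpret S: fi_system "shiftF I F" "shiftS I A" "shiftS I B" by (rule fi_system_shift) fact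
  have "vanish (shiftF I F) (shiftS I A) (shiftS I B) a n" if a: "a \<ge> 1" for a n
  proof (cases n)
    case 0
    then show ?thesis using S.vanish_0[of a] a by simp
  next
    case (Suc m)
    have "vanish (shiftF (M + 3) (shiftF i ?F)) (shiftS (M + 3) (shiftS i ?A)) (shiftS (M + 3) (shiftS i ?B)) a m"
      by (rule vanish_shift_ge[OF fi_system_shift[OF fi_system_deriv] i[OF a], of 0]) simp
    then have "vanish (shiftF I ?F) (shiftS I ?A) (shiftS I ?B) a m"
      unfolding I_def I funpow_add o_apply .
    then show ?thesis unfolding Suc shift_simps
    proof (rule S.vanish_SucI_deriv[rotated])
      show "x \<in> shiftS I B m" if "x \<in> shiftS I A m" "shiftF I F m (Suc m) (\<lambda>i. i) x \<in> shiftS I B (Suc m)" for m x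
        using K[of "m + I" x] that unfolding shiftS_apply shiftF_incl by (simp add: I_def)
    qed
  qed
  then show ?case by blast
qed

section \<open>FI-modules as FI-systems\<close>

lemma system_vanish_iso:
  assumes "system_map F A B F' A' B' \<phi>"
    and surj: "\<And>m y. y \<in> A' m \<Longrightarrow> \<exists>x\<in>A m. y - \<phi> m x \<in> B' m"
    and ker: "\<And>m x. x \<in> A m \<Longrightarrow> \<phi> m x \<in> B' m \<Longrightarrow> x \<in> B m"
  shows "vanish F A B a n \<longleftrightarrow> vanish F' A' B' a n"
proof -
  interpret system_map F A B F' A' B' \<phi> by fact
  interpret complex_map "bd F" "cubes A n" "cubes B n" "bd F'" "cubes A' n" "cubes B' n" "lift \<phi>"
    by (rule complex_map)
  show ?thesis
    unfolding vanish_def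
  proof (rule acyc_iso)
    fix b y assume y: "y \<in> cubes A' n b"
    have "\<forall>l. \<exists>x. length l = n \<and> int (trues l) = b \<longrightarrow>
        x \<in> A (falses l) \<and> y l - \<phi> (falses l) x \<in> B' (falses l)"
      using surj[OF cubesD[OF y]] by blast
    then obtain x where x: "\<And>l. length l = n \<and> int (trues l) = b \<longrightarrow>
        x l \<in> A (falses l) \<and> y l - \<phi> (falses l) (x l) \<in> B' (falses l)"
      by metis
    then show "\<exists>x\<in>cubes A n b. y - lift \<phi> x \<in> cubes B' n b"
      by (intro bexI[of _ x]) (auto simp: cubes_def lift_def)
  next
    fix b x assume x: "x \<in> cubes A n b" "lift \<phi> x \<in> cubes B' n b"
    show "x \<in> cubes B n b"
    proof (rule cubesI)
      fix l assume l: "length l = n" "int (trues l) = b"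
      show "x l \<in> B (falses l)"
        by (rule ker[OF cubesD[OF x(1) l]]) (use cubesD[OF x(2) l] in \<open>simp add: lift_def\<close>)
    qed
  qed
qed

lemma system_vanish_retract:
  assumes \<phi>: "system_map F A B F' A' B' \<phi>" and \<psi>: "system_map F' A' B' F A B \<psi>"
    and inv: "\<And>m x. x \<in> A' m \<Longrightarrow> x - \<phi> m (\<psi> m x) \<in> B' m" and "vanish F A B a n"
  shows "vanish F' A' B' a n"
proof -
  interpret P: complex_map "bd F" "cubes A n" "cubes B n" "bd F'" "cubes A' n" "cubes B' n" "lift \<phi>"
    by (rule system_map.complex_map[OF \<phi>])
  interpret Q: complex_map "bd F'" "cubes A' n" "cubes B' n" "bd F" "cubes A n" "cubes B n" "lift \<psi>"
    by (rule system_map.complex_map[OF \<psi>])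
  show ?thesis
    unfolding vanish_def
  proof (rule P.acyc_retract[OF assms(4)[unfolded vanish_def], of "lift \<psi>"])
    fix x assume x: "x \<in> cubes A' n a"
    show "lift \<psi> x \<in> cubes A n a" by (rule Q.\<phi>_C[OF x])
    show "x - lift \<phi> (lift \<psi> x) \<in> cubes B' n a"
    proof (rule cubesI)
      fix l assume l: "length l = n" "int (trues l) = a"
      show "(x - lift \<phi> (lift \<psi> x)) l \<in> B' (falses l)"
        using inv[OF cubesD[OF x l]] by (simp add: lift_def)
    qed
    assume "bd F' x \<in> cubes B' n (a - 1)"
    from P.S.N_add[OF Q.\<phi>_d[OF x] Q.\<phi>_N[OF this]] show "bd F (lift \<psi> x) \<in> cubes B n (a - 1)" by simp
  qed
qed

text \<open>Elements of an FI-module are represented by formal sums with values in it, so that addition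
  is total; sums with value zero form the subgroup \<open>B\<close> of the FI-system.\<close>

type_synonym 'a frag = "'a \<Rightarrow>\<^sub>0 int"

definition frag_map :: "('a \<Rightarrow> 'b) \<Rightarrow> 'a frag \<Rightarrow> 'b frag"
  where "frag_map f = frag_extend (\<lambda>x. frag_of (f x))"

lemma frag_map_simps [simp]:
  "frag_map f (x + y) = frag_map f x + frag_map f y" "frag_map f (x - y) = frag_map f x - frag_map f y"
  "frag_map f 0 = 0" "frag_map f (frag_of a) = frag_of (f a)"
  by (simp_all add: frag_map_def frag_extend_add frag_extend_diff)

lemma keys_frag_map: "Poly_Mapping.keys (frag_map f c) \<subseteq> f ` Poly_Mapping.keys c"
  unfolding frag_map_def using keys_frag_extend[of "\<lambda>x. frag_of (f x)" c] by auto

lemma frag_map_comp: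
  assumes "Poly_Mapping.keys c \<subseteq> S" "\<And>x. x \<in> S \<Longrightarrow> h x = g (f x)"
  shows "frag_map h c = frag_map g (frag_map f c)"
  by (rule free_Abelian_group_induct[OF assms(1)]) (auto simp: assms(2))

text \<open>Chosen through the universal property of the free abelian group, which determines it
  only on formal sums with all keys in the carrier.\<close>

definition free_eval :: "('k, 'a) module \<Rightarrow> 'a frag \<Rightarrow> 'a"
  where "free_eval M = (SOME h. h \<in> hom (free_Abelian_group (carrier M)) (add_monoid M) \<and>
    (\<forall>x\<in>carrier M. h (frag_of x) = x))"

abbreviation frags :: "'a set \<Rightarrow> 'a frag set"
  where "frags S \<equiv> {c. Poly_Mapping.keys c \<subseteq> S}"

lemma free_eval_aux:
  assumes "Module.module R M'"
  shows "free_eval M' \<in> hom (free_Abelian_group (carrier M')) (add_monoid M')"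
    "x \<in> carrier M' \<Longrightarrow> free_eval M' (frag_of x) = x"
proof -
  interpret M': Module.module R M' by fact
  obtain h where "h \<in> hom (free_Abelian_group (carrier M')) (add_monoid M')"
      "\<And>x. x \<in> carrier M' \<Longrightarrow> h (frag_of x) = x"
    using comm_group.free_Abelian_group_universal[OF M'.a_comm_group, of "\<lambda>x. x" "carrier M'"] by auto
  then have "\<exists>h. h \<in> hom (free_Abelian_group (carrier M')) (add_monoid M') \<and> (\<forall>x\<in>carrier M'. h (frag_of x) = x)"
    by blast
  from someI_ex[OF this, folded free_eval_def]
  show "free_eval M' \<in> hom (free_Abelian_group (carrier M')) (add_monoid M')"
    "x \<in> carrier M' \<Longrightarrow> free_eval M' (frag_of x) = x" by auto
qed

lemma free_eval:
  assumes "Module.module R M"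
  shows "c \<in> frags (carrier M) \<Longrightarrow> free_eval M c \<in> carrier M"
    and "x \<in> carrier M \<Longrightarrow> free_eval M (frag_of x) = x"
    and "c \<in> frags (carrier M) \<Longrightarrow> c' \<in> frags (carrier M) \<Longrightarrow> free_eval M (c + c') = free_eval M c \<oplus>\<^bsub>M\<^esub> free_eval M c'"
    and "c \<in> frags (carrier M) \<Longrightarrow> c' \<in> frags (carrier M) \<Longrightarrow> free_eval M (c - c') = free_eval M c \<ominus>\<^bsub>M\<^esub> free_eval M c'"
    and "free_eval M 0 = \<zero>\<^bsub>M\<^esub>"
proof -
  interpret Module.module R M by fact
  note h = free_eval_aux[OF assms]
  show 1: "free_eval M c \<in> carrier M" if "c \<in> frags (carrier M)" for c
    using h(1) that by (auto simp: hom_def Pi_iff)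
  show "free_eval M (frag_of x) = x" if "x \<in> carrier M" for x using h(2)[OF that] .
  show add: "free_eval M (c + c') = free_eval M c \<oplus>\<^bsub>M\<^esub> free_eval M c'"
    if "c \<in> frags (carrier M)" "c' \<in> frags (carrier M)" for c c'
    using h(1) that by (auto simp: hom_def)
  have k: "c - c' \<in> frags (carrier M)" if "c \<in> frags (carrier M)" "c' \<in> frags (carrier M)" for c c'
    using that keys_diff[of c c'] by auto
  show "free_eval M (c - c') = free_eval M c \<ominus>\<^bsub>M\<^esub> free_eval M c'"
    if "c \<in> frags (carrier M)" "c' \<in> frags (carrier M)" for c c'
    using add[OF k[OF that] that(2)] 1[OF k[OF that]] 1[OF that(1)] 1[OF that(2)]
    by (simp add: minus_eq M.add.inv_solve_right' a_assoc r_neg)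
  show "free_eval M 0 = \<zero>\<^bsub>M\<^esub>"
    using add[of 0 0] 1[of 0] by (simp add: M.l_zero)
qed

lemma mod_homs_diff:
  assumes M: "Module.module R M" and N: "Module.module R N" and h: "h \<in> mod_homs R M N"
    and "x \<in> carrier M" "y \<in> carrier M"
  shows "h (x \<ominus>\<^bsub>M\<^esub> y) = h x \<ominus>\<^bsub>N\<^esub> h y"
proof -
  interpret M: Module.module R M by fact
  interpret N: Module.module R N by fact
  have "\<ominus>\<^bsub>M\<^esub> y = (\<ominus>\<^bsub>R\<^esub> \<one>\<^bsub>R\<^esub>) \<odot>\<^bsub>M\<^esub> y" using assms(5) by (simp add: M.smult_l_minus)
  then have "h (\<ominus>\<^bsub>M\<^esub> y) = \<ominus>\<^bsub>N\<^esub> h y"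
    using mod_homsD(3)[OF h, of "\<ominus>\<^bsub>R\<^esub> \<one>\<^bsub>R\<^esub>" y] mod_homsD(1)[OF h assms(5)] assms(5) by (simp add: N.smult_l_minus)
  then show ?thesis using mod_homsD(2)[OF h assms(4), of "\<ominus>\<^bsub>M\<^esub> y"] assms(5) by (simp add: a_minus_def)
qed

lemma free_eval_natural:
  assumes M: "Module.module R M" and N: "Module.module R N" and h: "h \<in> mod_homs R M N"
    and c: "c \<in> frags (carrier M)"
  shows "free_eval N (frag_map h c) = h (free_eval M c)" "frag_map h c \<in> frags (carrier N)"
proof -
  interpret M: Module.module R M by fact
  interpret N: Module.module R N by fact
  have sub: "frag_map h c \<in> frags (carrier N)" if "c \<in> frags (carrier M)" for c
    using keys_frag_map[of h c] mod_homsD(1)[OF h] that by auto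
  note hd = mod_homs_diff[OF M N h]
  have "Poly_Mapping.keys c \<subseteq> carrier M" using c by simp
  then show "free_eval N (frag_map h c) = h (free_eval M c)"
  proof (rule free_Abelian_group_induct)
    fix x y
    assume "Poly_Mapping.keys x \<subseteq> carrier M" "Poly_Mapping.keys y \<subseteq> carrier M"
      and "free_eval N (frag_map h x) = h (free_eval M x)" "free_eval N (frag_map h y) = h (free_eval M y)"
    then show "free_eval N (frag_map h (x - y)) = h (free_eval M (x - y))"
      using sub[of x] sub[of y] free_eval(1)[OF M, of x] free_eval(1)[OF M, of y]
      by (simp add: free_eval(4)[OF M] free_eval(4)[OF N] hd)
  qed (use mod_homs_zero[OF M N h] mod_homsD(1)[OF h] in \<open>simp_all add: free_eval[OF M] free_eval[OF N]\<close>)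
  show "frag_map h c \<in> frags (carrier N)" by (rule sub[OF c])
qed

definition fi_act :: "('k, 'a) fi_mod \<Rightarrow> 'a frag action"
  where "fi_act V m n f = frag_map (Ar V {..<m} {..<n} (restrict f {..<m}))"

text \<open>Evaluation identifies \<open>preim V N m\<close> modulo \<open>fi_zero V m\<close> with
  \<open>N {..<m}\<close>. As a numerator it encodes a subobject of \<open>V\<close>, as a
  denominator a quotient.\<close>

definition preim :: "('k, 'a) fi_mod \<Rightarrow> (nat set \<Rightarrow> 'a set) \<Rightarrow> nat \<Rightarrow> 'a frag set"
  where "preim V N m = {c \<in> frags (carrier (Ob V {..<m})). free_eval (Ob V {..<m}) c \<in> N {..<m}}"

abbreviation "fi_full V \<equiv> preim V (\<lambda>X. carrier (Ob V X))"
abbreviation "fi_zero V \<equiv> preim V (\<lambda>X. {\<zero>\<^bsub>Ob V X\<^esub>})"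

text \<open>Stability under scalars is not part of the notion, since the cube complex sees only the
  additive structure.\<close>

definition fi_subgroups :: "('k, 'a) fi_mod \<Rightarrow> (nat set \<Rightarrow> 'a set) \<Rightarrow> bool"
  where "fi_subgroups V N \<longleftrightarrow> (\<forall>X. finite X \<longrightarrow> N X \<subseteq> carrier (Ob V X) \<and> \<zero>\<^bsub>Ob V X\<^esub> \<in> N X \<and>
    (\<forall>x\<in>N X. \<forall>y\<in>N X. x \<ominus>\<^bsub>Ob V X\<^esub> y \<in> N X) \<and>
    (\<forall>Y f. finite Y \<longrightarrow> f \<in> FI_hom X Y \<longrightarrow> Ar V X Y f ` N X \<subseteq> N Y))"

lemma fi_subgroupsD:
  assumes "fi_subgroups V N" "finite X"
  shows "x \<in> N X \<Longrightarrow> x \<in> carrier (Ob V X)" "\<zero>\<^bsub>Ob V X\<^esub> \<in> N X"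
    "x \<in> N X \<Longrightarrow> y \<in> N X \<Longrightarrow> x \<ominus>\<^bsub>Ob V X\<^esub> y \<in> N X"
    "finite Y \<Longrightarrow> f \<in> FI_hom X Y \<Longrightarrow> x \<in> N X \<Longrightarrow> Ar V X Y f x \<in> N Y"
proof -
  have *: "N X \<subseteq> carrier (Ob V X)" "\<zero>\<^bsub>Ob V X\<^esub> \<in> N X" "\<forall>x\<in>N X. \<forall>y\<in>N X. x \<ominus>\<^bsub>Ob V X\<^esub> y \<in> N X"
    "\<forall>Y f. finite Y \<longrightarrow> f \<in> FI_hom X Y \<longrightarrow> Ar V X Y f ` N X \<subseteq> N Y"
    using assms by (simp_all add: fi_subgroups_def)
  show "x \<in> N X \<Longrightarrow> x \<in> carrier (Ob V X)" "\<zero>\<^bsub>Ob V X\<^esub> \<in> N X"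
    "x \<in> N X \<Longrightarrow> y \<in> N X \<Longrightarrow> x \<ominus>\<^bsub>Ob V X\<^esub> y \<in> N X"
    using *(1-3) by auto
  show "Ar V X Y f x \<in> N Y" if "finite Y" "f \<in> FI_hom X Y" "x \<in> N X"
    using *(4)[rule_format, OF that(1,2)] that(3) by blast
qed

lemma inj_maps_FI_hom: "f \<in> inj_maps m n \<Longrightarrow> restrict f {..<m} \<in> FI_hom {..<m} {..<n}"
  by (auto simp: inj_maps_def FI_hom_def inj_on_def)

context fi_module
begin

lemma subgroups_full: "fi_subgroups V (\<lambda>X. carrier (Ob V X))"
  unfolding fi_subgroups_def
proof (intro allI impI conjI ballI)
  fix X :: "nat set" assume X: "finite X"
  interpret Module.module R "Ob V X" by (rule Ob_module[OF X])
  show "\<zero>\<^bsub>Ob V X\<^esub> \<in> carrier (Ob V X)" by simp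
  show "x \<ominus>\<^bsub>Ob V X\<^esub> y \<in> carrier (Ob V X)" if "x \<in> carrier (Ob V X)" "y \<in> carrier (Ob V X)" for x y
    using that by simp
  show "Ar V X Y f ` carrier (Ob V X) \<subseteq> carrier (Ob V Y)" if "finite Y" "f \<in> FI_hom X Y" for Y f
    using mod_homsD(1)[OF Ar_hom[OF X that]] by blast
qed simp

lemma subgroups_zero: "fi_subgroups V (\<lambda>X. {\<zero>\<^bsub>Ob V X\<^esub>})"
  unfolding fi_subgroups_def
proof (intro allI impI conjI ballI)
  fix X :: "nat set" assume X: "finite X"
  interpret Module.module R "Ob V X" by (rule Ob_module[OF X])
  show "x \<ominus>\<^bsub>Ob V X\<^esub> y \<in> {\<zero>\<^bsub>Ob V X\<^esub>}" if "x \<in> {\<zero>\<^bsub>Ob V X\<^esub>}" "y \<in> {\<zero>\<^bsub>Ob V X\<^esub>}" for x y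
    using that by (simp add: M.minus_eq M.r_neg)
  show "Ar V X Y f ` {\<zero>\<^bsub>Ob V X\<^esub>} \<subseteq> {\<zero>\<^bsub>Ob V Y\<^esub>}" if "finite Y" "f \<in> FI_hom X Y" for Y f
    using mod_homs_zero[OF Ob_module[OF X] Ob_module[OF that(1)] Ar_hom[OF X that]] by simp
  show "{\<zero>\<^bsub>Ob V X\<^esub>} \<subseteq> carrier (Ob V X)" by simp
qed simp

lemma fi_action_preim:
  assumes N: "fi_subgroups V N"
  shows "fi_action (fi_act V) (preim V N)"
proof unfold_locales
  note ev = free_eval[OF Ob_module[OF finite_lessThan]]
  fix m n p :: nat and f g :: "nat \<Rightarrow> nat" and x y
  show "fi_act V m n f (x + y) = fi_act V m n f x + fi_act V m n f y" by (simp add: fi_act_def)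
  show "0 \<in> preim V N m" using fi_subgroupsD(2)[OF N] by (simp add: preim_def ev)
  show "x - y \<in> preim V N m" if "x \<in> preim V N m" "y \<in> preim V N m"
    using that keys_diff[of x y] fi_subgroupsD(3)[OF N] by (auto simp: preim_def ev)
  show "fi_act V m n f x \<in> preim V N n" if f: "f \<in> inj_maps m n" and x: "x \<in> preim V N m"
  proof -
    note hom = inj_maps_FI_hom[OF f]
    note free_eval_natural[OF Ob_module[OF finite_lessThan] Ob_module[OF finite_lessThan] Ar_hom[OF _ _ hom]]
    then show ?thesis
      using x fi_subgroupsD(4)[OF N _ _ hom] by (simp add: preim_def fi_act_def)
  qed
  show "fi_act V m p (\<lambda>i. g (f i)) x = fi_act V n p g (fi_act V m n f x)"
    if f: "f \<in> inj_maps m n" and g: "g \<in> inj_maps n p" and x: "x \<in> preim V N m"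
    unfolding fi_act_def
  proof (rule frag_map_comp)
    show "Poly_Mapping.keys x \<subseteq> carrier (Ob V {..<m})" using x by (simp add: preim_def)
    fix v assume v: "v \<in> carrier (Ob V {..<m})"
    have "compose {..<m} (restrict g {..<n}) (restrict f {..<m}) = restrict (\<lambda>i. g (f i)) {..<m}"
      using inj_mapsD(1)[OF f] by (auto simp: compose_def restrict_def fun_eq_iff)
    then show "Ar V {..<m} {..<p} (restrict (\<lambda>i. g (f i)) {..<m}) v =
        Ar V {..<n} {..<p} (restrict g {..<n}) (Ar V {..<m} {..<n} (restrict f {..<m}) v)"
      using Ar_comp[OF _ _ _ inj_maps_FI_hom[OF f] inj_maps_FI_hom[OF g] v] by simp
  qed
  show "fi_act V m n f = fi_act V m n g" if "\<And>i. i < m \<Longrightarrow> f i = g i"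
  proof -
    have "restrict f {..<m} = restrict g {..<m}" using that by (auto simp: restrict_def)
    then show ?thesis by (simp only: fi_act_def)
  qed
qed

lemma fi_system_preim:
  assumes "fi_subgroups V N" "fi_subgroups V N'" "\<And>X x. finite X \<Longrightarrow> x \<in> N' X \<Longrightarrow> x \<in> N X"
  shows "fi_system (fi_act V) (preim V N) (preim V N')"
  by (intro fi_system.intro fi_action_preim assms(1,2) fi_system_axioms.intro)
    (use assms(3) in \<open>auto simp: preim_def\<close>)

end

lemma system_map_fi_hom:
  assumes V: "fi_module R V" and W: "fi_module R W" and \<phi>: "fi_hom R V W \<phi>"
    and N: "fi_subgroups V N" "fi_subgroups V N'" "\<And>X x. finite X \<Longrightarrow> x \<in> N' X \<Longrightarrow> x \<in> N X"
    and L: "fi_subgroups W L" "fi_subgroups W L'" "\<And>X x. finite X \<Longrightarrow> x \<in> L' X \<Longrightarrow> x \<in> L X"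
    and maps: "\<And>X x. finite X \<Longrightarrow> x \<in> N X \<Longrightarrow> \<phi> X x \<in> L X" "\<And>X x. finite X \<Longrightarrow> x \<in> N' X \<Longrightarrow> \<phi> X x \<in> L' X"
  shows "system_map (fi_act V) (preim V N) (preim V N') (fi_act W) (preim W L) (preim W L') (\<lambda>m. frag_map (\<phi> {..<m}))"
proof -
  interpret V: fi_module R V by fact
  interpret W: fi_module R W by fact
  have h: "\<phi> {..<m} \<in> mod_homs R (Ob V {..<m}) (Ob W {..<m})" for m using \<phi> by (auto simp: fi_hom_def)
  note nat = free_eval_natural[OF V.Ob_module W.Ob_module h, OF finite_lessThan finite_lessThan]
  show ?thesis
  proof (intro system_map.intro V.fi_system_preim N W.fi_system_preim L system_map_axioms.intro)
    show "fi_act W m n f (frag_map (\<phi> {..<m}) x) - frag_map (\<phi> {..<n}) (fi_act V m n f x) \<in> preim W L' n"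
      if f: "f \<in> inj_maps m n" and x: "x \<in> preim V N m" for m n f x
    proof -
      have "fi_act W m n f (frag_map (\<phi> {..<m}) x) = frag_map (\<lambda>v. Ar W {..<m} {..<n} (restrict f {..<m}) (\<phi> {..<m} v)) x"
        unfolding fi_act_def by (rule frag_map_comp[symmetric, of _ UNIV]) auto
      also have "\<dots> = frag_map (\<phi> {..<n}) (fi_act V m n f x)"
        unfolding fi_act_def
        by (rule frag_map_comp[of _ "carrier (Ob V {..<m})"])
          (use x \<phi> inj_maps_FI_hom[OF f] in \<open>auto simp: preim_def fi_hom_def\<close>)
      finally show ?thesis using fi_subgroupsD(2)[OF L(2)] W.Ob_module by (simp add: preim_def free_eval(5)[OF W.Ob_module])
    qed
  qed (use nat maps in \<open>auto simp: preim_def\<close>)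
qed

lemma preim_diff_zero:
  assumes "fi_module R V" "x \<in> fi_full V m" "y \<in> fi_full V m"
  shows "x - y \<in> fi_zero V m \<longleftrightarrow> free_eval (Ob V {..<m}) x = free_eval (Ob V {..<m}) y"
proof -
  interpret fi_module R V by fact
  interpret M: Module.module R "Ob V {..<m}" by (rule Ob_module) simp
  show ?thesis
    using assms(2,3) keys_diff[of x y] free_eval[OF M.module_axioms]
    by (auto simp: preim_def M.minus_eq M.r_neg M.add.inv_solve_right')
qed

section \<open>Vanishing for free and projective FI-modules\<close>

lemma shiftF_apply: "shiftF j F m n f = F (m + j) (n + j) ((up ^^ j) f)"
  by (induction j arbitrary: m n f) (simp_all add: shift_front_def funpow_swap1[of up])

lemma up_funpow: "(up ^^ j) f i = (if i < j then i else f (i - j) + j)"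
  by (induction j arbitrary: i) (auto simp: up_def split: nat.split)

text \<open>Here \<open>G j\<close> is meant to be a subsystem of \<open>S^j V\<close> with \<open>S (G j) = G (j + 1) \<oplus> G j\<close>; for a free
  \<open>V\<close> it is spanned by the injections that hit the first \<open>j\<close> points.\<close>

lemma split_vanish:
  assumes sys: "\<And>j. fi_system (shiftF j F) (G j) (shiftS j B)"
    and sub: "\<And>j m x. x \<in> G (Suc j) m \<Longrightarrow> x \<in> G j (Suc m)"
    and sum: "\<And>j m x. x \<in> G j (Suc m) \<Longrightarrow>
      \<exists>q\<in>G (Suc j) m. \<exists>p\<in>G j m. x - (q + shiftF j F m (Suc m) Suc p) \<in> shiftS j B (Suc m)"
    and direct: "\<And>j m q p. q \<in> G (Suc j) m \<Longrightarrow> p \<in> G j m \<Longrightarrow>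
      q + shiftF j F m (Suc m) Suc p \<in> shiftS j B (Suc m) \<Longrightarrow> q \<in> shiftS j B (Suc m) \<and> p \<in> shiftS j B m"
    and a: "a \<ge> 1"
  shows "vanish (shiftF j F) (G j) (shiftS j B) a n"
proof (induction n arbitrary: j)
  case 0
  show ?case using fi_system.vanish_0[OF sys] a by simp
next
  case (Suc n)
  interpret fi_system "shiftF j F" "G j" "shiftS j B" by (rule sys)
  interpret Q: fi_system "shiftF (Suc j) F" "G (Suc j)" "shiftS (Suc j) B" by (rule sys)
  let ?\<iota> = "lift (\<lambda>m. shiftF j F m (Suc m) Suc)"
  interpret complex_map "bd (shiftF j F)" "cubes (G j) n" "cubes (shiftS j B) n"
    "bd (shift_front (shiftF j F))" "cubes (shift_set (G j)) n" "cubes (shift_set (shiftS j B)) n" ?\<iota>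
    by (rule system_map.complex_map[OF front_map])
  show ?case
    unfolding vanish_Suc_front
  proof (rule cone_acycI_split[where Q = "cubes (G (Suc j)) n"])
    show "acyc (bd (shift_front (shiftF j F))) (cubes (G (Suc j)) n) (cubes (shift_set (shiftS j B)) n) a"
      using Suc[of "Suc j"] by (simp add: vanish_def)
    show "bd (shift_front (shiftF j F)) x \<in> cubes (G (Suc j)) n (a - 1)" if "x \<in> cubes (G (Suc j)) n a" for x
      using graded_complex.d_C[OF Q.graded_complex that] by simp
    show "x \<in> cubes (shift_set (G j)) n b" if "x \<in> cubes (G (Suc j)) n b" for x b
      using that by (auto simp: cubes_def shift_set_def intro: sub)
    show "\<exists>q\<in>cubes (G (Suc j)) n a. \<exists>p\<in>cubes (G j) n a. x - (q + ?\<iota> p) \<in> cubes (shift_set (shiftS j B)) n a"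
      if x: "x \<in> cubes (shift_set (G j)) n a" for x
    proof -
      have "\<exists>q p. length l = n \<and> int (trues l) = a \<longrightarrow> q \<in> G (Suc j) (falses l) \<and>
          p \<in> G j (falses l) \<and>
          x l - (q + shiftF j F (falses l) (Suc (falses l)) Suc p) \<in> shiftS j B (Suc (falses l))" for l
        using sum[OF cubesD[OF x, unfolded shift_set_def], of l] by blast
      then obtain q p where qp: "\<And>l. length l = n \<and> int (trues l) = a \<longrightarrow> q l \<in> G (Suc j) (falses l) \<and>
          p l \<in> G j (falses l) \<and>
          x l - (q l + shiftF j F (falses l) (Suc (falses l)) Suc (p l)) \<in> shiftS j B (Suc (falses l))"
        by metis
      then show ?thesis
        by (intro bexI[of _ q] bexI[of _ p] cubesI) (simp_all add: lift_def shift_set_def)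
    qed
    fix q p assume q: "q \<in> cubes (G (Suc j)) n (a - 1)" and p: "p \<in> cubes (G j) n (a - 1)"
      and s: "q + ?\<iota> p \<in> cubes (shift_set (shiftS j B)) n (a - 1)"
    have "q l \<in> shiftS j B (Suc (falses l)) \<and> p l \<in> shiftS j B (falses l)"
      if l: "length l = n" "int (trues l) = a - 1" for l
      using cubesD[OF s l] by (intro direct cubesD[OF q l] cubesD[OF p l]) (simp add: lift_def shift_set_def)
    then show "q \<in> cubes (shift_set (shiftS j B)) n (a - 1) \<and> p \<in> cubes (shiftS j B) n (a - 1)"
      by (auto simp: cubes_def shift_set_def)
  qed
qed

section \<open>Splitting the free FI-module by the points that an injection hits\<close>

definition push_fun :: "('k, 'r) ring_scheme \<Rightarrow> 'b set \<Rightarrow> ('b \<Rightarrow> 'c) \<Rightarrow> ('b \<Rightarrow> 'k) \<Rightarrow> 'c \<Rightarrow> 'k"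
  where "push_fun R B \<gamma> x = (\<lambda>c. if c \<in> \<gamma> ` B then x (inv_into B \<gamma> c) else \<zero>\<^bsub>R\<^esub>)"

lemma push_fun_hom:
  assumes R: "cring R" and \<gamma>: "inj_on \<gamma> B" "\<gamma> ` B \<subseteq> B'"
  shows "push_fun R B \<gamma> \<in> mod_homs R (free_mod R B) (free_mod R B')"
proof -
  interpret cring R by fact
  note [simp] = free_mod_coeff
  have "push_fun R B \<gamma> x \<in> carrier (free_mod R B')" if x: "x \<in> carrier (free_mod R B)" for x
  proof -
    have s: "{c. push_fun R B \<gamma> x c \<noteq> \<zero>\<^bsub>R\<^esub>} \<subseteq> \<gamma> ` {b \<in> B. x b \<noteq> \<zero>\<^bsub>R\<^esub>}"
      using \<gamma>(1) by (auto simp: push_fun_def split: if_splits)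
    have "finite {b \<in> B. x b \<noteq> \<zero>\<^bsub>R\<^esub>}" using x by (simp add: free_mod_def)
    then have "finite {c. push_fun R B \<gamma> x c \<noteq> \<zero>\<^bsub>R\<^esub>}" using s finite_surj by blast
    moreover have "{c. push_fun R B \<gamma> x c \<noteq> \<zero>\<^bsub>R\<^esub>} \<subseteq> B'" using s \<gamma>(2) by blast
    moreover have "range (push_fun R B \<gamma> x) \<subseteq> carrier R" using x by (auto simp: push_fun_def)
    ultimately show ?thesis by (simp add: free_mod_def)
  qed
  then show ?thesis
    by (auto simp: mod_homs_def) (auto simp: free_mod_def push_fun_def fun_eq_iff)
qed

lemma push_fun_apply: "inj_on \<gamma> B \<Longrightarrow> b \<in> B \<Longrightarrow> push_fun R B \<gamma> x (\<gamma> b) = x b"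
  by (simp add: push_fun_def)

lemma push_fun_basis:
  assumes "inj_on \<gamma> B" "b \<in> B"
  shows "push_fun R B \<gamma> (basis_elt R b) = basis_elt R (\<gamma> b)"
  using assms by (auto simp: push_fun_def basis_elt_def fun_eq_iff)

definition act_gen :: "(nat \<Rightarrow> nat) \<Rightarrow> nat set \<times> (nat \<Rightarrow> nat) \<times> 'a \<Rightarrow> nat set \<times> (nat \<Rightarrow> nat) \<times> 'a"
  where "act_gen g = (\<lambda>(Y, f, v). (Y, compose Y g f, v))"

lemma inj_on_act_gen:
  assumes "g \<in> FI_hom X Z" shows "inj_on (act_gen g) (fi_gens V X)"
proof (rule inj_onI)
  fix b b' assume b: "b \<in> fi_gens V X" "b' \<in> fi_gens V X" "act_gen g b = act_gen g b'"
  obtain Y f v Y' f' v' where bb: "b = (Y, f, v)" "b' = (Y', f', v')" by (metis prod_cases3)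
  have f: "f \<in> FI_hom Y X" "f' \<in> FI_hom Y' X" and eq: "Y' = Y" "v' = v" "compose Y g f = compose Y g f'"
    using b by (auto simp: bb fi_gens_def act_gen_def)
  have "f y = f' y" for y
  proof (cases "y \<in> Y")
    case True
    then have "g (f y) = g (f' y)" using eq(3) by (metis compose_eq)
    then show ?thesis using assms f True eq by (auto simp: FI_hom_def inj_on_def PiE_iff)
  next
    case False
    then show ?thesis using f eq by (auto simp: FI_hom_def PiE_def extensional_def)
  qed
  then show "b = b'" using eq by (auto simp: bb)
qed

lemma act_gen_gens: "g \<in> FI_hom X Z \<Longrightarrow> b \<in> fi_gens V X \<Longrightarrow> act_gen g b \<in> fi_gens V Z"
  by (auto simp: fi_gens_def act_gen_def FI_hom_comp)

lemma fi_free_Ar: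
  assumes R: "cring R" and g: "g \<in> FI_hom X Z" and x: "x \<in> carrier (Ob (fi_free R V) X)"
  shows "Ar (fi_free R V) X Z g x = push_fun R (fi_gens V X) (act_gen g) x"
proof (rule free_mod_hom_eq[where h = "Ar (fi_free R V) X Z g" and B = "fi_gens V X", OF module_free_mod[OF R]])
  show "Ar (fi_free R V) X Z g \<in> mod_homs R (free_mod R (fi_gens V X)) (free_mod R (fi_gens V Z))"
    using fi_free_Ar_hom[OF R g, of V] by (simp add: fi_free_def)
  show "push_fun R (fi_gens V X) (act_gen g) \<in> mod_homs R (free_mod R (fi_gens V X)) (free_mod R (fi_gens V Z))"
    by (rule push_fun_hom[OF R inj_on_act_gen[OF g]]) (auto intro: act_gen_gens[OF g])
  show "x \<in> carrier (free_mod R (fi_gens V X))" using x by (simp add: fi_free_def)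
  fix b assume b: "b \<in> fi_gens V X"
  then show "Ar (fi_free R V) X Z g (basis_elt R b) = push_fun R (fi_gens V X) (act_gen g) (basis_elt R b)"
    by (cases b) (simp add: push_fun_basis[OF inj_on_act_gen[OF g]] fi_free_Ar_basis[OF R g], simp add: act_gen_def)
qed

definition hit_gens :: "nat \<Rightarrow> ('k, 'a) fi_mod \<Rightarrow> nat set \<Rightarrow> (nat set \<times> (nat \<Rightarrow> nat) \<times> 'a) set"
  where "hit_gens j V X = {(Y, f, v) \<in> fi_gens V X. {..<j} \<subseteq> f ` Y}"

lemma free_mod_mono: "B \<subseteq> B' \<Longrightarrow> carrier (free_mod R B) \<subseteq> carrier (free_mod R B')"
  by (auto simp: free_mod_def)

lemma free_mod_ops:
  "x \<oplus>\<^bsub>free_mod R B\<^esub> y = (\<lambda>b. x b \<oplus>\<^bsub>R\<^esub> y b)" "r \<odot>\<^bsub>free_mod R B\<^esub> x = (\<lambda>b. r \<otimes>\<^bsub>R\<^esub> x b)"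
  "\<zero>\<^bsub>free_mod R B\<^esub> = (\<lambda>_. \<zero>\<^bsub>R\<^esub>)"
  by (simp_all add: free_mod_def)

lemma free_mod_minus:
  assumes R: "cring R" and x: "x \<in> carrier (free_mod R B)" "y \<in> carrier (free_mod R B)"
  shows "x \<ominus>\<^bsub>free_mod R B\<^esub> y = (\<lambda>b. x b \<ominus>\<^bsub>R\<^esub> y b)"
proof -
  interpret R: cring R by fact
  interpret M: Module.module R "free_mod R B" by (rule module_free_mod[OF R])
  have "(\<ominus>\<^bsub>free_mod R B\<^esub> y) b \<oplus>\<^bsub>R\<^esub> y b = \<zero>\<^bsub>R\<^esub>" for b
    using fun_cong[OF M.l_neg[OF x(2)], of b] by (simp add: free_mod_ops)
  then have "(\<ominus>\<^bsub>free_mod R B\<^esub> y) b = \<ominus>\<^bsub>R\<^esub> (y b)" for b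
    using free_mod_coeff[OF M.a_inv_closed[OF x(2)], of b] free_mod_coeff[OF x(2), of b]
    by (metis R.minus_equality)
  then show ?thesis by (simp add: a_minus_def free_mod_ops)
qed

lemma hit_gens_act:
  assumes f: "f \<in> inj_maps m n" and b: "b \<in> hit_gens j V {..<m + j}"
  shows "act_gen (restrict ((up ^^ j) f) {..<m + j}) b \<in> hit_gens j V {..<n + j}"
proof -
  have up: "(up ^^ j) f \<in> inj_maps (m + j) (n + j)"
    by (induction j) (use f inj_maps_up in auto)
  obtain Y h v where bb: "b = (Y, h, v)" by (cases b)
  have h: "(Y, h, v) \<in> fi_gens V {..<m + j}" "{..<j} \<subseteq> h ` Y" using b by (auto simp: bb hit_gens_def)
  have "i \<in> compose Y (restrict ((up ^^ j) f) {..<m + j}) h ` Y" if i: "i < j" for i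
  proof -
    obtain y where "y \<in> Y" "h y = i" using h(2) i by blast
    then show ?thesis using i by (intro image_eqI[of _ _ y]) (auto simp: compose_def up_funpow)
  qed
  then show ?thesis
    using act_gen_gens[OF inj_maps_FI_hom[OF up] h(1)] by (auto simp: bb hit_gens_def act_gen_def)
qed

lemma push_hit:
  assumes R: "cring R" and f: "f \<in> inj_maps m n"
    and x: "x \<in> carrier (free_mod R (hit_gens j V {..<m + j}))"
  shows "push_fun R (fi_gens V {..<m + j}) (act_gen (restrict ((up ^^ j) f) {..<m + j})) x
    \<in> carrier (free_mod R (hit_gens j V {..<n + j}))" (is "?y \<in> _")
proof -
  have up: "(up ^^ j) f \<in> inj_maps (m + j) (n + j)"
    by (induction j) (use f inj_maps_up in auto)
  note g = inj_maps_FI_hom[OF up]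
  have x': "x \<in> carrier (free_mod R (fi_gens V {..<m + j}))"
    using x free_mod_mono[of "hit_gens j V {..<m + j}" "fi_gens V {..<m + j}"] by (auto simp: hit_gens_def)
  have y: "?y \<in> carrier (free_mod R (fi_gens V {..<n + j}))"
    by (rule mod_homsD(1)[OF push_fun_hom[OF R inj_on_act_gen[OF g]] x']) (auto intro: act_gen_gens[OF g])
  have "b \<in> hit_gens j V {..<n + j}" if nz: "?y b \<noteq> \<zero>\<^bsub>R\<^esub>" for b
  proof -
    have "b \<in> act_gen (restrict ((up ^^ j) f) {..<m + j}) ` fi_gens V {..<m + j}"
      using nz by (auto simp: push_fun_def split: if_splits)
    then obtain c where c: "c \<in> fi_gens V {..<m + j}" "b = act_gen (restrict ((up ^^ j) f) {..<m + j}) c" by blast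
    moreover have "x c \<noteq> \<zero>\<^bsub>R\<^esub>" using nz push_fun_apply[OF inj_on_act_gen[OF g] c(1), of R x] c(2) by simp
    ultimately show ?thesis using x hit_gens_act[OF f, of c] by (auto simp: free_mod_def)
  qed
  with y show ?thesis by (auto simp: free_mod_def)
qed

text \<open>An injection that misses \<open>j\<close> factors through the coface
  \<open>(up ^^ j) Suc\<close>, which skips \<open>j\<close>. This coface fixes all points below
  \<open>j\<close>, so the first \<open>j\<close> points are still hit by the other factor.\<close>

lemma hit_gens_Suc:
  assumes "b \<in> hit_gens j V {..<Suc m + j}"
  shows "b \<in> hit_gens (Suc j) V {..<Suc m + j} \<or>
    (\<exists>c\<in>hit_gens j V {..<m + j}. b = act_gen (restrict ((up ^^ j) Suc) {..<m + j}) c)"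
proof -
  obtain Y h v where b: "b = (Y, h, v)" by (cases b)
  have h: "h \<in> FI_hom Y {..<Suc m + j}" "finite Y" "v \<in> carrier (Ob V Y)" "{..<j} \<subseteq> h ` Y"
    using assms by (auto simp: b hit_gens_def fi_gens_def)
  have hE: "h y < Suc m + j" if "y \<in> Y" for y using h(1) that by (auto simp: FI_hom_def)
  show ?thesis
  proof (cases "j \<in> h ` Y")
    case True
    then have "{..<Suc j} \<subseteq> h ` Y" using h(4) by (auto simp: less_Suc_eq)
    then show ?thesis using h by (auto simp: b hit_gens_def fi_gens_def)
  next
    case False
    let ?f = "\<lambda>y\<in>Y. if h y < j then h y else h y - 1"
    have f: "?f \<in> FI_hom Y {..<m + j}"
    proof -
      have "?f y < m + j" if "y \<in> Y" for y
      proof -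
        have "h y \<noteq> j" using that False by auto
        then show ?thesis using hE[OF that] that by auto
      qed
      moreover have "inj_on ?f Y"
      proof (rule inj_onI)
        fix y z assume yz: "y \<in> Y" "z \<in> Y" "?f y = ?f z"
        have "h y \<noteq> j" "h z \<noteq> j" using yz False by auto
        then have "h y = h z" using yz by (auto split: if_splits)
        then show "y = z" using h(1) yz by (auto simp: FI_hom_def inj_on_def)
      qed
      ultimately show ?thesis by (auto simp: FI_hom_def)
    qed
    have "(up ^^ j) Suc (?f y) = h y" if "y \<in> Y" for y
    proof -
      have "h y \<noteq> j" using that False by auto
      then show ?thesis using that by (auto simp: up_funpow)
    qed
    then have "compose Y (restrict ((up ^^ j) Suc) {..<m + j}) ?f = h"
      using f h(1) by (auto simp: compose_def FI_hom_def PiE_def extensional_def fun_eq_iff Pi_iff)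
    moreover have "i \<in> ?f ` Y" if i: "i < j" for i
    proof -
      obtain y where "y \<in> Y" "h y = i" using h(4) i by blast
      then show ?thesis using i by (intro image_eqI[of _ _ y]) auto
    qed
    ultimately show ?thesis
      using f h by (intro disjI2 bexI[of _ "(Y, ?f, v)"]) (auto simp: b act_gen_def hit_gens_def fi_gens_def)
  qed
qed

lemma act_gen_not_hit:
  "act_gen (restrict ((up ^^ j) Suc) {..<m + j}) c \<notin> hit_gens (Suc j) V X" if "c \<in> fi_gens V {..<m + j}"
proof
  assume a: "act_gen (restrict ((up ^^ j) Suc) {..<m + j}) c \<in> hit_gens (Suc j) V X"
  obtain Y f v where c: "c = (Y, f, v)" by (cases c)
  have f: "f \<in> FI_hom Y {..<m + j}" using that by (auto simp: c fi_gens_def)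
  have "j \<in> compose Y (restrict ((up ^^ j) Suc) {..<m + j}) f ` Y"
    using a by (auto simp: c act_gen_def hit_gens_def)
  then obtain y where "y \<in> Y" "j = (up ^^ j) Suc (f y)" using f by (auto simp: compose_def FI_hom_def Pi_iff)
  then show False by (simp add: up_funpow split: if_splits)
qed

text \<open>The hypotheses of \<open>split_vanish\<close> hold because a generator either hits
  \<open>j\<close> or comes, uniquely, from the coface that skips \<open>j\<close>: coefficients of
  the first kind form \<open>q\<close>, those of the second kind are pulled back to form
  \<open>p\<close>.\<close>

lemma fi_free_vanish:
  assumes R: "cring R" and a: "a \<ge> 1"
  shows "vanish (fi_act (fi_free R V)) (fi_full (fi_free R V)) (fi_zero (fi_free R V)) a n"
proof -
  define Q where "Q = fi_free R V"
  define F where "F = fi_act Q"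
  define H where "H = (\<lambda>j X. carrier (free_mod R (hit_gens j V X)))"
  \<comment> \<open>After \<open>j\<close> front shifts \<open>{..<m}\<close> has become
    \<open>{..<m + j}\<close>, and the first \<open>j\<close> points are the new ones.\<close>
  define G where "G = (\<lambda>j m. preim Q (H j) (m + j))"
  interpret R: cring R by fact
  interpret Q: fi_module R Q unfolding Q_def by (rule fi_module_fi_free[OF R])
  have Ob: "Ob Q X = free_mod R (fi_gens V X)" for X by (simp add: Q_def fi_free_def)
  have H_sub: "H j X \<subseteq> carrier (Ob Q X)" for j X
    unfolding H_def Ob by (rule free_mod_mono) (auto simp: hit_gens_def)
  have H_minus: "x \<ominus>\<^bsub>Ob Q X\<^esub> y \<in> H j X" if "x \<in> H j X" "y \<in> H j X" for x y j X
  proof -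
    interpret M: Module.module R "free_mod R (hit_gens j V X)" by (rule module_free_mod[OF R])
    have "x \<ominus>\<^bsub>Ob Q X\<^esub> y = x \<ominus>\<^bsub>free_mod R (hit_gens j V X)\<^esub> y"
      using that H_sub[of j X] unfolding Ob by (subst (1 2) free_mod_minus[OF R]) (auto simp: H_def)
    then show ?thesis using M.minus_closed that by (simp add: H_def)
  qed
  have H_zero: "\<zero>\<^bsub>Ob Q X\<^esub> \<in> H j X" for j X by (simp add: Ob H_def free_mod_def)
  note ev = free_eval[OF Q.Ob_module[OF finite_lessThan]]
  have sys0: "fi_system (shiftF j F) (shiftS j (fi_full Q)) (shiftS j (fi_zero Q))" for j
    unfolding F_def
  proof (rule fi_system_shift, rule Q.fi_system_preim[OF Q.subgroups_full Q.subgroups_zero])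
    fix X :: "nat set" and x assume X: "finite X" and x: "x \<in> {\<zero>\<^bsub>Ob Q X\<^esub>}"
    show "x \<in> carrier (Ob Q X)" using fi_subgroupsD(2)[OF Q.subgroups_full X] x by simp
  qed
  have G_sub: "x \<in> fi_full Q (m + j)" if "x \<in> G j m" for x j m
    using that H_sub[of j "{..<m + j}"] by (auto simp: G_def preim_def)
  have up: "(up ^^ j) f \<in> inj_maps (m + j) (n + j)" if "f \<in> inj_maps m n" for j f m n
    by (induction j) (use that inj_maps_up in auto)
  have evF: "free_eval (Ob Q {..<n + j}) (shiftF j F m n f x)
      = push_fun R (fi_gens V {..<m + j}) (act_gen (restrict ((up ^^ j) f) {..<m + j})) (free_eval (Ob Q {..<m + j}) x)"
    if f: "f \<in> inj_maps m n" and x: "x \<in> fi_full Q (m + j)" for f m n j x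
  proof -
    note g = inj_maps_FI_hom[OF up[OF f, of j]]
    have "free_eval (Ob Q {..<m + j}) x \<in> carrier (Ob Q {..<m + j})" using x by (simp add: preim_def)
    then show ?thesis
      using free_eval_natural(1)[OF Q.Ob_module Q.Ob_module Q.Ar_hom[OF _ _ g], of x] x fi_free_Ar[OF R g, of _ V]
      by (simp add: shiftF_apply F_def fi_act_def preim_def Q_def)
  qed
  have GA: "fi_action (shiftF j F) (G j)" for j
  proof -
    interpret S: fi_system "shiftF j F" "shiftS j (fi_full Q)" "shiftS j (fi_zero Q)" by (rule sys0)
    have full: "x \<in> shiftS j (fi_full Q) m" if "x \<in> G j m" for x m using G_sub[OF that] by (simp add: shiftS_apply)
    show ?thesis
    proof unfold_locales
      show "shiftF j F m n f (x + y) = shiftF j F m n f x + shiftF j F m n f y" for m n f x y by (rule S.A.F_add)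
      show "0 \<in> G j m" for m using H_zero[of "{..<m + j}" j] by (simp add: G_def preim_def ev)
      show "x - y \<in> G j m" if "x \<in> G j m" "y \<in> G j m" for x y m
        using that H_minus keys_diff[of x y] by (auto simp: G_def preim_def ev)
      show "shiftF j F m n f x \<in> G j n" if f: "f \<in> inj_maps m n" and x: "x \<in> G j m" for f m n x
      proof -
        have "shiftF j F m n f x \<in> fi_full Q (n + j)"
          using S.A.F_A[OF f full[OF x]] by (simp add: shiftS_apply)
        moreover have "free_eval (Ob Q {..<n + j}) (shiftF j F m n f x) \<in> H j {..<n + j}"
          unfolding evF[OF f G_sub[OF x]] H_def
          by (rule push_hit[OF R f]) (use x in \<open>simp add: G_def preim_def H_def\<close>)
        ultimately show ?thesis by (simp add: G_def preim_def)
      qed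
      show "shiftF j F m p (\<lambda>i. g (f i)) x = shiftF j F n p g (shiftF j F m n f x)"
        if "f \<in> inj_maps m n" "g \<in> inj_maps n p" "x \<in> G j m" for f m n g p x
        by (rule S.A.F_comp[OF that(1,2) full[OF that(3)]])
      show "shiftF j F m n f = shiftF j F m n g" if "\<And>i. i < m \<Longrightarrow> f i = g i" for m n f g
        by (rule S.A.F_cong[OF that])
    qed
  qed
  have B_iff: "x \<in> shiftS j (fi_zero Q) m \<longleftrightarrow> x \<in> fi_full Q (m + j) \<and> free_eval (Ob Q {..<m + j}) x = \<zero>\<^bsub>Ob Q {..<m + j}\<^esub>"
    for x j m using fi_subgroupsD(2)[OF Q.subgroups_full, of "{..<m + j}"] by (auto simp: shiftS_apply preim_def)
  have Suc_inj: "Suc \<in> inj_maps m (Suc m)" for m by (rule inj_maps_Suc)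
  have in_frags: "x \<in> frags (carrier (Ob Q {..<m}))" if "x \<in> fi_full Q m" for x m using that by (simp add: preim_def)
  have full_Suc: "shiftF j F m (Suc m) Suc x \<in> fi_full Q (Suc m + j)" if "x \<in> G j m" for x j m
    using G_sub[OF fi_action.F_A[OF GA Suc_inj that]] .
  have "vanish (shiftF 0 F) (G 0) (shiftS 0 (fi_zero Q)) a n"
  proof (rule split_vanish[where F = F and G = G, OF _ _ _ _ a])
    show "fi_system (shiftF j F) (G j) (shiftS j (fi_zero Q))" for j
    proof (intro fi_system.intro GA fi_system_axioms.intro)
      show "fi_action (shiftF j F) (shiftS j (fi_zero Q))" using sys0[of j] by (rule fi_system.axioms)
      show "x \<in> G j m" if "x \<in> shiftS j (fi_zero Q) m" for x m
        using that H_zero[of "{..<m + j}" j] by (auto simp: shiftS_apply preim_def G_def)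
    qed
    show "x \<in> G j (Suc m)" if "x \<in> G (Suc j) m" for j m x
    proof -
      have "hit_gens (Suc j) V X \<subseteq> hit_gens j V X" for X by (auto simp: hit_gens_def)
      then have "H (Suc j) X \<subseteq> H j X" for X unfolding H_def by (rule free_mod_mono)
      then show ?thesis using that by (auto simp: G_def preim_def)
    qed
  next
    fix j m x assume x: "x \<in> G j (Suc m)"
    let ?\<gamma> = "act_gen (restrict ((up ^^ j) Suc) {..<m + j})"
    define e where "e = free_eval (Ob Q {..<Suc m + j}) x"
    have e: "e \<in> H j {..<Suc m + j}" using x by (simp add: e_def G_def preim_def)
    define q where "q = (\<lambda>b. if b \<in> hit_gens (Suc j) V {..<Suc m + j} then e b else \<zero>\<^bsub>R\<^esub>)"
    define p where "p = (\<lambda>c. if c \<in> hit_gens j V {..<m + j} then e (?\<gamma> c) else \<zero>\<^bsub>R\<^esub>)"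
    note inj = inj_on_act_gen[OF inj_maps_FI_hom[OF up[OF Suc_inj[of m], of j]], of V]
    have eR: "e b \<in> carrier R" for b using e by (auto simp: H_def free_mod_def)
    have e0: "e b = \<zero>\<^bsub>R\<^esub>" if "b \<notin> hit_gens j V {..<Suc m + j}" for b using that e by (auto simp: H_def free_mod_def)
    have fin: "finite {b. e b \<noteq> \<zero>\<^bsub>R\<^esub>}" using e by (auto simp: H_def free_mod_def)
    have q: "q \<in> H (Suc j) {..<Suc m + j}"
    proof -
      have "finite {b. q b \<noteq> \<zero>\<^bsub>R\<^esub>}" by (rule finite_subset[OF _ fin]) (auto simp: q_def)
      moreover have "q b \<in> carrier R" for b using eR by (simp add: q_def)
      moreover have "b \<in> hit_gens (Suc j) V {..<Suc m + j}" if "q b \<noteq> \<zero>\<^bsub>R\<^esub>" for b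
        using that by (auto simp: q_def split: if_splits)
      ultimately show ?thesis unfolding H_def free_mod_def by auto
    qed
    have hit_sub: "hit_gens i V X \<subseteq> fi_gens V X" for i X by (auto simp: hit_gens_def)
    have p: "p \<in> H j {..<m + j}"
    proof -
      have "finite (?\<gamma> ` {c. p c \<noteq> \<zero>\<^bsub>R\<^esub>})" by (rule finite_subset[OF _ fin]) (auto simp: p_def)
      moreover have "inj_on ?\<gamma> {c. p c \<noteq> \<zero>\<^bsub>R\<^esub>}"
        by (rule inj_on_subset[OF inj]) (use hit_sub in \<open>auto simp: p_def split: if_splits\<close>)
      ultimately have "finite {c. p c \<noteq> \<zero>\<^bsub>R\<^esub>}" by (rule finite_imageD)
      moreover have "p c \<in> carrier R" for c using eR by (simp add: p_def)
      moreover have "c \<in> hit_gens j V {..<m + j}" if "p c \<noteq> \<zero>\<^bsub>R\<^esub>" for c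
        using that by (auto simp: p_def split: if_splits)
      ultimately show ?thesis unfolding H_def free_mod_def by auto
    qed
    let ?P = "push_fun R (fi_gens V {..<m + j}) ?\<gamma> p"
    have eq: "e b = q b \<oplus>\<^bsub>R\<^esub> ?P b" for b
    proof (cases "b \<in> ?\<gamma> ` fi_gens V {..<m + j}")
      case True
      then obtain c where c: "c \<in> fi_gens V {..<m + j}" "b = ?\<gamma> c" by blast
      have "?P b = e b"
      proof (cases "c \<in> hit_gens j V {..<m + j}")
        case False
        have "b \<notin> hit_gens j V {..<Suc m + j}"
        proof
          assume "b \<in> hit_gens j V {..<Suc m + j}"
          from hit_gens_Suc[OF this] obtain c' where c': "c' \<in> hit_gens j V {..<m + j}" "b = ?\<gamma> c'"
            using act_gen_not_hit[OF c(1)] c(2) by blast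
          then have "c = c'" using inj_onD[OF inj _ c(1), of c'] c(2) hit_sub by auto
          then show False using c' False by blast
        qed
        then show ?thesis using e0 push_fun_apply[OF inj c(1), of R p] False c(2) by (simp add: p_def)
      qed (use c push_fun_apply[OF inj c(1), of R p] in \<open>simp add: p_def\<close>)
      moreover have "q b = \<zero>\<^bsub>R\<^esub>" using act_gen_not_hit[OF c(1)] c(2) by (simp add: q_def)
      ultimately show ?thesis using eR by simp
    next
      case False
      then have "?P b = \<zero>\<^bsub>R\<^esub>" by (simp add: push_fun_def)
      moreover have "q b = e b"
      proof (cases "b \<in> hit_gens (Suc j) V {..<Suc m + j}")
        case not_hit: False
        have "b \<notin> hit_gens j V {..<Suc m + j}"
          using hit_gens_Suc[of b j V m] not_hit False subsetD[OF hit_sub] by blast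
        then show ?thesis using e0 not_hit by (simp add: q_def)
      qed (simp add: q_def)
      ultimately show ?thesis using eR by simp
    qed
    have pG: "frag_of p \<in> G j m" using p H_sub[of j "{..<m + j}"] by (auto simp: G_def preim_def ev subset_iff)
    have qG: "frag_of q \<in> G (Suc j) m" using q H_sub[of "Suc j" "{..<Suc m + j}"] by (auto simp: G_def preim_def ev subset_iff)
    have evp: "free_eval (Ob Q {..<m + j}) (frag_of p) = p" using p H_sub[of j "{..<m + j}"] by (intro ev(2)) auto
    have evq: "free_eval (Ob Q {..<Suc m + j}) (frag_of q) = q" using q H_sub[of "Suc j" "{..<Suc m + j}"] by (intro ev(2)) auto
    have qf: "frag_of q \<in> fi_full Q (Suc m + j)" using G_sub[OF qG] by simp
    interpret S: fi_action "fi_act Q" "fi_full Q" by (rule Q.fi_action_preim[OF Q.subgroups_full])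
    have "free_eval (Ob Q {..<Suc m + j}) x = free_eval (Ob Q {..<Suc m + j}) (frag_of q + shiftF j F m (Suc m) Suc (frag_of p))"
      unfolding ev(3)[OF in_frags[OF qf] in_frags[OF full_Suc[OF pG]]] evF[OF Suc_inj G_sub[OF pG]] evp evq e_def[symmetric]
      by (simp add: Ob free_mod_ops fun_eq_iff eq)
    then have "x - (frag_of q + shiftF j F m (Suc m) Suc (frag_of p)) \<in> shiftS j (fi_zero Q) (Suc m)"
      unfolding shiftS_apply using preim_diff_zero[OF Q.fi_module_axioms G_sub[OF x] S.A_add[OF qf full_Suc[OF pG]]] by blast
    then show "\<exists>q\<in>G (Suc j) m. \<exists>p\<in>G j m. x - (q + shiftF j F m (Suc m) Suc p) \<in> shiftS j (fi_zero Q) (Suc m)"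
      using pG qG by blast
  next
    fix j m q p assume q: "q \<in> G (Suc j) m" and p: "p \<in> G j m"
      and s: "q + shiftF j F m (Suc m) Suc p \<in> shiftS j (fi_zero Q) (Suc m)"
    let ?\<gamma> = "act_gen (restrict ((up ^^ j) Suc) {..<m + j})"
    let ?q = "free_eval (Ob Q {..<Suc m + j}) q" and ?p = "free_eval (Ob Q {..<m + j}) p"
    let ?P = "push_fun R (fi_gens V {..<m + j}) ?\<gamma> ?p"
    note inj = inj_on_act_gen[OF inj_maps_FI_hom[OF up[OF Suc_inj[of m], of j]], of V]
    have qf: "q \<in> fi_full Q (Suc m + j)" using G_sub[OF q] by simp
    have sum: "?q b \<oplus>\<^bsub>R\<^esub> ?P b = \<zero>\<^bsub>R\<^esub>" for b
    proof -
      have "free_eval (Ob Q {..<Suc m + j}) (q + shiftF j F m (Suc m) Suc p) = \<zero>\<^bsub>Ob Q {..<Suc m + j}\<^esub>"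
        using s unfolding B_iff by blast
      then show ?thesis
        unfolding ev(3)[OF in_frags[OF qf] in_frags[OF full_Suc[OF p]]] evF[OF Suc_inj G_sub[OF p]]
        unfolding Ob free_mod_ops by (rule fun_cong)
    qed
    have qH: "?q \<in> H (Suc j) {..<Suc m + j}" and pH: "?p \<in> H j {..<m + j}"
      using q p by (simp_all add: G_def preim_def)
    have qR: "?q b \<in> carrier R" and pR: "?p b \<in> carrier R" for b using qH pH by (auto simp: H_def free_mod_def)
    \<comment> \<open>The supports are disjoint: \<open>?q\<close> lives on generators that hit
      \<open>j\<close>, \<open>?P\<close> on generators that miss it.\<close>
    have q0: "?q b = \<zero>\<^bsub>R\<^esub>" for b
    proof (cases "b \<in> ?\<gamma> ` fi_gens V {..<m + j}")
      case True
      then have "b \<notin> hit_gens (Suc j) V {..<Suc m + j}" using act_gen_not_hit by blast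
      then show ?thesis using qH by (auto simp: H_def free_mod_def)
    next
      case False
      then show ?thesis using sum[of b] qR[of b] by (simp add: push_fun_def)
    qed
    have p0: "?p c = \<zero>\<^bsub>R\<^esub>" for c
    proof (cases "c \<in> fi_gens V {..<m + j}")
      case True
      then show ?thesis using sum[of "?\<gamma> c"] push_fun_apply[OF inj True, of R ?p] pR[of c] q0 by simp
    next
      case False
      then have "c \<notin> hit_gens j V {..<m + j}" by (auto simp: hit_gens_def)
      then show ?thesis using pH by (auto simp: H_def free_mod_def)
    qed
    show "q \<in> shiftS j (fi_zero Q) (Suc m) \<and> p \<in> shiftS j (fi_zero Q) m"
      unfolding B_iff using qf G_sub[OF p] q0 p0 by (auto simp: Ob free_mod_ops fun_eq_iff)
  qed
  moreover have "G 0 = fi_full Q"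
  proof -
    have "H 0 X = carrier (Ob Q X)" for X
    proof -
      have "hit_gens 0 V X = fi_gens V X" by (auto simp: hit_gens_def)
      then show ?thesis by (simp add: H_def Ob)
    qed
    then show ?thesis by (auto simp: G_def fun_eq_iff preim_def)
  qed
  ultimately show ?thesis by (simp add: F_def Q_def)
qed

lemma fi_system_full_zero:
  assumes "fi_module R V" shows "fi_system (fi_act V) (fi_full V) (fi_zero V)"
proof -
  interpret fi_module R V by fact
  show ?thesis
    by (rule fi_system_preim[OF subgroups_full subgroups_zero]) (use fi_subgroupsD(2)[OF subgroups_full] in auto)
qed

lemma system_map_full_zero:
  assumes V: "fi_module R V" and W: "fi_module R W" and \<phi>: "fi_hom R V W \<phi>"
  shows "system_map (fi_act V) (fi_full V) (fi_zero V) (fi_act W) (fi_full W) (fi_zero W) (\<lambda>m. frag_map (\<phi> {..<m}))"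
proof (rule system_map_fi_hom[OF V W \<phi> fi_module.subgroups_full[OF V] fi_module.subgroups_zero[OF V] _
      fi_module.subgroups_full[OF W] fi_module.subgroups_zero[OF W]])
  fix X :: "nat set" and x assume X: "finite X"
  have h: "\<phi> X \<in> mod_homs R (Ob V X) (Ob W X)" using \<phi> X by (simp add: fi_hom_def)
  show "x \<in> carrier (Ob V X)" if "x \<in> {\<zero>\<^bsub>Ob V X\<^esub>}"
    using that fi_subgroupsD(2)[OF fi_module.subgroups_full[OF V] X] by simp
  show "\<phi> X x \<in> carrier (Ob W X)" if "x \<in> carrier (Ob V X)" using mod_homsD(1)[OF h that] .
  show "\<phi> X x \<in> {\<zero>\<^bsub>Ob W X\<^esub>}" if "x \<in> {\<zero>\<^bsub>Ob V X\<^esub>}"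
    using that mod_homs_zero[OF fi_module.Ob_module[OF V X] fi_module.Ob_module[OF W X] h] by simp
next
  fix X :: "nat set" and x assume X: "finite X" "x \<in> {\<zero>\<^bsub>Ob W X\<^esub>}"
  then show "x \<in> carrier (Ob W X)"
    using fi_subgroupsD(2)[OF fi_module.subgroups_full[OF W] X(1)] by simp
qed

section \<open>Projectives as retracts of free FI-modules\<close>

lemma frag_map_id: "frag_map (\<lambda>x. x) c = c"
  by (simp add: frag_map_def frag_expansion[symmetric])

text \<open>The lifting property is available only against FI-modules with elements in
  \<open>univ\<close>. So \<open>P\<close> is renamed by \<open>Atom\<close> and its free cover by
  \<open>univ_enc\<close>; the renaming of \<open>P\<close> is lifted along the renamed evaluation,
  and decoding the lift gives \<open>s\<close>.\<close>

lemma projective_retract_free: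
  fixes P :: "('k, 'p) fi_mod"
  assumes R: "cring R" and P: "fi_projective R P"
  shows "\<exists>s r. fi_hom R P (fi_free R P) s \<and> fi_hom R (fi_free R P) P r \<and>
    (\<forall>X. finite X \<longrightarrow> (\<forall>x\<in>carrier (Ob P X). r X (s X x) = x))"
proof -
  have mod: "fi_module R P" using P by (simp add: fi_projective_def)
  interpret P: fi_module R P by fact
  let ?S = "{c. finite {b. c b \<noteq> \<zero>\<^bsub>R\<^esub>}}" and ?F = "fi_free R P"
    and ?\<iota> = "Atom :: 'p \<Rightarrow> ('k, 'p) univ"
  let ?T = "fi_transport ?S (univ_enc R ?\<iota>) ?F" and ?inv = "inv_into ?S (univ_enc R ?\<iota>)"
    and ?B = "fi_transport UNIV ?\<iota> P"
  have \<iota>: "inj ?\<iota>" by (simp add: inj_def)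
  have "carrier (Ob ?F X) \<subseteq> ?S" for X by (auto simp: fi_free_def free_mod_def)
  note T = fi_transport[OF fi_module_fi_free[OF R] inj_on_univ_enc[OF \<iota>] this]
  note B = fi_transport[OF mod \<iota>, simplified]
  let ?ev = "fi_free_ext R P (\<lambda>Y v. v)"
  note ev = fi_free_ext[OF mod R, of P "\<lambda>Y v. v", simplified]
  have \<pi>: "fi_hom R ?T ?B (\<lambda>X x. ?\<iota> (?ev X (?inv x)))"
    by (rule fi_hom_comp[OF fi_hom_comp[OF T(3) ev(1)] B(2)])
  have epi: "fi_epi ?T ?B (\<lambda>X x. ?\<iota> (?ev X (?inv x)))"
    unfolding fi_epi_def
  proof (intro allI impI equalityI)
    fix X :: "nat set" assume X: "finite X"
    show "(\<lambda>x. ?\<iota> (?ev X (?inv x))) ` carrier (Ob ?T X) \<subseteq> carrier (Ob ?B X)"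
      using \<pi> X by (auto simp: fi_hom_def mod_homs_def)
    show "carrier (Ob ?B X) \<subseteq> (\<lambda>x. ?\<iota> (?ev X (?inv x))) ` carrier (Ob ?T X)"
    proof
      fix w assume "w \<in> carrier (Ob ?B X)"
      then obtain v where v: "v \<in> carrier (Ob P X)" "w = ?\<iota> v" by (auto simp: fi_transport_def)
      have b: "(X, (\<lambda>x\<in>X. x), v) \<in> fi_gens P X" using X v by (auto simp: fi_gens_def FI_hom_id)
      let ?c = "basis_elt R (X, (\<lambda>x\<in>X. x), v)"
      have c: "?c \<in> carrier (Ob ?F X)" using basis_elt_in[OF R b] by (simp add: fi_free_def)
      have "?ev X ?c = v" using ev(2)[OF X b] P.Ar_id[OF X v(1)] by simp
      then show "w \<in> (\<lambda>x. ?\<iota> (?ev X (?inv x))) ` carrier (Ob ?T X)"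
        using c T(4)[OF X c] v(2) by (intro image_eqI[of _ _ "univ_enc R ?\<iota> ?c"]) (auto simp: T(5))
    qed
  qed
  have "\<exists>\<psi>. fi_hom R P ?T \<psi> \<and> (\<forall>X. finite X \<longrightarrow> (\<forall>x\<in>carrier (Ob P X). ?\<iota> (?ev X (?inv (\<psi> X x))) = ?\<iota> x))"
    using P[unfolded fi_projective_def, THEN conjunct2, rule_format, OF T(1) B(1) \<pi> epi B(2)] .
  then obtain \<psi> where \<psi>: "fi_hom R P ?T \<psi>"
    "\<And>X x. finite X \<Longrightarrow> x \<in> carrier (Ob P X) \<Longrightarrow> ?ev X (?inv (\<psi> X x)) = x" by auto
  show ?thesis using fi_hom_comp[OF \<psi>(1) T(3)] ev(1) \<psi>(2) by blast
qed

definition hvanish :: "('k, 'a) fi_mod \<Rightarrow> int \<Rightarrow> nat \<Rightarrow> bool"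
  where "hvanish V a n \<longleftrightarrow> vanish (fi_act V) (fi_full V) (fi_zero V) a n"

lemma projective_hvanish:
  assumes R: "cring R" and P: "fi_projective R P" and a: "a \<ge> 1"
  shows "hvanish P a n"
proof -
  have mod: "fi_module R P" using P by (simp add: fi_projective_def)
  obtain s r where s: "fi_hom R P (fi_free R P) s" and r: "fi_hom R (fi_free R P) P r"
    and rs: "\<And>X x. finite X \<Longrightarrow> x \<in> carrier (Ob P X) \<Longrightarrow> r X (s X x) = x"
    using projective_retract_free[OF R P] by blast
  note F = fi_module_fi_free[OF R, of P]
  show ?thesis
    unfolding hvanish_def
  proof (rule system_vanish_retract[OF system_map_full_zero[OF F mod r] system_map_full_zero[OF mod F s] _ fi_free_vanish[OF R a]])
    fix m x assume x: "x \<in> fi_full P m"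
    have "frag_map (\<lambda>x. x) x = frag_map (r {..<m}) (frag_map (s {..<m}) x)"
      by (rule frag_map_comp[of _ "carrier (Ob P {..<m})"]) (use x rs in \<open>auto simp: preim_def\<close>)
    then show "x - frag_map (r {..<m}) (frag_map (s {..<m}) x) \<in> fi_zero P m"
      using free_eval(5)[OF fi_module.Ob_module[OF mod]] by (simp add: frag_map_id preim_def)
  qed
qed

section \<open>FI-homology without quotients\<close>

lemma (in Module.module) submodule_hull:
  assumes "G \<subseteq> carrier M"
  shows "submodule ((\<lambda>N. submodule N R M) hull G) R M"
proof -
  have "(\<lambda>N. submodule N R M) hull G \<subseteq> carrier M"
    by (rule hull_minimal) (rule assms carrier_is_submodule)+
  moreover have mem: "x \<in> (\<lambda>N. submodule N R M) hull G \<longleftrightarrow> (\<forall>N. submodule N R M \<longrightarrow> G \<subseteq> N \<longrightarrow> x \<in> N)" for x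
    by (auto simp: hull_def)
  moreover have "\<zero>\<^bsub>M\<^esub> \<in> N" if "submodule N R M" for N
    using subgroup.one_closed[OF submodule.axioms(1)[OF that]] by simp
  ultimately show ?thesis
    by (intro submoduleI) (simp_all add: submoduleE(3,4,5))
qed

lemma submodule_vimage:
  assumes M: "Module.module R M" and N: "Module.module R N" and h: "h \<in> mod_homs R M N"
    and K: "submodule K R N"
  shows "submodule {x \<in> carrier M. h x \<in> K} R M"
proof -
  interpret M: Module.module R M by fact
  interpret N: Module.module R N by fact
  note hK = mod_homsD[OF h]
  note K = N.submoduleE[OF K] subgroup.one_closed[OF submodule.axioms(1)[OF K], simplified]
  show ?thesis
  proof (rule M.submoduleI)
    fix a assume a: "a \<in> {x \<in> carrier M. h x \<in> K}"
    then have "\<ominus>\<^bsub>M\<^esub> a = (\<ominus>\<^bsub>R\<^esub> \<one>\<^bsub>R\<^esub>) \<odot>\<^bsub>M\<^esub> a" by (auto simp: M.smult_l_minus)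
    then show "\<ominus>\<^bsub>M\<^esub> a \<in> {x \<in> carrier M. h x \<in> K}"
      using a hK(3)[of "\<ominus>\<^bsub>R\<^esub> \<one>\<^bsub>R\<^esub>" a] K(4) by simp
  qed (use K mod_homs_zero[OF M N h] in \<open>auto simp: hK\<close>)
qed

lemma (in Module.module) abelian_subgroup_submodule:
  assumes "submodule K R M" shows "abelian_subgroup K M"
  by (intro abelian_subgroupI3 additive_subgroup.intro submodule.axioms(1)[OF assms] abelian_group_axioms)

lemma (in Module.module) coset_eq_iff:
  assumes K: "submodule K R M" and x: "x \<in> carrier M" "y \<in> carrier M"
  shows "K +>\<^bsub>M\<^esub> x = K +>\<^bsub>M\<^esub> y \<longleftrightarrow> x \<ominus>\<^bsub>M\<^esub> y \<in> K"
proof -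
  interpret abelian_subgroup K M by (rule abelian_subgroup_submodule[OF K])
  show ?thesis
    using a_rcos_module[OF x(2,1)] a_repr_independence'[of x y] a_repr_independenceD[of x y] x
    by (auto simp: a_minus_def)
qed

lemma quot_map_coset:
  assumes M: "Module.module R M" and N: "Module.module R N" and h: "h \<in> mod_homs R M N"
    and K: "submodule K R M" and L: "submodule L R N" and hK: "\<And>x. x \<in> K \<Longrightarrow> h x \<in> L"
    and x: "x \<in> carrier M"
  shows "quot_map N L h (K +>\<^bsub>M\<^esub> x) = L +>\<^bsub>N\<^esub> h x"
proof -
  interpret M: Module.module R M by fact
  interpret N: Module.module R N by fact
  interpret KM: abelian_subgroup K M by (rule M.abelian_subgroup_submodule[OF K])
  have "L +>\<^bsub>N\<^esub> h y = L +>\<^bsub>N\<^esub> h x" if y: "y \<in> K +>\<^bsub>M\<^esub> x" for y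
  proof -
    have yc: "y \<in> carrier M" using KM.a_elemrcos_carrier[OF x y] .
    have "y \<ominus>\<^bsub>M\<^esub> x \<in> K" using KM.a_rcos_module[OF x yc] y by (simp add: a_minus_def)
    then have "h y \<ominus>\<^bsub>N\<^esub> h x \<in> L" using hK mod_homs_diff[OF M N h yc x] by metis
    then show ?thesis using N.coset_eq_iff[OF L] mod_homsD(1)[OF h] yc x by blast
  qed
  moreover have "x \<in> K +>\<^bsub>M\<^esub> x" by (rule KM.a_rcos_self[OF x])
  ultimately show ?thesis unfolding quot_map_def by blast
qed

text \<open>\<open>Z\<close> represents the cycles inside \<open>M\<close>, so that triviality of a
  quotient whose elements are cosets of cosets is decided by elements of \<open>M\<close>.\<close>

lemma subquotient_trivial_iff:
  assumes M: "Module.module R M" and K: "submodule K R M" and Q: "Module.module R Q" and b: "b \<in> mod_homs R Q M"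
    and Z: "Z \<subseteq> carrier M" "\<zero>\<^bsub>M\<^esub> \<in> Z"
    and Cy: "Cy = (\<lambda>x. K +>\<^bsub>M\<^esub> x) ` Z" and Bd: "Bd = (\<lambda>y. K +>\<^bsub>M\<^esub> b y) ` carrier Q"
  shows "carrier (mod_quot ((mod_quot M K)\<lparr>carrier := Cy\<rparr>) Bd) = {\<zero>\<^bsub>mod_quot ((mod_quot M K)\<lparr>carrier := Cy\<rparr>) Bd\<^esub>}
    \<longleftrightarrow> (\<forall>x\<in>Z. \<exists>y\<in>carrier Q. x \<ominus>\<^bsub>M\<^esub> b y \<in> K)"
proof -
  interpret M: Module.module R M by fact
  interpret Q: Module.module R Q by fact
  interpret KM: abelian_subgroup K M by (rule M.abelian_subgroup_submodule[OF K])
  let ?c = "\<lambda>x. K +>\<^bsub>M\<^esub> x" and ?M = "(mod_quot M K)\<lparr>carrier := Cy\<rparr>"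
  note bc = mod_homsD(1)[OF b]
  have coset: "Bd +>\<^bsub>?M\<^esub> C = (\<lambda>y. ?c (b y) <+>\<^bsub>M\<^esub> C) ` carrier Q" for C
    by (auto simp: a_r_coset_def' Bd mod_quot_def)
  have coset': "Bd +>\<^bsub>?M\<^esub> ?c x = (\<lambda>y. ?c (b y \<oplus>\<^bsub>M\<^esub> x)) ` carrier Q" if "x \<in> carrier M" for x
    unfolding coset using KM.a_rcos_sum[OF bc that] by (auto intro!: image_cong)
  have carr: "carrier (mod_quot ?M Bd) = (\<lambda>x. Bd +>\<^bsub>?M\<^esub> ?c x) ` Z"
    by (auto simp: mod_quot_def A_RCOSETS_def' Cy a_r_coset_def')
  have "Bd +>\<^bsub>?M\<^esub> ?c x = Bd \<longleftrightarrow> (\<exists>y\<in>carrier Q. x \<ominus>\<^bsub>M\<^esub> b y \<in> K)" if x: "x \<in> Z" for x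
  proof
    have xc: "x \<in> carrier M" using x Z by blast
    { assume "Bd +>\<^bsub>?M\<^esub> ?c x = Bd"
      moreover have "?c (b \<zero>\<^bsub>Q\<^esub> \<oplus>\<^bsub>M\<^esub> x) \<in> Bd +>\<^bsub>?M\<^esub> ?c x" unfolding coset'[OF xc] by blast
      ultimately have "?c x \<in> Bd" using mod_homs_zero[OF Q M b] xc by simp
      then show "\<exists>y\<in>carrier Q. x \<ominus>\<^bsub>M\<^esub> b y \<in> K" using M.coset_eq_iff[OF K xc] bc by (auto simp: Bd) }
    { assume "\<exists>y\<in>carrier Q. x \<ominus>\<^bsub>M\<^esub> b y \<in> K"
      then obtain y where y: "y \<in> carrier Q" "?c x = ?c (b y)" using M.coset_eq_iff[OF K xc] bc by blast
      have "Bd +>\<^bsub>?M\<^esub> ?c x = (\<lambda>z. ?c (b (z \<oplus>\<^bsub>Q\<^esub> y))) ` carrier Q"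
        unfolding y(2) coset'[OF bc[OF y(1)]] using mod_homsD(2)[OF b _ y(1)] by (auto intro!: image_cong)
      also have "\<dots> = Bd"
        unfolding Bd
      proof (intro equalityI subsetI)
        fix C assume "C \<in> (\<lambda>y. ?c (b y)) ` carrier Q"
        then obtain z where z: "z \<in> carrier Q" "C = ?c (b z)" by blast
        have "(z \<ominus>\<^bsub>Q\<^esub> y) \<oplus>\<^bsub>Q\<^esub> y = z" using z y by (simp add: Q.minus_eq Q.a_assoc Q.l_neg)
        then show "C \<in> (\<lambda>z. ?c (b (z \<oplus>\<^bsub>Q\<^esub> y))) ` carrier Q"
          using z y by (intro image_eqI[of _ _ "z \<ominus>\<^bsub>Q\<^esub> y"]) auto
      qed (use y in auto)
      finally show "Bd +>\<^bsub>?M\<^esub> ?c x = Bd" . }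
  qed
  then have *: "Bd +>\<^bsub>?M\<^esub> ?c x = Bd \<longleftrightarrow> (\<exists>y\<in>carrier Q. x \<ominus>\<^bsub>M\<^esub> b y \<in> K)" if "x \<in> Z" for x using that .
  have "\<zero>\<^bsub>mod_quot ?M Bd\<^esub> = Bd" by (simp add: mod_quot_def)
  moreover have "(\<lambda>x. Bd +>\<^bsub>?M\<^esub> ?c x) ` Z = {Bd} \<longleftrightarrow> (\<forall>x\<in>Z. Bd +>\<^bsub>?M\<^esub> ?c x = Bd)"
    using Z(2) by blast
  ultimately show ?thesis unfolding carr using * by simp
qed

section \<open>The submodules JV and exactness of F(P)\<close>

definition J_gens :: "('k, 'a) fi_mod \<Rightarrow> nat set \<Rightarrow> 'a set"
  where "J_gens V X = (\<Union>Y\<in>{Y. finite Y \<and> card Y < card X}. \<Union>f\<in>FI_hom Y X. Ar V Y X f ` carrier (Ob V Y))"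

lemma fi_J_hull: "fi_J R V X = (\<lambda>N. submodule N R (Ob V X)) hull J_gens V X"
  by (simp add: fi_J_def J_gens_def)

lemma J_gensE:
  assumes "x \<in> J_gens V X"
  obtains Y f v where "finite Y" "card Y < card X" "f \<in> FI_hom Y X" "v \<in> carrier (Ob V Y)" "x = Ar V Y X f v"
  using assms by (auto simp: J_gens_def)

lemma J_gensI: "finite Y \<Longrightarrow> card Y < card X \<Longrightarrow> f \<in> FI_hom Y X \<Longrightarrow> v \<in> carrier (Ob V Y) \<Longrightarrow>
  Ar V Y X f v \<in> fi_J R V X"
  unfolding fi_J_hull by (rule subsetD[OF hull_subset]) (auto simp: J_gens_def)

context fi_module
begin

lemma submodule_J: "finite X \<Longrightarrow> submodule (fi_J R V X) R (Ob V X)"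
  unfolding fi_J_hull
  by (intro module.submodule_hull Ob_module) (auto simp: J_gens_def intro: mod_homsD(1)[OF Ar_hom])

lemma J_carrier: "finite X \<Longrightarrow> x \<in> fi_J R V X \<Longrightarrow> x \<in> carrier (Ob V X)"
  using Module.module.submoduleE(1)[OF Ob_module submodule_J] by blast

end

text \<open>The preimage of a submodule under a linear map is a submodule, so containment of a hull
  can be tested on its generators.\<close>

lemma J_map:
  assumes V: "fi_module R V" and W: "fi_module R W" and X: "finite X" and Z: "finite Z"
    and h: "h \<in> mod_homs R (Ob V X) (Ob W Z)"
    and gens: "\<And>Y f v. finite Y \<Longrightarrow> card Y < card X \<Longrightarrow> f \<in> FI_hom Y X \<Longrightarrow> v \<in> carrier (Ob V Y) \<Longrightarrow> h (Ar V Y X f v) \<in> fi_J R W Z"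
    and x: "x \<in> fi_J R V X"
  shows "h x \<in> fi_J R W Z"
proof -
  interpret V: fi_module R V by fact
  interpret W: fi_module R W by fact
  have "fi_J R V X \<subseteq> {x \<in> carrier (Ob V X). h x \<in> fi_J R W Z}"
    unfolding fi_J_hull[of R V]
  proof (rule hull_minimal)
    show "submodule {x \<in> carrier (Ob V X). h x \<in> fi_J R W Z} R (Ob V X)"
      by (rule submodule_vimage[OF V.Ob_module[OF X] W.Ob_module[OF Z] h W.submodule_J[OF Z]])
    show "J_gens V X \<subseteq> {x \<in> carrier (Ob V X). h x \<in> fi_J R W Z}"
    proof
      fix x assume "x \<in> J_gens V X"
      then obtain Y f v where "finite Y" "card Y < card X" "f \<in> FI_hom Y X" "v \<in> carrier (Ob V Y)" "x = Ar V Y X f v"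
        by (rule J_gensE)
      then show "x \<in> {x \<in> carrier (Ob V X). h x \<in> fi_J R W Z}"
        using gens mod_homsD(1)[OF V.Ar_hom[OF _ X]] by simp
    qed
  qed
  then show ?thesis using x by blast
qed

lemma J_hom:
  assumes V: "fi_module R V" and W: "fi_module R W" and \<phi>: "fi_hom R V W \<phi>" and X: "finite X" and x: "x \<in> fi_J R V X"
  shows "\<phi> X x \<in> fi_J R W X"
proof (rule J_map[OF V W X X _ _ x])
  show "\<phi> X \<in> mod_homs R (Ob V X) (Ob W X)" using \<phi> X by (simp add: fi_hom_def)
  fix Y f v assume a: "finite Y" "card Y < card X" "f \<in> FI_hom Y X" "v \<in> carrier (Ob V Y)"
  have "\<phi> Y \<in> mod_homs R (Ob V Y) (Ob W Y)" using \<phi> a by (simp add: fi_hom_def)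
  then have "\<phi> Y v \<in> carrier (Ob W Y)" using a(4) by (rule mod_homsD(1))
  then have "Ar W Y X f (\<phi> Y v) \<in> fi_J R W X" by (rule J_gensI[OF a(1-3)])
  then show "\<phi> X (Ar V Y X f v) \<in> fi_J R W X" using \<phi> X a by (simp add: fi_hom_def)
qed

lemma J_Ar:
  assumes V: "fi_module R V" and X: "finite X" "finite Z" "card X \<le> card Z" and g: "g \<in> FI_hom X Z" and x: "x \<in> fi_J R V X"
  shows "Ar V X Z g x \<in> fi_J R V Z"
proof (rule J_map[OF V V X(1,2) fi_module.Ar_hom[OF V X(1,2) g] _ x])
  fix Y f v assume a: "finite Y" "card Y < card X" "f \<in> FI_hom Y X" "v \<in> carrier (Ob V Y)"
  show "Ar V X Z g (Ar V Y X f v) \<in> fi_J R V Z"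
    unfolding fi_module.Ar_comp[OF V a(1) X(1,2) a(3) g a(4), symmetric]
    by (rule J_gensI[OF a(1) _ FI_hom_comp[OF a(3) g] a(4)]) (use a X in simp)
qed

text \<open>Vanishing at \<open>X\<close> of the homology of \<open>F(P)\<close> at \<open>P a\<close>, with the quotients by \<open>J\<close> unfolded.\<close>

definition F_exact_at ::
  "('k, 'r) ring_scheme \<Rightarrow> (nat \<Rightarrow> ('k, 'b) fi_mod) \<Rightarrow> (nat \<Rightarrow> nat set \<Rightarrow> 'b \<Rightarrow> 'b) \<Rightarrow> nat \<Rightarrow> nat set \<Rightarrow> bool"
  where "F_exact_at R P d a X \<longleftrightarrow> (\<forall>x\<in>carrier (Ob (P a) X).
    (\<forall>b. a = Suc b \<longrightarrow> d b X x \<in> fi_J R (P b) X) \<longrightarrow>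
    (\<exists>y\<in>carrier (Ob (P (Suc a)) X). x \<ominus>\<^bsub>Ob (P a) X\<^esub> d a X y \<in> fi_J R (P a) X))"

abbreviation trivial_at :: "('k, 'a) fi_mod \<Rightarrow> nat set \<Rightarrow> bool"
  where "trivial_at V X \<equiv> carrier (Ob V X) = {\<zero>\<^bsub>Ob V X\<^esub>}"

lemma F_exact_at_iff:
  assumes P: "\<And>a. fi_module R (P a)" and d: "\<And>a. fi_hom R (P (Suc a)) (P a) (d a)" and X: "finite X"
  shows "trivial_at (fi_quot (fi_sub (F_ob R (P a)) (F_cycles R P d a)) (F_boundaries R P d a)) X
    \<longleftrightarrow> F_exact_at R P d a X"
proof -
  have M: "Module.module R (Ob (P a) X)" and J: "submodule (fi_J R (P a) X) R (Ob (P a) X)" for a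
    using fi_module.Ob_module[OF P X] fi_module.submodule_J[OF P X] by auto
  have dh: "d a X \<in> mod_homs R (Ob (P (Suc a)) X) (Ob (P a) X)" for a using d[of a] X by (simp add: fi_hom_def)
  have q: "quot_map (Ob (P a) X) (fi_J R (P a) X) (d a X) (fi_J R (P (Suc a)) X +>\<^bsub>Ob (P (Suc a)) X\<^esub> x)
    = fi_J R (P a) X +>\<^bsub>Ob (P a) X\<^esub> d a X x" if "x \<in> carrier (Ob (P (Suc a)) X)" for a x
    by (rule quot_map_coset[OF M M dh J J J_hom[OF P P d X] that])
  have J0: "fi_J R (P a) X +>\<^bsub>Ob (P a) X\<^esub> x = fi_J R (P a) X \<longleftrightarrow> x \<in> fi_J R (P a) X" if "x \<in> carrier (Ob (P a) X)" for a x
  proof -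
    interpret Module.module R "Ob (P a) X" by (rule M)
    show ?thesis
      using a_coset_join1[OF _ that submodule.axioms(1)[OF J]] a_coset_join2[OF that submodule.axioms(1)[OF J]] by blast
  qed
  define Z where "Z = {x \<in> carrier (Ob (P a) X). \<forall>b. a = Suc b \<longrightarrow> d b X x \<in> fi_J R (P b) X}"
  have zero: "\<zero>\<^bsub>Ob (P a) X\<^esub> \<in> Z"
  proof -
    interpret Module.module R "Ob (P a) X" by (rule M)
    have "d b X \<zero>\<^bsub>Ob (P (Suc b)) X\<^esub> \<in> fi_J R (P b) X" for b
      using mod_homs_zero[OF M M dh] subgroup.one_closed[OF submodule.axioms(1)[OF J]] by simp
    then show ?thesis by (auto simp: Z_def)
  qed
  have Cy: "F_cycles R P d a X = (\<lambda>x. fi_J R (P a) X +>\<^bsub>Ob (P a) X\<^esub> x) ` Z"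
  proof (cases a)
    case 0
    then show ?thesis by (auto simp: F_cycles_def F_ob_def fi_quot_def mod_quot_def A_RCOSETS_def' Z_def)
  next
    case (Suc b)
    have "F_cycles R P d a X = {C \<in> a_rcosets\<^bsub>Ob (P a) X\<^esub> fi_J R (P a) X.
        quot_map (Ob (P b) X) (fi_J R (P b) X) (d b X) C = fi_J R (P b) X}"
      by (auto simp: Suc F_cycles_def fi_ker_def a_kernel_def' F_ob_def fi_quot_def mod_quot_def F_map_def)
    also have "\<dots> = (\<lambda>x. fi_J R (P a) X +>\<^bsub>Ob (P a) X\<^esub> x) ` Z"
      using q[of _ b] J0[of _ b] mod_homsD(1)[OF dh[of b]] by (auto simp: A_RCOSETS_def' Z_def Suc)
    finally show ?thesis .
  qed
  have Bd: "F_boundaries R P d a X = (\<lambda>y. fi_J R (P a) X +>\<^bsub>Ob (P a) X\<^esub> d a X y) ` carrier (Ob (P (Suc a)) X)"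
  proof -
    have "F_boundaries R P d a X = quot_map (Ob (P a) X) (fi_J R (P a) X) (d a X) ` (\<lambda>x. fi_J R (P (Suc a)) X +>\<^bsub>Ob (P (Suc a)) X\<^esub> x) ` carrier (Ob (P (Suc a)) X)"
      by (auto simp: F_boundaries_def fi_im_def F_ob_def fi_quot_def mod_quot_def A_RCOSETS_def' F_map_def)
    then show ?thesis using q[of _ a] by (simp add: image_image)
  qed
  have Ob: "Ob (fi_quot (fi_sub (F_ob R (P a)) (F_cycles R P d a)) (F_boundaries R P d a)) X
    = mod_quot ((mod_quot (Ob (P a) X) (fi_J R (P a) X))\<lparr>carrier := F_cycles R P d a X\<rparr>) (F_boundaries R P d a X)"
    by (simp add: fi_quot_def fi_sub_def F_ob_def)
  have "Z \<subseteq> carrier (Ob (P a) X)" by (auto simp: Z_def)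
  then show ?thesis
    unfolding Ob subquotient_trivial_iff[OF M J M dh \<open>Z \<subseteq> _\<close> zero Cy Bd]
    by (auto simp: F_exact_at_def Z_def)
qed

text \<open>Moves from arbitrary finite sets, and from \<open>{1..n}\<close> in the definition of
  the degree, to the sets \<open>{..<n}\<close> on which the cubes live.\<close>

lemma F_exact_at_transport:
  assumes P: "\<And>a. fi_module R (P a)" and d: "\<And>a. fi_hom R (P (Suc a)) (P a) (d a)"
    and fin: "finite X" "finite Z" "card X = card Z" and E: "F_exact_at R P d a X"
  shows "F_exact_at R P d a Z"
proof -
  obtain \<beta>0 where \<beta>0: "bij_betw \<beta>0 Z X" using fin by (metis bij_betw_iff_card)
  define \<beta> where "\<beta> = restrict \<beta>0 Z"
  define \<gamma> where "\<gamma> = restrict (inv_into Z \<beta>0) X"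
  have \<beta>: "\<beta> \<in> FI_hom Z X" and \<gamma>: "\<gamma> \<in> FI_hom X Z"
    using \<beta>0 bij_betw_inv_into[OF \<beta>0] unfolding \<beta>_def \<gamma>_def FI_hom_def bij_betw_def by auto
  have \<gamma>\<beta>: "compose Z \<gamma> \<beta> = (\<lambda>x\<in>Z. x)"
    using \<beta>0 by (auto simp: compose_def \<beta>_def \<gamma>_def fun_eq_iff bij_betw_def)
  have Ar: "Ar (P b) X Z \<gamma> (Ar (P b) Z X \<beta> x) = x" if "x \<in> carrier (Ob (P b) Z)" for b x
    using fi_module.Ar_comp[OF P fin(2,1,2) \<beta> \<gamma> that] fi_module.Ar_id[OF P fin(2) that] by (simp add: \<gamma>\<beta>)
  have nat: "d b W (Ar (P (Suc b)) U W f x) = Ar (P b) U W f (d b U x)"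
    if "finite U" "finite W" "f \<in> FI_hom U W" "x \<in> carrier (Ob (P (Suc b)) U)" for b U W f x
    using d[of b] that by (simp add: fi_hom_def)
  have dc: "d b U x \<in> carrier (Ob (P b) U)" if "finite U" "x \<in> carrier (Ob (P (Suc b)) U)" for b U x
  proof -
    have "d b U \<in> mod_homs R (Ob (P (Suc b)) U) (Ob (P b) U)" using d[of b] that by (simp add: fi_hom_def)
    then show ?thesis using that(2) by (rule mod_homsD(1))
  qed
  note Arc = mod_homsD(1)[OF fi_module.Ar_hom[OF P]]
  show ?thesis
    unfolding F_exact_at_def
  proof (intro ballI impI)
    fix x assume x: "x \<in> carrier (Ob (P a) Z)" "\<forall>b. a = Suc b \<longrightarrow> d b Z x \<in> fi_J R (P b) Z"
    define x' where "x' = Ar (P a) Z X \<beta> x"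
    have x': "x' \<in> carrier (Ob (P a) X)" unfolding x'_def by (rule Arc[OF fin(2,1) \<beta> x(1)])
    have "d b X x' \<in> fi_J R (P b) X" if a: "a = Suc b" for b
    proof -
      have "d b X x' = Ar (P b) Z X \<beta> (d b Z x)"
        unfolding x'_def a by (rule nat[OF fin(2,1) \<beta>]) (use x(1) a in simp)
      also have "\<dots> \<in> fi_J R (P b) X"
        by (rule J_Ar[OF P fin(2,1) _ \<beta>]) (use x(2) a fin(3) in simp_all)
      finally show ?thesis .
    qed
    then obtain y where y: "y \<in> carrier (Ob (P (Suc a)) X)" "x' \<ominus>\<^bsub>Ob (P a) X\<^esub> d a X y \<in> fi_J R (P a) X"
      using E x' unfolding F_exact_at_def by blast
    let ?y = "Ar (P (Suc a)) X Z \<gamma> y"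
    have "Ar (P a) X Z \<gamma> (x' \<ominus>\<^bsub>Ob (P a) X\<^esub> d a X y) = x \<ominus>\<^bsub>Ob (P a) Z\<^esub> d a Z ?y"
      unfolding nat[OF fin(1,2) \<gamma> y(1)]
        mod_homs_diff[OF fi_module.Ob_module[OF P fin(1)] fi_module.Ob_module[OF P fin(2)] fi_module.Ar_hom[OF P fin(1,2) \<gamma>]
          x' dc[OF fin(1) y(1)]]
      unfolding x'_def Ar[OF x(1)] ..
    moreover have "Ar (P a) X Z \<gamma> (x' \<ominus>\<^bsub>Ob (P a) X\<^esub> d a X y) \<in> fi_J R (P a) Z"
      by (rule J_Ar[OF P fin(1,2) _ \<gamma> y(2)]) (use fin(3) in simp)
    ultimately show "\<exists>y\<in>carrier (Ob (P (Suc a)) Z). x \<ominus>\<^bsub>Ob (P a) Z\<^esub> d a Z y \<in> fi_J R (P a) Z"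
      using Arc[OF fin(1,2) \<gamma> y(1)] by metis
  qed
qed

section \<open>Generators and boundaries\<close>

text \<open>The witness is \<open>y\<close> at the list whose only \<open>True\<close> is at
  position \<open>j\<close>. \<open>(up ^^ j) Suc\<close> is the coface skipping \<open>j\<close>,
  and no sign arises since the boundary is read at a list without \<open>True\<close>.\<close>

lemma bd_coface:
  assumes "fi_action F A" "y \<in> A m" "j \<le> m"
  shows "\<exists>c\<in>cubes A (Suc m) 1. bd F c (replicate (Suc m) False) = F m (Suc m) ((up ^^ j) Suc) y"
  using assms
proof (induction j arbitrary: F A m)
  case 0
  interpret fi_action F A by fact
  let ?c = "\<lambda>l. if l = True # replicate m False then y else 0"
  have cnt: "falses (replicate m False) = m" by (induction m) auto
  have "?c \<in> cubes A (Suc m) 1"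
    by (rule cubesI) (use 0 cnt A_zero in auto)
  moreover have "bd (shift_front F) (\<lambda>l. 0) (replicate m False) = 0"
    using bd_uminus[where F = "shift_front F" and c = "\<lambda>l. 0" and l = "replicate m False"]
      bd_add[where F = "shift_front F" and c = "\<lambda>l. 0" and c' = "\<lambda>l. 0" and l = "replicate m False"]
      fi_action.F_add[OF fi_action_front] by simp
  ultimately show ?case using cnt by (intro bexI[of _ ?c]) auto
next
  case (Suc j)
  interpret fi_action F A by fact
  obtain m' where m: "m = Suc m'" using Suc.prems(3) by (cases m) auto
  have "y \<in> shift_set A m'" using Suc.prems(2) m by (simp add: shift_set_def)
  then obtain c where c: "c \<in> cubes (shift_set A) m 1"
    "bd (shift_front F) c (replicate m False) = shift_front F m' m ((up ^^ j) Suc) y"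
    using Suc.IH[OF fi_action_front] Suc.prems(3) unfolding m by blast
  let ?c = "\<lambda>l. case l of [] \<Rightarrow> 0 | b # l \<Rightarrow> if b then 0 else c l"
  have "?c \<in> cubes A (Suc m) 1"
  proof (rule cubesI)
    fix l :: "bool list" assume l: "length l = Suc m" "int (trues l) = 1"
    then obtain b l' where l': "l = b # l'" by (cases l) auto
    show "?c l \<in> A (falses l)"
      using l l' cubesD[OF c(1), of l'] A_zero by (cases b) (simp_all add: shift_set_def)
  qed
  moreover have "bd F ?c (replicate (Suc m) False) = F m (Suc m) ((up ^^ Suc j) Suc) y"
    using c(2) by (simp add: F_zero shift_front_def m)
  ultimately show ?case by blast
qed

lemma list_all_False: "length l = n \<Longrightarrow> trues l = 0 \<Longrightarrow> l = replicate n False"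
  by (induction l arbitrary: n) (auto split: if_splits)

lemma count_replicate_False [simp]: "falses (replicate n False) = n" "trues (replicate n False) = 0"
  by (induction n) auto

text \<open>For the least missed point \<open>j\<close>, \<open>f\<close> hits the first
  \<open>j\<close> points but not \<open>j\<close> itself, which is the situation of
  \<open>hit_gens_Suc\<close>.\<close>

lemma FI_hom_factor:
  assumes f: "f \<in> FI_hom Y {..<n}" "finite Y" "card Y < n"
  obtains m j f' where "n = Suc m" "j \<le> m" "f' \<in> FI_hom Y {..<m}" "f = compose Y (restrict ((up ^^ j) Suc) {..<m}) f'"
proof -
  have "card (f ` Y) < n" using card_image_le[OF f(2), of f] f(3) by simp
  then have "\<not> {..<n} \<subseteq> f ` Y" using card_mono[of "f ` Y" "{..<n}"] f(2) by auto
  then have ex: "\<exists>j. j < n \<and> j \<notin> f ` Y" by blast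
  define j where "j = (LEAST j. j < n \<and> j \<notin> f ` Y)"
  have j: "j < n" "j \<notin> f ` Y" using LeastI_ex[OF ex] by (auto simp: j_def)
  have jl: "{..<j} \<subseteq> f ` Y"
  proof
    fix i assume "i \<in> {..<j}"
    then show "i \<in> f ` Y" using not_less_Least[of i "\<lambda>j. j < n \<and> j \<notin> f ` Y"] j(1) by (auto simp: j_def)
  qed
  \<comment> \<open>A dummy that turns \<open>f\<close> into a generator \<open>(Y, f, 0)\<close>;
    \<open>hit_gens\<close> reads nothing of it but the carriers.\<close>
  define V :: "(nat, nat) fi_mod"
    where "V = \<lparr>Ob = \<lambda>_. undefined\<lparr>carrier := UNIV\<rparr>, Ar = undefined\<rparr>"
  have V: "carrier (Ob V Z) = UNIV" for Z by (simp add: V_def)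
  define m where "m = n - 1 - j"
  have n: "n = Suc m + j" using j(1) by (simp add: m_def)
  have "(Y, f, 0) \<in> hit_gens j V {..<Suc m + j}" using f jl n by (simp add: hit_gens_def fi_gens_def V)
  moreover have "(Y, f, 0) \<notin> hit_gens (Suc j) V {..<Suc m + j}" using j(2) by (auto simp: hit_gens_def)
  ultimately obtain c where c: "c \<in> hit_gens j V {..<m + j}" "(Y, f, 0) = act_gen (restrict ((up ^^ j) Suc) {..<m + j}) c"
    using hit_gens_Suc by blast
  obtain Y' f' v where "c = (Y', f', v)" by (cases c)
  with c have "f' \<in> FI_hom Y {..<m + j}" "f = compose Y (restrict ((up ^^ j) Suc) {..<m + j}) f'"
    by (auto simp: act_gen_def hit_gens_def fi_gens_def)
  then show ?thesis using that[of "m + j" j f'] n by simp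
qed

text \<open>This is the statement that \<open>H_0\<close> of the cube is \<open>F\<close>.
  Boundaries are sums of coface images, and every image from a smaller set factors through a coface.
  Boundaries are stable under a scalar \<open>r\<close> because multiplication by \<open>r\<close>
  is a map of FI-modules, by commutativity of the ring, and so acts on cubes.\<close>

lemma J_eq_boundaries:
  assumes P: "fi_module R P"
  shows "fi_J R P {..<n} = (\<lambda>c. free_eval (Ob P {..<n}) (bd (fi_act P) c (replicate n False))) ` cubes (fi_full P) n 1"
    (is "_ = ?ev ` ?C")
proof -
  interpret P: fi_module R P by fact
  interpret M: Module.module R "Ob P {..<n}" by (rule P.Ob_module) simp
  interpret S: fi_system "fi_act P" "fi_full P" "fi_zero P" by (rule fi_system_full_zero[OF P])
  interpret G: graded_complex "bd (fi_act P)" "cubes (fi_full P) n" "cubes (fi_zero P) n" by (rule S.graded_complex)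
  note ev = free_eval[OF M.module_axioms]
  have full: "fi_full P n = frags (carrier (Ob P {..<n}))" using ev(1) by (auto simp: preim_def)
  have bd: "bd (fi_act P) c (replicate n False) \<in> frags (carrier (Ob P {..<n}))" if "c \<in> ?C" for c
    using cubesD[OF G.d_C[OF that], of "replicate n False"] unfolding full[symmetric] by simp
  have "submodule (?ev ` ?C) R (Ob P {..<n})"
  proof (rule M.submoduleI)
    show "?ev ` ?C \<subseteq> carrier (Ob P {..<n})" using ev(1)[OF bd] by blast
    show "\<zero>\<^bsub>Ob P {..<n}\<^esub> \<in> ?ev ` ?C"
      by (rule image_eqI[OF _ G.C_zero]) (simp only: G.d_zero zero_fun_apply ev(5))
    show "a \<oplus>\<^bsub>Ob P {..<n}\<^esub> b \<in> ?ev ` ?C" if a: "a \<in> ?ev ` ?C" and b: "b \<in> ?ev ` ?C" for a b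
    proof -
      obtain c where c: "c \<in> ?C" "a = ?ev c" using a by blast
      obtain c' where c': "c' \<in> ?C" "b = ?ev c'" using b by blast
      show ?thesis
        by (rule image_eqI[OF _ G.C_add[OF c(1) c'(1)]]) (simp only: c c' G.d_add plus_fun_apply ev(3)[OF bd[OF c(1)] bd[OF c'(1)]])
    qed
    show smult: "r \<odot>\<^bsub>Ob P {..<n}\<^esub> a \<in> ?ev ` ?C" if r: "r \<in> carrier R" and a: "a \<in> ?ev ` ?C" for r a
    proof -
      obtain c where c: "c \<in> ?C" "a = ?ev c" using a by blast
      have hom: "fi_hom R P P (\<lambda>X v. r \<odot>\<^bsub>Ob P X\<^esub> v)"
        unfolding fi_hom_def
      proof (intro conjI allI impI ballI)
        fix X :: "nat set" assume X: "finite X"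
        interpret X: Module.module R "Ob P X" by (rule P.Ob_module[OF X])
        show "(\<odot>\<^bsub>Ob P X\<^esub>) r \<in> mod_homs R (Ob P X) (Ob P X)"
        proof -
          have "r \<odot>\<^bsub>Ob P X\<^esub> (s \<odot>\<^bsub>Ob P X\<^esub> x) = s \<odot>\<^bsub>Ob P X\<^esub> (r \<odot>\<^bsub>Ob P X\<^esub> x)"
            if "s \<in> carrier R" "x \<in> carrier (Ob P X)" for s x
            using X.smult_assoc1[OF r that] X.smult_assoc1[OF that(1) r that(2)] M.R.m_comm[OF r that(1)] by metis
          then show ?thesis using r by (simp add: mod_homs_def X.smult_r_distr)
        qed
        show "r \<odot>\<^bsub>Ob P Y\<^esub> Ar P X Y f v = Ar P X Y f (r \<odot>\<^bsub>Ob P X\<^esub> v)"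
          if "finite Y" "f \<in> FI_hom X Y" "v \<in> carrier (Ob P X)" for Y f v
          using mod_homsD(3)[OF P.Ar_hom[OF X that(1,2)] r that(3)] by simp
      qed
      let ?\<phi> = "\<lambda>m. frag_map (\<lambda>v. r \<odot>\<^bsub>Ob P {..<m}\<^esub> v)"
      interpret K: complex_map "bd (fi_act P)" "cubes (fi_full P) n" "cubes (fi_zero P) n"
          "bd (fi_act P)" "cubes (fi_full P) n" "cubes (fi_zero P) n" "lift ?\<phi>"
        by (rule system_map.complex_map[OF system_map_full_zero[OF P P hom]])
      have h: "(\<odot>\<^bsub>Ob P {..<n}\<^esub>) r \<in> mod_homs R (Ob P {..<n}) (Ob P {..<n})" using hom by (simp add: fi_hom_def)
      note nat = free_eval_natural[OF M.module_axioms M.module_axioms h bd[OF c(1)]]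
      have "(bd (fi_act P) (lift ?\<phi> c) - lift ?\<phi> (bd (fi_act P) c)) (replicate n False) \<in> fi_zero P n"
        using cubesD[OF K.\<phi>_d[OF c(1)], of "replicate n False"] by simp
      then have "bd (fi_act P) (lift ?\<phi> c) (replicate n False) - ?\<phi> n (bd (fi_act P) c (replicate n False)) \<in> fi_zero P n"
        by (simp add: lift_def)
      then have "?ev (lift ?\<phi> c) = r \<odot>\<^bsub>Ob P {..<n}\<^esub> ?ev c"
        using preim_diff_zero[OF P, of "bd (fi_act P) (lift ?\<phi> c) (replicate n False)" n] bd[OF K.\<phi>_C[OF c(1)]] nat
        unfolding full by simp
      then show ?thesis unfolding c(2) by (intro image_eqI[OF _ K.\<phi>_C[OF c(1)]]) (rule sym)
    qed
    show "\<ominus>\<^bsub>Ob P {..<n}\<^esub> a \<in> ?ev ` ?C" if a: "a \<in> ?ev ` ?C" for a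
    proof -
      have "a \<in> carrier (Ob P {..<n})" using ev(1)[OF bd] a by blast
      then have "\<ominus>\<^bsub>Ob P {..<n}\<^esub> a = (\<ominus>\<^bsub>R\<^esub> \<one>\<^bsub>R\<^esub>) \<odot>\<^bsub>Ob P {..<n}\<^esub> a" by (simp add: M.smult_l_minus)
      then show ?thesis using smult[of "\<ominus>\<^bsub>R\<^esub> \<one>\<^bsub>R\<^esub>" a] a by simp
    qed
  qed
  moreover have "J_gens P {..<n} \<subseteq> ?ev ` ?C"
  proof
    fix x assume "x \<in> J_gens P {..<n}"
    then obtain Y f v where Y: "finite Y" "card Y < card {..<n}" "f \<in> FI_hom Y {..<n}" "v \<in> carrier (Ob P Y)" "x = Ar P Y {..<n} f v"
      by (rule J_gensE)
    obtain m j f' where m: "n = Suc m" "j \<le> m" "f' \<in> FI_hom Y {..<m}" "f = compose Y (restrict ((up ^^ j) Suc) {..<m}) f'"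
      using FI_hom_factor[OF Y(3,1)] Y(2) by auto
    have \<delta>: "(up ^^ j) Suc \<in> inj_maps m (Suc m)"
      by (rule inj_mapsI) (auto simp: up_funpow split: if_splits)
    let ?w = "Ar P Y {..<m} f' v"
    have w: "?w \<in> carrier (Ob P {..<m})" by (rule mod_homsD(1)[OF P.Ar_hom[OF Y(1) _ m(3)] Y(4)]) simp
    have x: "x = Ar P {..<m} {..<n} (restrict ((up ^^ j) Suc) {..<m}) ?w"
      unfolding Y(5) m(4) using P.Ar_comp[OF Y(1) _ _ m(3) _ Y(4)] inj_maps_FI_hom[OF \<delta>] m(1) by simp
    have "frag_of ?w \<in> fi_full P m" using w free_eval(2)[OF P.Ob_module] by (simp add: preim_def)
    then obtain c where c: "c \<in> cubes (fi_full P) n 1"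
      "bd (fi_act P) c (replicate n False) = fi_act P m n ((up ^^ j) Suc) (frag_of ?w)"
      using bd_coface[OF S.A.fi_action_axioms _ m(2)] m(1) by blast
    have "x \<in> carrier (Ob P {..<n})" using mod_homsD(1)[OF P.Ar_hom[OF Y(1) _ Y(3)] Y(4)] Y(5) by simp
    then have "?ev c = x" unfolding c(2) by (simp add: fi_act_def x ev(2))
    then show "x \<in> ?ev ` ?C" using c(1) by blast
  qed
  ultimately have "fi_J R P {..<n} \<subseteq> ?ev ` ?C" unfolding fi_J_hull by (intro hull_minimal)
  moreover have "?ev c \<in> fi_J R P {..<n}" if c: "c \<in> ?C" for c
  proof -
    note J = P.submodule_J[of "{..<n}", simplified]
    note JE = M.submoduleE[OF J] subgroup.one_closed[OF submodule.axioms(1)[OF J], simplified]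
    have "bd (fi_act P) c (replicate n False) \<in> {z \<in> frags (carrier (Ob P {..<n})). free_eval (Ob P {..<n}) z \<in> fi_J R P {..<n}}"
    proof (rule bd_in_range)
      fix x y assume "x \<in> {z \<in> frags (carrier (Ob P {..<n})). free_eval (Ob P {..<n}) z \<in> fi_J R P {..<n}}"
        and "y \<in> {z \<in> frags (carrier (Ob P {..<n})). free_eval (Ob P {..<n}) z \<in> fi_J R P {..<n}}"
      then show "x + y \<in> {z \<in> frags (carrier (Ob P {..<n})). free_eval (Ob P {..<n}) z \<in> fi_J R P {..<n}}"
        using JE(5) S.A.A_add[of x n y] unfolding full by (auto simp: ev(3))
    next
      fix l' f assume l': "length l' = length (replicate n False)" "trues l' = 1"
        and f: "f \<in> inj_maps (falses l') (Suc (falses l'))"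
      let ?k = "falses l'"
      have k: "Suc ?k = n" using count_bool_length[of l'] l' by simp
      have cl: "c l' \<in> fi_full P ?k" using cubesD[OF c, of l'] l' by simp
      have v: "free_eval (Ob P {..<?k}) (c l') \<in> carrier (Ob P {..<?k})" using cl by (simp add: preim_def)
      have hom: "restrict f {..<?k} \<in> FI_hom {..<?k} {..<n}" using inj_maps_FI_hom[OF f] k by simp
      have "free_eval (Ob P {..<n}) (fi_act P ?k (Suc ?k) f (c l')) = Ar P {..<?k} {..<n} (restrict f {..<?k}) (free_eval (Ob P {..<?k}) (c l'))"
        unfolding k fi_act_def
        by (rule free_eval_natural(1)[OF P.Ob_module P.Ob_module P.Ar_hom]) (use cl hom in \<open>auto simp: preim_def\<close>)
      moreover have "Ar P {..<?k} {..<n} (restrict f {..<?k}) (free_eval (Ob P {..<?k}) (c l')) \<in> fi_J R P {..<n}"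
        by (rule J_gensI[OF _ _ hom v]) (use k in auto)
      moreover have "fi_act P ?k (Suc ?k) f (c l') \<in> frags (carrier (Ob P {..<n}))"
        using S.A.F_A[OF f cl] k unfolding full[symmetric] by simp
      ultimately show "fi_act P ?k (Suc ?k) f (c l') \<in> {z \<in> frags (carrier (Ob P {..<n})). free_eval (Ob P {..<n}) z \<in> fi_J R P {..<n}}"
        by simp
    qed (use JE ev(5) in auto)
    then show ?thesis by simp
  qed
  ultimately show ?thesis by blast
qed

lemma cubes_zero_iff:
  assumes P: "fi_module R P" and c: "c \<in> cubes (fi_full P) n 0" "c' \<in> cubes (fi_full P) n 0"
  shows "c - c' \<in> cubes (fi_zero P) n 0 \<longleftrightarrow>
    free_eval (Ob P {..<n}) (c (replicate n False)) = free_eval (Ob P {..<n}) (c' (replicate n False))"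
proof -
  have "c (replicate n False) \<in> fi_full P n" "c' (replicate n False) \<in> fi_full P n"
    using cubesD[OF c(1), of "replicate n False"] cubesD[OF c(2), of "replicate n False"] by simp_all
  note * = preim_diff_zero[OF P this]
  have "c - c' \<in> cubes (fi_zero P) n 0 \<longleftrightarrow> c (replicate n False) - c' (replicate n False) \<in> fi_zero P n"
  proof
    assume "c - c' \<in> cubes (fi_zero P) n 0"
    from cubesD[OF this, of "replicate n False"] show "c (replicate n False) - c' (replicate n False) \<in> fi_zero P n" by simp
  next
    assume a: "c (replicate n False) - c' (replicate n False) \<in> fi_zero P n"
    show "c - c' \<in> cubes (fi_zero P) n 0"
    proof (rule cubesI)
      fix l :: "bool list" assume "length l = n" "int (trues l) = 0"
      then have "l = replicate n False" by (intro list_all_False) auto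
      then show "(c - c') l \<in> fi_zero P (falses l)" using a by simp
    qed
  qed
  then show ?thesis using * by simp
qed

section \<open>Dimension shifting along a resolution\<close>

lemma fi_ker_iff: "x \<in> fi_ker V W \<phi> X \<longleftrightarrow> x \<in> carrier (Ob V X) \<and> \<phi> X x = \<zero>\<^bsub>Ob W X\<^esub>"
  by (simp add: fi_ker_def a_kernel_def')

lemma kernel_subgroups:
  assumes V: "fi_module R V" and W: "fi_module R W" and \<phi>: "fi_hom R V W \<phi>"
  shows "fi_subgroups V (fi_ker V W \<phi>)"
  unfolding fi_subgroups_def
proof (intro allI impI conjI ballI)
  interpret V: fi_module R V by fact
  interpret W: fi_module R W by fact
  fix X :: "nat set" assume X: "finite X"
  interpret MV: Module.module R "Ob V X" by (rule V.Ob_module[OF X])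
  interpret MW: Module.module R "Ob W X" by (rule W.Ob_module[OF X])
  have h: "\<phi> X \<in> mod_homs R (Ob V X) (Ob W X)" using \<phi> X by (simp add: fi_hom_def)
  show "fi_ker V W \<phi> X \<subseteq> carrier (Ob V X)" by (auto simp: fi_ker_iff)
  show "\<zero>\<^bsub>Ob V X\<^esub> \<in> fi_ker V W \<phi> X"
    using mod_homs_zero[OF MV.module_axioms MW.module_axioms h] by (simp add: fi_ker_iff)
  show "x \<ominus>\<^bsub>Ob V X\<^esub> y \<in> fi_ker V W \<phi> X" if "x \<in> fi_ker V W \<phi> X" "y \<in> fi_ker V W \<phi> X" for x y
    using that mod_homs_diff[OF MV.module_axioms MW.module_axioms h, of x y]
    by (simp add: fi_ker_iff MW.minus_eq MW.r_neg)
  show "Ar V X Y f ` fi_ker V W \<phi> X \<subseteq> fi_ker V W \<phi> Y" if "finite Y" "f \<in> FI_hom X Y" for Y f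
  proof
    fix y assume "y \<in> Ar V X Y f ` fi_ker V W \<phi> X"
    then obtain x where x: "x \<in> carrier (Ob V X)" "\<phi> X x = \<zero>\<^bsub>Ob W X\<^esub>" "y = Ar V X Y f x" by (auto simp: fi_ker_iff)
    have "\<phi> Y y = Ar W X Y f (\<phi> X x)" using \<phi> X that x by (simp add: fi_hom_def)
    then have "\<phi> Y y = \<zero>\<^bsub>Ob W Y\<^esub>"
      using x(2) mod_homs_zero[OF MW.module_axioms W.Ob_module[OF that(1)] W.Ar_hom[OF X that]] by simp
    then show "y \<in> fi_ker V W \<phi> Y" using mod_homsD(1)[OF V.Ar_hom[OF X that] x(1)] x(3) by (simp add: fi_ker_iff)
  qed
qed

lemma preim_sub:
  assumes "fi_subgroups V N" shows "x \<in> preim V N m \<Longrightarrow> x \<in> fi_full V m" and "x \<in> fi_zero V m \<Longrightarrow> x \<in> preim V N m"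
  using fi_subgroupsD(1,2)[OF assms, of "{..<m}"] by (auto simp: preim_def)

text \<open>The isomorphism of \<open>V / ker \<phi>\<close> with the image of
  \<open>\<phi>\<close>, at the level of cube homology.\<close>

lemma vanish_hom_iso:
  assumes V: "fi_module R V" and W: "fi_module R W" and \<phi>: "fi_hom R V W \<phi>"
    and L: "fi_subgroups W L" "\<And>X. finite X \<Longrightarrow> \<phi> X ` carrier (Ob V X) = L X"
  shows "vanish (fi_act V) (fi_full V) (preim V (fi_ker V W \<phi>)) a n \<longleftrightarrow> vanish (fi_act W) (preim W L) (fi_zero W) a n"
proof -
  interpret V: fi_module R V by fact
  interpret W: fi_module R W by fact
  have h: "\<phi> {..<m} \<in> mod_homs R (Ob V {..<m}) (Ob W {..<m})" for m using \<phi> by (simp add: fi_hom_def)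
  note nat = free_eval_natural[OF V.Ob_module[OF finite_lessThan] W.Ob_module[OF finite_lessThan] h]
  show ?thesis
  proof (rule system_vanish_iso[OF system_map_fi_hom[OF V W \<phi> V.subgroups_full kernel_subgroups[OF V W \<phi>] _ L(1) W.subgroups_zero]])
    fix m y assume y: "y \<in> preim W L m"
    then obtain v where v: "v \<in> carrier (Ob V {..<m})" "free_eval (Ob W {..<m}) y = \<phi> {..<m} v"
      using L(2)[of "{..<m}"] by (auto simp: preim_def)
    have fv: "frag_of v \<in> fi_full V m" using v(1) free_eval(2)[OF V.Ob_module] by (simp add: preim_def)
    have pv: "\<phi> {..<m} v \<in> carrier (Ob W {..<m})" by (rule mod_homsD(1)[OF h v(1)])
    have "frag_map (\<phi> {..<m}) (frag_of v) \<in> fi_full W m"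
      "free_eval (Ob W {..<m}) (frag_map (\<phi> {..<m}) (frag_of v)) = \<phi> {..<m} v"
      using pv free_eval(2)[OF W.Ob_module[OF finite_lessThan] pv] by (simp_all add: preim_def)
    then have "y - frag_map (\<phi> {..<m}) (frag_of v) \<in> fi_zero W m"
      using preim_diff_zero[OF W preim_sub(1)[OF L(1) y]] v(2) by simp
    then show "\<exists>x\<in>fi_full V m. y - frag_map (\<phi> {..<m}) x \<in> fi_zero W m" using fv by blast
  next
    fix m x assume "x \<in> fi_full V m" "frag_map (\<phi> {..<m}) x \<in> fi_zero W m"
    then show "x \<in> preim V (fi_ker V W \<phi>) m" using nat[of x m] by (simp add: preim_def fi_ker_iff)
  next
    fix X x assume X: "finite (X :: nat set)"
    show "x \<in> carrier (Ob V X) \<Longrightarrow> \<phi> X x \<in> L X" using L(2)[OF X] by blast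
    show "x \<in> fi_ker V W \<phi> X \<Longrightarrow> x \<in> carrier (Ob V X)" "x \<in> fi_ker V W \<phi> X \<Longrightarrow> \<phi> X x \<in> {\<zero>\<^bsub>Ob W X\<^esub>}"
      by (simp_all add: fi_ker_iff)
  next
    fix X x assume X: "finite (X :: nat set)" and "x \<in> {\<zero>\<^bsub>Ob W X\<^esub>}"
    then show "x \<in> L X" using fi_subgroupsD(2)[OF L(1) X] by simp
  qed
qed

lemma subcomplex_preim:
  assumes P: "fi_module R P" and K: "fi_subgroups P K"
  shows "subcomplex (bd (fi_act P)) (cubes (fi_full P) n) (cubes (fi_zero P) n) (cubes (preim P K) n)"
proof -
  interpret fi_module R P by fact
  interpret S: fi_system "fi_act P" "fi_full P" "fi_zero P" by (rule fi_system_full_zero[OF P])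
  interpret K: fi_action "fi_act P" "preim P K" by (rule fi_action_preim[OF K])
  show ?thesis
  proof (intro subcomplex.intro S.graded_complex subcomplex_axioms.intro)
    show "bd (fi_act P) x \<in> cubes (preim P K) n (a - 1)" if "x \<in> cubes (preim P K) n a" for x a
    proof (rule cubesI)
      fix l :: "bool list" assume "length l = n" "int (trues l) = a - 1"
      then show "bd (fi_act P) x l \<in> preim P K (falses l)"
        by (intro bd_in[OF K.fi_action_axioms] cubesD[OF that]) auto
    qed
    show "x \<in> cubes (preim P K) n a" if "x \<in> cubes (fi_zero P) n a" for x a
      using that preim_sub(2)[OF K] by (auto simp: cubes_def)
    show "x \<in> cubes (fi_full P) n a" if "x \<in> cubes (preim P K) n a" for x a
      using that preim_sub(1)[OF K] by (auto simp: cubes_def)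
  qed (auto simp: cubes_def K.A_diff)
qed

locale fi_resolution =
  fixes R :: "('k, 'r) ring_scheme" and V :: "('k, 'a) fi_mod" and P :: "nat \<Rightarrow> ('k, 'b) fi_mod" and d \<epsilon>
  assumes R: "cring R" and V: "fi_module R V" and res: "projective_resolution R V P d \<epsilon>"
begin

text \<open>Indexed so that \<open>P a / syz a\<close> is isomorphic to \<open>V\<close> for
  \<open>a = 0\<close> and to \<open>syz (a - 1)\<close> for \<open>a > 0\<close>.\<close>

definition syz :: "nat \<Rightarrow> nat set \<Rightarrow> 'b set"
  where "syz a = (case a of 0 \<Rightarrow> fi_ker (P 0) V \<epsilon> | Suc b \<Rightarrow> fi_ker (P (Suc b)) (P b) (d b))"

lemma P: "fi_module R (P a)" and proj: "fi_projective R (P a)" and d: "fi_hom R (P (Suc a)) (P a) (d a)"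
  and \<epsilon>: "fi_hom R (P 0) V \<epsilon>"
  using res by (auto simp: projective_resolution_def fi_projective_def)

lemma syz_subgroups: "fi_subgroups (P a) (syz a)"
  unfolding syz_def using kernel_subgroups[OF P V \<epsilon>] kernel_subgroups[OF P P d] by (cases a) auto

lemma im_syz: "finite X \<Longrightarrow> d a X ` carrier (Ob (P (Suc a)) X) = syz a X"
  using res unfolding projective_resolution_def fi_exact_def syz_def fi_im_def by (cases a) auto

lemma dh: "finite X \<Longrightarrow> d a X \<in> mod_homs R (Ob (P (Suc a)) X) (Ob (P a) X)"
  using d by (simp add: fi_hom_def)

abbreviation "dP a \<equiv> bd (fi_act (P a))"
abbreviation "cP a n \<equiv> cubes (fi_full (P a)) n"
abbreviation "zP a n \<equiv> cubes (fi_zero (P a)) n"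
abbreviation "sP a n \<equiv> cubes (preim (P a) (syz a)) n"
abbreviation "obP a n \<equiv> Ob (P a) {..<n}"
abbreviation "quot_vanish a \<equiv> vanish (fi_act (P a)) (fi_full (P a)) (preim (P a) (syz a))"

lemma hvanish_quot: "hvanish V b n \<longleftrightarrow> quot_vanish 0 b n"
proof -
  have "preim V (\<lambda>X. carrier (Ob V X)) = fi_full V" ..
  moreover have "\<epsilon> X ` carrier (Ob (P 0) X) = carrier (Ob V X)" if "finite X" for X
    using res that by (simp add: projective_resolution_def fi_epi_def)
  ultimately show ?thesis
    using vanish_hom_iso[OF P V \<epsilon> fi_module.subgroups_full[OF V]] by (simp add: hvanish_def syz_def)
qed

lemma P_acyc: "b \<ge> 1 \<Longrightarrow> acyc (dP a) (cP a n) (zP a n) b"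
  using projective_hvanish[OF R proj, of b a n] by (simp add: hvanish_def vanish_def)

text \<open>Dimension shift along \<open>0 \<rightarrow> syz a \<rightarrow> P a \<rightarrow> P a /
  syz a \<rightarrow> 0\<close>. For \<open>b \<ge> 1\<close> the projective middle term has no
  homology in degrees \<open>b\<close> and \<open>b + 1\<close>, and \<open>syz a\<close> is the
  next quotient \<open>P (Suc a) / syz (Suc a)\<close>.\<close>

lemma quot_vanish_Suc:
  assumes "b \<ge> 1" shows "quot_vanish a (b + 1) n \<longleftrightarrow> quot_vanish (Suc a) b n"
proof -
  interpret subcomplex "dP a" "cP a n" "zP a n" "sP a n"
    by (rule subcomplex_preim[OF P syz_subgroups])
  have "quot_vanish a (b + 1) n \<longleftrightarrow> vanish (fi_act (P a)) (preim (P a) (syz a)) (fi_zero (P a)) b n"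
    unfolding vanish_def by (rule acyc_shift) (use assms P_acyc in auto)
  also have "\<dots> \<longleftrightarrow> quot_vanish (Suc a) b n"
    using vanish_hom_iso[OF P P d syz_subgroups im_syz, of a b n] by (simp add: syz_def)
  finally show ?thesis .
qed

lemma quot_vanish_shift: "quot_vanish a (int b + 1) n \<longleftrightarrow> quot_vanish (a + b) 1 n"
proof (induction b arbitrary: a)
  case (Suc b)
  show ?case using quot_vanish_Suc[of "int b + 1" a n] Suc[of "Suc a"] by (simp add: algebra_simps)
qed simp

abbreviation "ev a n x \<equiv> free_eval (obP a n) x"

lemma ev_top: "c \<in> cP a n 0 \<Longrightarrow> ev a n (c (replicate n False)) \<in> carrier (obP a n)"
  "c \<in> cP a n 0 \<Longrightarrow> c (replicate n False) \<in> fi_full (P a) n"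
  using cubesD[of c "fi_full (P a)" n 0 "replicate n False"] by (simp_all add: preim_def)

lemma J_iff: "x \<in> fi_J R (P a) {..<n} \<longleftrightarrow>
  (\<exists>c\<in>cP a n 1. x = ev a n (dP a c (replicate n False)))"
  unfolding J_eq_boundaries[OF P] by blast

lemma const_cubes:
  assumes "x \<in> carrier (obP a n)" "x \<in> N {..<n}"
  shows "(\<lambda>_. frag_of x) \<in> cubes (preim (P a) N) n 0"
  using free_eval(2)[OF fi_module.Ob_module[OF P], of "{..<n}" x a] assms
  by (intro cubes_const) (simp add: preim_def)

text \<open>Together with \<open>lift_d_surj\<close> this gives
  \<open>J(syz a) = d a (J(P (Suc a)))\<close>, where \<open>J\<close> is read as the boundaries of
  1-chains.\<close>

lemma lift_d:
  assumes c: "c \<in> cP (Suc a) n 1"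
  shows "lift (\<lambda>m. frag_map (d a {..<m})) c \<in> sP a n 1"
    "ev a n (dP a (lift (\<lambda>m. frag_map (d a {..<m})) c) (replicate n False))
      = d a {..<n} (ev (Suc a) n (dP (Suc a) c (replicate n False)))"
proof -
  let ?L = "lift (\<lambda>m. frag_map (d a {..<m}))"
  interpret complex_map "dP (Suc a)" "cP (Suc a) n" "zP (Suc a) n"
    "dP a" "cP a n" "zP a n" ?L
    by (rule system_map.complex_map[OF system_map_full_zero[OF P P d]])
  note nat = free_eval_natural[OF fi_module.Ob_module[OF P finite_lessThan] fi_module.Ob_module[OF P finite_lessThan] dh[OF finite_lessThan]]
  show "?L c \<in> sP a n 1"
  proof (rule cubesI)
    fix l assume l: "length l = n" "int (trues l) = 1"
    let ?k = "falses l"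
    have cl: "c l \<in> fi_full (P (Suc a)) ?k" by (rule cubesD[OF c l])
    have "d a {..<?k} (ev (Suc a) ?k (c l)) \<in> syz a {..<?k}" using im_syz[of "{..<?k}" a] cl by (auto simp: preim_def)
    then show "?L c l \<in> preim (P a) (syz a) ?k" using nat[of "c l" a] cl by (simp add: lift_def preim_def)
  qed
  have b: "dP (Suc a) c \<in> cP (Suc a) n 0" using S.d_C[OF c] by simp
  have "dP a (?L c) - ?L (dP (Suc a) c) \<in> zP a n 0"
    using \<phi>_d[OF c] by simp
  then have "ev a n (dP a (?L c) (replicate n False)) = ev a n (?L (dP (Suc a) c) (replicate n False))"
    using cubes_zero_iff[OF P, of "dP a (?L c)" a n "?L (dP (Suc a) c)"] T.d_C[OF \<phi>_C[OF c]] \<phi>_C[OF b] by simp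
  also have "\<dots> = d a {..<n} (ev (Suc a) n (dP (Suc a) c (replicate n False)))"
    using nat(1)[of "dP (Suc a) c (replicate n False)"] ev_top(2)[OF b] by (simp add: lift_def preim_def)
  finally show "ev a n (dP a (?L c) (replicate n False))
      = d a {..<n} (ev (Suc a) n (dP (Suc a) c (replicate n False)))" .
qed

lemma lift_d_surj:
  assumes v: "v \<in> sP a n 1"
  obtains c where "c \<in> cP (Suc a) n 1"
    "ev a n (dP a v (replicate n False)) = d a {..<n} (ev (Suc a) n (dP (Suc a) c (replicate n False)))"
proof -
  interpret Sub: subcomplex "dP a" "cP a n" "zP a n" "sP a n"
    by (rule subcomplex_preim[OF P syz_subgroups])
  have "\<exists>y. length l = n \<and> int (trues l) = 1 \<longrightarrow> y \<in> carrier (Ob (P (Suc a)) {..<falses l}) \<and>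
      ev a (falses l) (v l) = d a {..<falses l} y" for l
  proof (cases "length l = n \<and> int (trues l) = 1")
    case True
    then have "ev a (falses l) (v l) \<in> syz a {..<falses l}"
      using cubesD[OF v, of l] by (simp add: preim_def)
    then show ?thesis using im_syz[of "{..<falses l}" a] by auto
  qed blast
  then obtain y where y: "\<And>l. length l = n \<and> int (trues l) = 1 \<longrightarrow>
      y l \<in> carrier (Ob (P (Suc a)) {..<falses l}) \<and> ev a (falses l) (v l) = d a {..<falses l} (y l)"
    by metis
  let ?c = "\<lambda>l. frag_of (y l)" and ?L = "lift (\<lambda>m. frag_map (d a {..<m}))"
  note e2 = free_eval(2)[OF fi_module.Ob_module[OF P finite_lessThan]]
  have c: "?c \<in> cP (Suc a) n 1"
    by (rule cubesI) (use y e2 in \<open>simp add: preim_def\<close>)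
  have diff: "v - ?L ?c \<in> zP a n 1"
  proof (rule cubesI)
    fix l :: "bool list" assume l: "length l = n" "int (trues l) = 1"
    let ?k = "falses l"
    have yl: "y l \<in> carrier (Ob (P (Suc a)) {..<?k})" "ev a ?k (v l) = d a {..<?k} (y l)" using y l by auto
    have dy: "d a {..<?k} (y l) \<in> carrier (Ob (P a) {..<?k})" by (rule mod_homsD(1)[OF dh yl(1)]) simp
    have "frag_of (d a {..<?k} (y l)) \<in> fi_full (P a) ?k" using dy e2[OF dy] by (simp add: preim_def)
    moreover have "v l \<in> fi_full (P a) ?k" using preim_sub(1)[OF syz_subgroups cubesD[OF v l]] .
    ultimately have "v l - frag_of (d a {..<?k} (y l)) \<in> fi_zero (P a) ?k"
      using preim_diff_zero[OF P, of "v l" a ?k] e2[OF dy] yl(2) by simp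
    then show "(v - ?L ?c) l \<in> fi_zero (P a) ?k" by (simp add: lift_def)
  qed
  have L: "?L ?c \<in> cP a n 1" by (rule Sub.W_C[OF lift_d(1)[OF c]])
  have "dP a v - dP a (?L ?c) \<in> zP a n 0"
    using Sub.d_N[OF diff] by (simp add: Sub.d_diff)
  then have "ev a n (dP a v (replicate n False)) = ev a n (dP a (?L ?c) (replicate n False))"
    using cubes_zero_iff[OF P, of "dP a v" a n "dP a (?L ?c)"] Sub.d_C[OF Sub.W_C[OF v]] Sub.d_C[OF L] by simp
  then show ?thesis using that[OF c] lift_d(2)[OF c] by simp
qed

text \<open>\<open>H_1(P a / syz a) = 0\<close> means that
  \<open>H_0(syz a) \<rightarrow> H_0(P a)\<close> is injective: if \<open>d x\<close> lies in
  \<open>J(P a)\<close>, it lies in \<open>J(syz a)\<close>, so \<open>d x = d j\<close> for some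
  \<open>j\<close> in \<open>J(P (Suc a))\<close>. Then \<open>x - j\<close> is in the kernel of
  \<open>d a\<close>, which is the image of \<open>d (Suc a)\<close>; this is exactness of
  \<open>F(P)\<close> at \<open>Suc a\<close>.\<close>

lemma quot_vanish_exact: "quot_vanish a 1 n \<longleftrightarrow> F_exact_at R P d (Suc a) {..<n}"
proof -
  interpret subcomplex "dP a" "cP a n" "zP a n" "sP a n"
    by (rule subcomplex_preim[OF P syz_subgroups])
  interpret M1: Module.module R "obP (Suc a) n" by (rule fi_module.Ob_module[OF P]) simp
  interpret M0: Module.module R "obP a n" by (rule fi_module.Ob_module[OF P]) simp
  let ?bd = "dP a" and ?t = "replicate n False" and ?d = "d a {..<n}"
  note dh' = dh[of "{..<n}" a, simplified]
  have bd0: "?bd c \<in> cP a n 0" if "c \<in> cP a n 1" for c using d_C[OF that] by simp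
  have bd1: "dP (Suc a) c \<in> cP (Suc a) n 0" if "c \<in> cP (Suc a) n 1" for c
    using graded_complex.d_C[OF fi_system.graded_complex[OF fi_system_full_zero[OF P]] that] by simp
  have ker: "?d x = ?d y \<longleftrightarrow> (\<exists>z\<in>carrier (obP (Suc (Suc a)) n). x \<ominus>\<^bsub>obP (Suc a) n\<^esub> y = d (Suc a) {..<n} z)"
    if "x \<in> carrier (obP (Suc a) n)" "y \<in> carrier (obP (Suc a) n)" for x y
  proof -
    have "?d x = ?d y \<longleftrightarrow> ?d (x \<ominus>\<^bsub>obP (Suc a) n\<^esub> y) = \<zero>\<^bsub>obP a n\<^esub>"
      using mod_homs_diff[OF M1.module_axioms M0.module_axioms dh' that] mod_homsD(1)[OF dh'] that
      by (simp add: M0.minus_eq) (metis M0.add.inv_closed M0.minus_equality M0.minus_minus M0.r_neg)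
    also have "\<dots> \<longleftrightarrow> x \<ominus>\<^bsub>obP (Suc a) n\<^esub> y \<in> syz (Suc a) {..<n}"
      using that by (simp add: syz_def fi_ker_iff)
    finally show ?thesis using im_syz[of "{..<n}" "Suc a"] by auto
  qed
  have swap: "x \<ominus>\<^bsub>obP (Suc a) n\<^esub> y = z \<longleftrightarrow> x \<ominus>\<^bsub>obP (Suc a) n\<^esub> z = y"
    if "x \<in> carrier (obP (Suc a) n)" "y \<in> carrier (obP (Suc a) n)" "z \<in> carrier (obP (Suc a) n)" for x y z
    using that by (metis M1.add.inv_solve_right' M1.minus_eq M1.a_comm M1.minus_closed)
  have dc: "d (Suc a) {..<n} z \<in> carrier (obP (Suc a) n)" if "z \<in> carrier (obP (Suc (Suc a)) n)" for z
    using mod_homsD(1)[OF dh that] by simp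
  have "quot_vanish a 1 n \<longleftrightarrow>
    (\<forall>w\<in>sP a n 0. (\<exists>c\<in>cP a n 1. w - ?bd c \<in> zP a n 0) \<longrightarrow>
      (\<exists>v\<in>sP a n 1. w - ?bd v \<in> zP a n 0))"
    using acyc_shift_0[of 0] P_acyc[of 1 a n] by (simp add: vanish_def)
  also have "\<dots> \<longleftrightarrow> (\<forall>x\<in>carrier (obP (Suc a) n). ?d x \<in> fi_J R (P a) {..<n} \<longrightarrow>
      (\<exists>j\<in>fi_J R (P (Suc a)) {..<n}. ?d x = ?d j))" (is "?L \<longleftrightarrow> ?R")
  proof
    assume L: ?L
    show ?R
    proof (intro ballI impI)
      fix x assume x: "x \<in> carrier (obP (Suc a) n)" "?d x \<in> fi_J R (P a) {..<n}"
      have dx: "?d x \<in> carrier (obP a n)" "?d x \<in> syz a {..<n}"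
        using mod_homsD(1)[OF dh' x(1)] im_syz[of "{..<n}" a] x(1) by auto
      have w: "(\<lambda>_. frag_of (?d x)) \<in> sP a n 0" by (rule const_cubes[where N = "syz a", OF dx])
      have e: "ev a n (frag_of (?d x)) = ?d x" by (rule free_eval(2)[OF M0.module_axioms dx(1)])
      obtain c where c: "c \<in> cP a n 1" "?d x = ev a n (?bd c ?t)" using x(2) unfolding J_iff by blast
      then have "(\<lambda>_. frag_of (?d x)) - ?bd c \<in> zP a n 0"
        using cubes_zero_iff[OF P W_C[OF w] bd0[OF c(1)]] e by simp
      with L w c(1) obtain v where v: "v \<in> sP a n 1" "(\<lambda>_. frag_of (?d x)) - ?bd v \<in> zP a n 0"
        by blast
      then have "?d x = ev a n (?bd v ?t)" using cubes_zero_iff[OF P W_C[OF w] bd0[OF W_C[OF v(1)]]] e by simp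
      moreover obtain c' where c': "c' \<in> cP (Suc a) n 1"
        "ev a n (?bd v ?t) = ?d (ev (Suc a) n (dP (Suc a) c' ?t))" by (rule lift_d_surj[OF v(1)])
      moreover have "ev (Suc a) n (dP (Suc a) c' ?t) \<in> fi_J R (P (Suc a)) {..<n}"
        using c'(1) unfolding J_iff by blast
      ultimately show "\<exists>j\<in>fi_J R (P (Suc a)) {..<n}. ?d x = ?d j" by metis
    qed
  next
    assume Rr: ?R
    show ?L
    proof (intro ballI impI)
      fix w assume w: "w \<in> sP a n 0" "\<exists>c\<in>cP a n 1. w - ?bd c \<in> zP a n 0"
      then obtain c where c: "c \<in> cP a n 1" "w - ?bd c \<in> zP a n 0" by blast
      have "ev a n (w ?t) \<in> syz a {..<n}" using cubesD[OF w(1), of ?t] by (simp add: preim_def)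
      then obtain x where x: "x \<in> carrier (obP (Suc a) n)" "ev a n (w ?t) = ?d x" using im_syz[of "{..<n}" a] by auto
      have "?d x = ev a n (?bd c ?t)" using cubes_zero_iff[OF P W_C[OF w(1)] bd0[OF c(1)]] c(2) x(2) by simp
      then have "?d x \<in> fi_J R (P a) {..<n}" using c(1) unfolding J_iff by blast
      then obtain j where j: "j \<in> fi_J R (P (Suc a)) {..<n}" "?d x = ?d j" using Rr x(1) by blast
      then obtain c' where c': "c' \<in> cP (Suc a) n 1" "j = ev (Suc a) n (dP (Suc a) c' ?t)"
        unfolding J_iff by blast
      let ?v = "lift (\<lambda>m. frag_map (d a {..<m})) c'"
      have "w - ?bd ?v \<in> zP a n 0"
        using cubes_zero_iff[OF P W_C[OF w(1)] bd0[OF W_C[OF lift_d(1)[OF c'(1)]]]] lift_d(2)[OF c'(1)] c'(2) j(2) x(2) by simp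
      then show "\<exists>v\<in>sP a n 1. w - ?bd v \<in> zP a n 0" using lift_d(1)[OF c'(1)] by blast
    qed
  qed
  also have "\<dots> \<longleftrightarrow> F_exact_at R P d (Suc a) {..<n}"
  proof -
    have "(\<exists>j\<in>fi_J R (P (Suc a)) {..<n}. ?d x = ?d j) \<longleftrightarrow>
        (\<exists>z\<in>carrier (obP (Suc (Suc a)) n). x \<ominus>\<^bsub>obP (Suc a) n\<^esub> d (Suc a) {..<n} z \<in> fi_J R (P (Suc a)) {..<n})"
      if x: "x \<in> carrier (obP (Suc a) n)" for x
    proof
      assume "\<exists>j\<in>fi_J R (P (Suc a)) {..<n}. ?d x = ?d j"
      then obtain j where j: "j \<in> fi_J R (P (Suc a)) {..<n}" "?d x = ?d j" by blast
      have jc: "j \<in> carrier (obP (Suc a) n)" using fi_module.J_carrier[OF P _ j(1)] by simp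
      obtain z where z: "z \<in> carrier (obP (Suc (Suc a)) n)" "x \<ominus>\<^bsub>obP (Suc a) n\<^esub> j = d (Suc a) {..<n} z"
        using ker[OF x jc] j(2) by blast
      then show "\<exists>z\<in>carrier (obP (Suc (Suc a)) n). x \<ominus>\<^bsub>obP (Suc a) n\<^esub> d (Suc a) {..<n} z \<in> fi_J R (P (Suc a)) {..<n}"
        using swap[OF x jc dc[OF z(1)]] j(1) by metis
    next
      assume "\<exists>z\<in>carrier (obP (Suc (Suc a)) n). x \<ominus>\<^bsub>obP (Suc a) n\<^esub> d (Suc a) {..<n} z \<in> fi_J R (P (Suc a)) {..<n}"
      then obtain z where z: "z \<in> carrier (obP (Suc (Suc a)) n)" "x \<ominus>\<^bsub>obP (Suc a) n\<^esub> d (Suc a) {..<n} z \<in> fi_J R (P (Suc a)) {..<n}"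
        (is "?j \<in> _") by blast
      have jc: "?j \<in> carrier (obP (Suc a) n)" using fi_module.J_carrier[OF P _ z(2)] by simp
      have "?d x = ?d ?j" using ker[OF x jc] swap[OF x dc[OF z(1)] jc] z(1) by blast
      then show "\<exists>j\<in>fi_J R (P (Suc a)) {..<n}. ?d x = ?d j" using z(2) by blast
    qed
    then show ?thesis by (simp add: F_exact_at_def)
  qed
  finally show ?thesis .
qed

lemma hvanish_iff_exact: "hvanish V (int (Suc a)) n \<longleftrightarrow> F_exact_at R P d (Suc a) {..<n}"
  using quot_vanish_shift[of 0 a n] by (simp add: hvanish_quot quot_vanish_exact add.commute)

text \<open>\<open>H_0(V)\<close> is \<open>P 0\<close> modulo \<open>syz 0 + J(P 0)\<close>, and
  exactness of \<open>F(P)\<close> at \<open>P 0\<close> says that these two submodules fill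
  \<open>P 0\<close>.\<close>

lemma hvanish_0:
  assumes E: "F_exact_at R P d 0 {..<n}" shows "hvanish V 0 n"
proof -
  interpret Sub: subcomplex "dP 0" "cP 0 n" "zP 0 n" "sP 0 n"
    by (rule subcomplex_preim[OF P syz_subgroups])
  interpret M: Module.module R "obP 0 n" by (rule fi_module.Ob_module[OF P]) simp
  let ?t = "replicate n False"
  have "quot_vanish 0 0 n"
    unfolding vanish_def acyc_def
  proof (intro ballI impI)
    fix c assume c: "c \<in> cP 0 n 0"
    obtain y where y: "y \<in> carrier (obP 1 n)" "ev 0 n (c ?t) \<ominus>\<^bsub>obP 0 n\<^esub> d 0 {..<n} y \<in> fi_J R (P 0) {..<n}"
      using E ev_top(1)[OF c] unfolding F_exact_at_def by auto
    obtain b where b: "b \<in> cP 0 n 1"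
      "ev 0 n (c ?t) \<ominus>\<^bsub>obP 0 n\<^esub> d 0 {..<n} y = ev 0 n (dP 0 b ?t)"
      using y(2) unfolding J_iff by blast
    have bd: "dP 0 b \<in> cP 0 n 0" using Sub.d_C[OF b(1)] by simp
    have dy: "d 0 {..<n} y \<in> carrier (obP 0 n)" "d 0 {..<n} y \<in> syz 0 {..<n}"
      using mod_homsD(1)[OF dh, of "{..<n}" y 0] im_syz[of "{..<n}" 0] y(1) by auto
    have diff: "c ?t - dP 0 b ?t \<in> fi_full (P 0) n"
      using fi_action.A_diff[OF fi_module.fi_action_preim[OF P fi_module.subgroups_full[OF P]]] ev_top(2)[OF c] ev_top(2)[OF bd] by blast
    have "ev 0 n (c ?t - dP 0 b ?t) = ev 0 n (c ?t) \<ominus>\<^bsub>obP 0 n\<^esub> ev 0 n (dP 0 b ?t)"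
      using ev_top(2)[OF c] ev_top(2)[OF bd] by (intro free_eval(4)[OF M.module_axioms]) (auto simp: preim_def)
    also have "\<dots> = d 0 {..<n} y"
      unfolding b(2)[symmetric] using ev_top(1)[OF c] dy(1)
      by (metis M.add.inv_solve_right' M.minus_eq M.a_comm M.minus_closed)
    finally have "c ?t - dP 0 b ?t \<in> preim (P 0) (syz 0) n" using diff dy(2) by (simp add: preim_def)
    moreover have "(c - dP 0 b) l = c ?t - dP 0 b ?t \<and> falses l = n"
      if "length l = n" "int (trues l) = 0" for l
      using list_all_False[of l n] that by simp
    ultimately have "c - dP 0 b \<in> sP 0 n 0"
      by (intro cubesI) metis
    then show "\<exists>b\<in>cP 0 n (0 + 1). c - dP 0 b \<in> sP 0 n 0"
      using b(1) by auto
  qed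
  then show ?thesis by (simp add: hvanish_quot)
qed

end

section \<open>The regularity bound\<close>

lemma pt_map_FI_hom: "f \<in> FI_hom X Y \<Longrightarrow> pt_map X f \<in> FI_hom (pt_add X) (pt_add Y)"
  by (auto simp: FI_hom_def pt_map_def pt_add_def inj_on_def)

lemma pt_map_id: "pt_map X (\<lambda>x\<in>X. x) = (\<lambda>x\<in>pt_add X. x)"
  by (auto simp: pt_map_def pt_add_def fun_eq_iff)

lemma pt_map_compose: "f \<in> FI_hom X Y \<Longrightarrow> pt_map X (compose X g f) = compose (pt_add X) (pt_map Y g) (pt_map X f)"
  by (auto simp: pt_map_def pt_add_def fun_eq_iff compose_def FI_hom_def)

lemma finite_pt_add: "finite X \<Longrightarrow> finite (pt_add X)"
  by (simp add: pt_add_def)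

lemma fi_module_shift:
  assumes "fi_module R V" shows "fi_module R (fi_shift V)"
proof -
  interpret fi_module R V by fact
  show ?thesis
    by (rule fi_module.intro)
      (simp_all add: fi_shift_def finite_pt_add Ob_module Ar_hom pt_map_FI_hom pt_map_id Ar_id pt_map_compose Ar_comp)
qed

lemma pt_add_lessThan: "pt_add {..<m} = {..<Suc m}"
  by (simp add: pt_add_def lessThan_Suc_eq_insert_0)

text \<open>An equality rather than an isomorphism, because \<open>pt_add\<close> also puts the new
  point at 0.\<close>

lemma fi_act_shift: "fi_act (fi_shift V) = shift_front (fi_act V)"
proof -
  have "pt_map {..<m} (restrict f {..<m}) = restrict (up f) {..<Suc m}" for m f
    by (auto simp: pt_map_def pt_add_lessThan fun_eq_iff up_def restrict_def split: nat.split)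
  note this[simp]
  show ?thesis by (intro ext) (simp add: fi_act_def shift_front_def fi_shift_def pt_add_lessThan)
qed

lemma preim_shift: "fi_full (fi_shift V) = shift_set (fi_full V)" "fi_zero (fi_shift V) = shift_set (fi_zero V)"
  by (simp_all add: preim_def shift_set_def fi_shift_def pt_add_lessThan fun_eq_iff)

lemma hvanish_shift: "hvanish ((fi_shift ^^ i) V) a n \<longleftrightarrow>
  vanish (shiftF i (fi_act V)) (shiftS i (fi_full V)) (shiftS i (fi_zero V)) a n"
proof -
  have "fi_act ((fi_shift ^^ i) V) = shiftF i (fi_act V) \<and> fi_full ((fi_shift ^^ i) V) = shiftS i (fi_full V)
    \<and> fi_zero ((fi_shift ^^ i) V) = shiftS i (fi_zero V)"
    by (induction i) (simp_all add: fi_act_shift preim_shift)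
  then show ?thesis by (simp add: hvanish_def)
qed

lemma fi_module_shifts: "fi_module R V \<Longrightarrow> fi_module R ((fi_shift ^^ i) V)"
  by (induction i) (simp_all add: fi_module_shift)

lemma fi_homology_exact:
  fixes V :: "('k, 'a) fi_mod"
  assumes R: "cring R" and V: "fi_module R V"
  obtains P :: "nat \<Rightarrow> ('k, ('k, 'a) univ) fi_mod" and d \<epsilon>
  where "fi_resolution R V P d \<epsilon>"
    "\<And>a X. finite X \<Longrightarrow> trivial_at (fi_homology R a V) X \<longleftrightarrow> F_exact_at R P d a {..<card X}"
proof -
  obtain P :: "nat \<Rightarrow> ('k, ('k, 'a) univ) fi_mod" and d where Pd: "chosen_resolution R V = (P, d)" by (cases "chosen_resolution R V")
  have "\<exists>x. case x of (P :: nat \<Rightarrow> ('k, ('k, 'a) univ) fi_mod, d) \<Rightarrow> \<exists>\<epsilon>. projective_resolution R V P d \<epsilon>"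
    using ex_projective_resolution[OF R V] by auto
  from someI_ex[OF this, folded chosen_resolution_def] obtain \<epsilon> where res: "projective_resolution R V P d \<epsilon>"
    unfolding Pd by auto
  interpret fi_resolution R V P d \<epsilon> by (intro fi_resolution.intro R V res)
  have "trivial_at (fi_homology R a V) X \<longleftrightarrow> F_exact_at R P d a {..<card X}"
    if X: "finite X" for a X
  proof -
    have "trivial_at (fi_homology R a V) X \<longleftrightarrow> F_exact_at R P d a X"
      unfolding fi_homology_def Pd case_prod_conv by (rule F_exact_at_iff[where P = P and d = d, OF P d X])
    also have "\<dots> \<longleftrightarrow> F_exact_at R P d a {..<card X}"
      using F_exact_at_transport[where P = P and d = d and a = a, OF P d, of X "{..<card X}"]
        F_exact_at_transport[where P = P and d = d and a = a, OF P d, of "{..<card X}" X] X by auto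
    finally show ?thesis .
  qed
  then show ?thesis by (rule that[OF fi_resolution_axioms])
qed

lemma homology_trivial_iff:
  fixes V :: "('k, 'a) fi_mod"
  assumes "cring R" "fi_module R V" "finite X"
  shows "trivial_at (fi_homology R (Suc a) V) X \<longleftrightarrow> hvanish V (int (Suc a)) (card X)"
proof (rule fi_homology_exact[OF assms(1,2)])
  fix P :: "nat \<Rightarrow> ('k, ('k, 'a) univ) fi_mod" and d \<epsilon>
  assume "fi_resolution R V P d \<epsilon>" and
    *: "\<And>a X. finite X \<Longrightarrow> trivial_at (fi_homology R a V) X \<longleftrightarrow> F_exact_at R P d a {..<card X}"
  then interpret fi_resolution R V P d \<epsilon> by simp
  show ?thesis unfolding *[OF assms(3)] hvanish_iff_exact ..
qed

lemma hvanish_0_homology: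
  fixes V :: "('k, 'a) fi_mod"
  assumes "cring R" "fi_module R V" "finite X" "trivial_at (fi_homology R 0 V) X"
  shows "hvanish V 0 (card X)"
proof (rule fi_homology_exact[OF assms(1,2)])
  fix P :: "nat \<Rightarrow> ('k, ('k, 'a) univ) fi_mod" and d \<epsilon>
  assume "fi_resolution R V P d \<epsilon>" and
    *: "\<And>a X. finite X \<Longrightarrow> trivial_at (fi_homology R a V) X \<longleftrightarrow> F_exact_at R P d a {..<card X}"
  then interpret fi_resolution R V P d \<epsilon> by simp
  show ?thesis by (rule hvanish_0) (use assms(4) in \<open>unfold *[OF assms(3)]\<close>)
qed

lemma F_acyclic_iff:
  assumes "cring R" "fi_module R V"
  shows "F_acyclic R V \<longleftrightarrow> (\<forall>a\<ge>1. \<forall>n. hvanish V a n)"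
proof
  assume F: "F_acyclic R V"
  show "\<forall>a\<ge>1. \<forall>n. hvanish V a n"
  proof (intro allI impI)
    fix a :: int and n assume a: "a \<ge> 1"
    define b where "b = nat (a - 1)"
    have ab: "a = int (Suc b)" using a by (simp add: b_def)
    have "trivial_at (fi_homology R (Suc b) V) {..<n}"
      using F[unfolded F_acyclic_def, THEN spec, THEN mp, THEN spec, THEN mp, of "Suc b" "{..<n}"] by simp
    from iffD1[OF homology_trivial_iff[OF assms finite_lessThan] this]
    show "hvanish V a n" unfolding ab card_lessThan .
  qed
next
  assume H: "\<forall>a\<ge>1. \<forall>n. hvanish V a n"
  show "F_acyclic R V"
    unfolding F_acyclic_def
  proof (intro allI impI)
    fix a :: nat and X :: "nat set" assume a: "1 \<le> a" "finite X"
    then obtain b where b: "a = Suc b" by (cases a) auto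
    have "hvanish V (int (Suc b)) (card X)" using H by simp
    from iffD2[OF homology_trivial_iff[OF assms a(2)] this]
    show "trivial_at (fi_homology R a V) X"
      unfolding b .
  qed
qed

lemma homology_trivial_initial:
  assumes "cring R" "fi_module R V"
  shows "trivial_at (fi_homology R (Suc a) V) {1..n} \<longleftrightarrow> hvanish V (int (Suc a)) n"
proof -
  have c: "card {1..n} = n" by simp
  have f: "finite {1..n}" by simp
  note homology_trivial_iff[OF assms f]
  from this[unfolded c] show ?thesis .
qed

lemma fi_hd_ge:
  assumes "cring R" "fi_module R V" "\<not> hvanish V (int (Suc a)) n"
  shows "ereal (real n) \<le> fi_hd R (Suc a) V"
  unfolding fi_hd_def fi_deg_def
  unfolding homology_trivial_initial[OF assms(1,2)] by (rule SUP_upper) (use assms(3) in blast)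

lemma fi_hd_leI:
  assumes "cring R" "fi_module R V" "\<And>n. real n > x \<Longrightarrow> hvanish V (int (Suc a)) n"
  shows "fi_hd R (Suc a) V \<le> ereal x"
  unfolding fi_hd_def fi_deg_def
  unfolding homology_trivial_initial[OF assms(1,2)]
  by (rule SUP_least) (use assms(3) in force)

lemma generated_hvanish:
  assumes "cring R" "fi_module R V" "generated_le R k V" "n > k"
  shows "hvanish V 0 n"
proof (rule ccontr)
  assume *: "\<not> hvanish V 0 n"
  have "carrier (Ob (fi_homology R 0 V) {1..n}) \<noteq> {\<zero>\<^bsub>Ob (fi_homology R 0 V) {1..n}\<^esub>}"
    using hvanish_0_homology[OF assms(1,2), of "{1..n}"] * by fastforce
  then have "ereal (real n) \<le> fi_hd R 0 V" unfolding fi_hd_def fi_deg_def by (intro SUP_upper) blast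
  also have "\<dots> \<le> ereal (real k)" using assms(3) unfolding generated_le_def .
  finally show False using assms(4) by simp
qed

text \<open>\<open>H_0(P) \<rightarrow> H_0(V)\<close> is onto, and \<open>H_1(V)\<close> embeds
  into \<open>H_0(W)\<close> because \<open>H_1(P) = 0\<close>.\<close>

lemma presentation_hvanish:
  assumes R: "cring R" and G: "gen_rel_presentation R k d W P V \<iota> \<pi>"
  shows "n > k \<Longrightarrow> hvanish V 0 n" "n > d \<Longrightarrow> hvanish V 1 n"
proof -
  have W: "fi_module R W" and P: "fi_module R P" and V: "fi_module R V" and \<iota>: "fi_hom R W P \<iota>" and \<pi>: "fi_hom R P V \<pi>"
    and mono: "fi_mono W \<iota>" and ex: "fi_exact W P V \<iota> \<pi>" and epi: "fi_epi P V \<pi>"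
    and proj: "fi_projective R P" and gP: "generated_le R k P" and gW: "generated_le R d W"
    using G by (auto simp: gen_rel_presentation_def fi_short_exact_def)
  note K = kernel_subgroups[OF P V \<pi>]
  interpret subcomplex "bd (fi_act P)" "cubes (fi_full P) n" "cubes (fi_zero P) n" "cubes (preim P (fi_ker P V \<pi>)) n" for n
    by (rule subcomplex_preim[OF P K])
  have V_quot: "hvanish V b n \<longleftrightarrow> acyc (bd (fi_act P)) (cubes (fi_full P) n) (cubes (preim P (fi_ker P V \<pi>)) n) b" for b n
    using vanish_hom_iso[OF P V \<pi> fi_module.subgroups_full[OF V]] epi by (simp add: hvanish_def vanish_def fi_epi_def)
  have ker: "fi_ker W P \<iota> X = {\<zero>\<^bsub>Ob W X\<^esub>}" if X: "finite X" for X
  proof -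
    have h: "\<iota> X \<in> mod_homs R (Ob W X) (Ob P X)" using \<iota> X by (simp add: fi_hom_def)
    have z: "\<zero>\<^bsub>Ob W X\<^esub> \<in> carrier (Ob W X)" using fi_subgroupsD(2)[OF fi_module.subgroups_full[OF W] X] .
    have "\<iota> X \<zero>\<^bsub>Ob W X\<^esub> = \<zero>\<^bsub>Ob P X\<^esub>" by (rule mod_homs_zero[OF fi_module.Ob_module[OF W X] fi_module.Ob_module[OF P X] h])
    then show ?thesis using mono X z unfolding fi_mono_def inj_on_def by (auto simp: fi_ker_iff)
  qed
  have W_iso: "hvanish W b n \<longleftrightarrow> acyc (bd (fi_act P)) (cubes (preim P (fi_ker P V \<pi>)) n) (cubes (fi_zero P) n) b" for b n
  proof -
    have "fi_zero W = preim W (fi_ker W P \<iota>)" using ker by (simp add: preim_def fun_eq_iff)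
    then show ?thesis
      using vanish_hom_iso[OF W P \<iota> K] ex by (simp add: hvanish_def vanish_def fi_exact_def fi_im_def)
  qed
  show "hvanish V 0 n" if "n > k"
  proof -
    have "acyc (bd (fi_act P)) (cubes (fi_full P) n) (cubes (fi_zero P) n) 0"
      using generated_hvanish[OF R P gP that] by (simp add: hvanish_def vanish_def)
    then show ?thesis
      unfolding V_quot acyc_def using N_W cubes_negative[of "0 - 1" _ "fi_zero P" n] by (metis diff_0 neg_less_0_iff_less zero_less_one)
  qed
  show "hvanish V 1 n" if "n > d"
  proof -
    have W0: "acyc (bd (fi_act P)) (cubes (preim P (fi_ker P V \<pi>)) n) (cubes (fi_zero P) n) 0"
      using generated_hvanish[OF R W gW that] unfolding W_iso .
    have "\<exists>v\<in>cubes (preim P (fi_ker P V \<pi>)) n 1. w - bd (fi_act P) v \<in> cubes (fi_zero P) n 0"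
      if "w \<in> cubes (preim P (fi_ker P V \<pi>)) n 0" for w
      using acycD[OF W0 that cubes_negative] by simp
    moreover have "acyc (bd (fi_act P)) (cubes (fi_full P) n) (cubes (fi_zero P) n) (0 + 1)"
      using projective_hvanish[OF R proj, of 1 n] by (simp add: hvanish_def vanish_def)
    ultimately show ?thesis using acyc_shift_0[of n 0] by (simp add: V_quot)
  qed
qed

theorem theorem16:
  fixes R :: "('k, 'r) ring_scheme" and V :: "('k, 'a) fi_mod"
    and W :: "('k, 'w) fi_mod" and P :: "('k, 'p) fi_mod" and k d :: nat
  assumes "cring R" and "fi_module R V"
    and "gen_rel_presentation R k d W P V \<iota> \<pi>"
  shows "fi_reg R V \<le> fi_hd1S R V - 1"
proof -
  note RV = assms(1,2)
  note sys = fi_system_full_zero[OF assms(2)]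
  note S = fi_module_shifts[OF assms(2)]
  have "\<exists>i. \<forall>a\<ge>1. \<forall>n. vanish (shiftF i (fi_act V)) (shiftS i (fi_full V)) (shiftS i (fi_zero V)) a n"
    \<comment> \<open>Thresholds are indices from which homology vanishes, hence one above the
      degrees \<open>k\<close> and \<open>d\<close>.\<close>
    by (rule eventually_acyclic[OF sys, of "Suc k" "Suc d"])
      (use presentation_hvanish[OF assms(1,3)] in \<open>auto simp: hvanish_def\<close>)
  then have "\<exists>i. F_acyclic R ((fi_shift ^^ i) V)"
    using F_acyclic_iff[OF assms(1) S] by (simp add: hvanish_shift)
  then have "F_acyclic R ((fi_shift ^^ fi_N R V) V)" unfolding fi_N_def by (rule LeastI_ex)
  then have N: "vanish (shiftF (fi_N R V) (fi_act V)) (shiftS (fi_N R V) (fi_full V)) (shiftS (fi_N R V) (fi_zero V)) a n"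
    if "a \<ge> 1" for a n
    using F_acyclic_iff[OF assms(1) S] that by (simp add: hvanish_shift)
  \<comment> \<open>An integer \<open>n + i > c + 1\<close> is at least \<open>c + 2\<close>, so the
    strict bound excludes nonzero \<open>H_1\<close> there. In this form it fits a floor as well as
    the value \<open>-\<infinity>\<close>.\<close>
  have key: "fi_reg R V \<le> ereal (real_of_int c)" if c: "fi_hd1S R V < ereal (real_of_int c + 2)" for c
  proof -
    have h1: "vanish (shiftF i (fi_act V)) (shiftS i (fi_full V)) (shiftS i (fi_zero V)) 1 n"
      if "i \<le> fi_N R V" "int n + int i > c + 1" for i n
    proof (rule ccontr)
      assume "\<not> vanish (shiftF i (fi_act V)) (shiftS i (fi_full V)) (shiftS i (fi_zero V)) 1 n"
      then have "ereal (real n) \<le> fi_hd R 1 ((fi_shift ^^ i) V)"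
        using fi_hd_ge[OF assms(1) S[of i], where a = 0 and n = n] by (simp add: hvanish_shift)
      then have "ereal (real n) + ereal (real i) \<le> fi_hd R 1 ((fi_shift ^^ i) V) + ereal (real i)"
        by (rule add_right_mono)
      also have "\<dots> \<le> fi_hd1S R V" unfolding fi_hd1S_def by (rule Max_ge) (use that(1) in auto)
      also note c
      finally show False using that(2) by simp
    qed
    have van: "hvanish V a n" if "a \<ge> 1" "int n > c + a" for a n
      unfolding hvanish_def by (rule regularity_bound[OF sys N h1 that])
    have "fi_hd R a V \<le> ereal (real_of_int c + real a)" if a1: "a \<ge> 1" for a
    proof -
      obtain b where a: "a = Suc b" using a1 by (cases a) auto
      show ?thesis unfolding a
      proof (rule fi_hd_leI[OF RV])
        fix n assume "real_of_int c + real (Suc b) < real n"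
        then have "int n > c + int (Suc b)" by linarith
        then show "hvanish V (int (Suc b)) n" by (intro van) auto
      qed
    qed
    then show ?thesis unfolding fi_reg_def by (intro INF_lower) simp
  qed
  show ?thesis
  proof (cases "fi_hd1S R V")
    case (real r)
    \<comment> \<open>With \<open>c = \<lfloor>r\<rfloor> - 1\<close> the condition of
      \<open>key\<close> is \<open>r < \<lfloor>r\<rfloor> + 1\<close>.\<close>
    have "fi_reg R V \<le> ereal (real_of_int (\<lfloor>r\<rfloor> - 1))"
      by (rule key) (simp add: real, linarith)
    also have "\<dots> \<le> ereal (r - 1)" by simp
    finally show ?thesis by (simp add: real one_ereal_def)
  next
    case PInf
    then show ?thesis by simp
  next
    case MInf
    \<comment> \<open>Here \<open>key\<close> applies to every integer \<open>c\<close>, so the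
      regularity is \<open>-\<infinity>\<close> as well.\<close>
    have "fi_reg R V \<le> ereal B" for B
    proof -
      have "fi_reg R V \<le> ereal (real_of_int \<lfloor>B\<rfloor>)" by (rule key) (simp add: MInf)
      also have "\<dots> \<le> ereal B" by simp
      finally show ?thesis .
    qed
    then have "fi_reg R V = - \<infinity>" by (rule ereal_bot)
    then show ?thesis by simp
  qed
qed

end
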